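(* Let $T\in(0,\infty)$, let $\xi^F,\Phi,\sigma,\nu$ satisfy the noise assumption and the structure assumption stated in the context, and let $\rho_0\in L^1(\Omega;L^1(\mathbb{T}^d))$ be nonnegative and $\mathcal{F}_0$-measurable. If $\rho$ is a stochastic kinetic solution of $$d\rho=\Delta\Phi(\rho)\,dt-\nabla\cdot(\sigma(\rho)\,d\xi^F+\nu(\rho)\,dt)+\tfrac12\nabla\cdot\left(F_1[\sigma'(\rho)]^2\nabla\rho+\sigma(\rho)\sigma'(\rho)F_2\right)dt$$ on $\mathbb{T}^d\times[0,T]$ with initial data $\rho_0$ and with kinetic measure $q$, then almost surely $$\liminf_{\beta\to0}\left(\beta^{-1}q\big(\mathbb{T}^d\times[\tfrac{\beta}{2},\beta]\times[0,T]\big)\right)=0.$$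
   Context: $\mathbb{T}^d$ is the $d$-dimensional torus. Noise assumption. $(\Omega,\mathcal{F},\mathbb{P})$ is a probability space with filtration $(\mathcal{F}_t)_{t\in[0,\infty)}$, $\{B^k\}_{k\in\mathbb{N}}$ are independent $d$-dimensional $\mathcal{F}_t$-Brownian motions, $\{f_k\colon\mathbb{T}^d\to\mathbb{R}\}_{k\in\mathbb{N}}$ are continuously differentiable, $\xi^F=\sum_{k}f_k(x)B^k_t$; the sums $F_1=\sum_kf_k^2$, $F_2=\frac12\sum_k\nabla f_k^2=\sum_kf_k\nabla f_k$, $F_3=\sum_k|\nabla f_k|^2$ are continuous on $\mathbb{T}^d$ and $\nabla\cdot F_2=\frac12\Delta F_1$ is bounded on $\mathbb{T}^d$. Stochastic integrals are defined by $\int_0^t\int_{\mathbb{T}^d}g\,\nabla\cdot(h\,d\xi^F)=\sum_k\big(\int_0^t\int_{\mathbb{T}^d}g f_k\nabla h\cdot dB^k_s+\int_0^t\int_{\mathbb{T}^d}g h\nabla f_k\cdot dB^k_s\big)$ in the It\^o sense. Structure assumption. $\Phi,\sigma\in C([0,\infty))$ and $\nu\in C([0,\infty);\mathbb{R}^d)$ satisfy: (i) $\Phi,\sigma\in C^{1,1}_{\mathrm{loc}}((0,\infty))$, $\nu\in C^1_{\mathrm{loc}}((0,\infty);\mathbb{R}^d)$; (ii) $\Phi(0)=0$ and $\Phi'>0$ on $(0,\infty)$; (iii) for some $c\in(0,\infty)$, $\limsup_{\xi\to0^+}\sigma^2(\xi)/\xi\le c$ (so $\sigma(0)=0$); (iv)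 either $\sigma\sigma'\in C([0,\infty))$ with $(\sigma\sigma')(0)=0$, or $\nabla\cdot F_2=0$; (v) for some $c\in[1,\infty)$, $\sup_{\xi'\in[0,\xi]}\sigma^2(\xi')\le c(1+\xi+\sigma^2(\xi))$ for every $\xi\in[0,\infty)$; (vi) for some $c\in[1,\infty)$, $\sup_{\xi'\in[0,\xi]}|\nu(\xi')|\le c(1+\xi+|\nu(\xi)|)$ for every $\xi\in[0,\infty)$. Kinetic measure. A map $q$ from $\Omega$ to nonnegative, locally finite measures on $\mathbb{T}^d\times(0,\infty)\times[0,T]$ such that for every $\psi\in C_c^\infty(\mathbb{T}^d\times(0,\infty))$ the process $(\omega,t)\mapsto\int_0^t\int_{\mathbb{R}}\int_{\mathbb{T}^d}\psi(x,\xi)\,dq(\omega)$ is $\mathcal{F}_t$-predictable. Stochastic kinetic solution. For nonnegative $\mathcal{F}_0$-measurable $\rho_0\in L^1(\Omega;L^1(\mathbb{T}^d))$, a stochastic kinetic solution is a nonnegative, a.s. continuous $L^1(\mathbb{T}^d)$-valued, $\mathcal{F}_t$-predictable $\rho\in L^1(\Omega\times[0,T];L^1(\mathbb{T}^d))$ with: (1) a.s. for every $t\in[0,T]$, $\|\rho(\cdot,t)\|_{L^1}=\|\rho_0\|_{L^1}$; (2) $\sigma(\rho)\in L^2(\Omega;L^2(\mathbb{T}^d\times[0,T]))$, $\nu(\rho)\in L^1(\Omega;L^1(\mathbb{T}^d\times[0,T];\mathbb{R}^d))$; (3) for every $K\in\mathbb{N}$, $(\rho\wedge K)\vee\frac1K\in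 L^2(\Omega;L^2([0,T];H^1(\mathbb{T}^d)))$; and there exists a kinetic measure $q$ (the kinetic measure of $\rho$) with: (4) a.s. $\delta_0(\xi-\rho)\Phi'(\xi)|\nabla\rho|^2\le q$ as measures on $\mathbb{T}^d\times(0,\infty)\times[0,T]$; (5) $\lim_{M\to\infty}\mathbb{E}[q(\mathbb{T}^d\times[M,M+1]\times[0,T])]=0$; (6) for every $\psi\in C_c^\infty(\mathbb{T}^d\times(0,\infty))$, a.s. for every $t\in[0,T]$, $$\int_{\mathbb{R}}\int_{\mathbb{T}^d}\chi(x,\xi,t)\psi=\int_{\mathbb{R}}\int_{\mathbb{T}^d}\overline\chi(\rho_0)\psi-\int_0^t\!\!\int_{\mathbb{T}^d}\Phi'(\rho)\nabla\rho\cdot(\nabla\psi)(x,\rho)-\tfrac12\int_0^t\!\!\int_{\mathbb{T}^d}F_1[\sigma'(\rho)]^2\nabla\rho\cdot(\nabla\psi)(x,\rho)-\tfrac12\int_0^t\!\!\int_{\mathbb{T}^d}\sigma(\rho)\sigma'(\rho)F_2\cdot(\nabla\psi)(x,\rho)$$ $$-\int_0^t\!\!\int_{\mathbb{R}}\int_{\mathbb{T}^d}\partial_\xi\psi\,dq+\tfrac12\int_0^t\!\!\int_{\mathbb{T}^d}\big(\sigma(\rho)\sigma'(\rho)\nabla\rho\cdot F_2+F_3\sigma^2(\rho)\big)(\partial_\xi\psi)(x,\rho)-\int_0^t\!\!\int_{\mathbb{T}^d}\psi(x,\rho)\nabla\cdot\nu(\rho)\,dt-\int_0^t\!\!\int_{\mathbb{T}^d}\psi(x,\rho)\nabla\cdot(\sigma(\rho)d\xi^F).$$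 Here $\overline\chi(\rho)=\mathbf{1}_{\{0<\xi<\rho\}}$, $\chi(x,\xi,t)=\mathbf{1}_{\{0<\xi<\rho(x,t)\}}$, and $(\nabla\psi)(x,\rho)$, $(\partial_\xi\psi)(x,\rho)$ are the $x$-gradient and $\xi$-derivative of $\psi$ evaluated at $(x,\rho(x,t))$. *)

theory Defs
  imports "HOL-Probability.Probability"
begin

section \<open>The torus and smooth functions on it\<close>

text \<open>
  The torus is \<open>\<real>\<^sup>d / \<int>\<^sup>d\<close>.  Continuous and smooth functions on it are functions on \<^typ>\<open>real^'d\<close> with
  period 1 in every coordinate; measures and measurable functions live on the half-open unit cube,
  which contains exactly one representative of every point of the torus.
\<close>

definition torus :: "(real^'d) set" where
  "torus = {x. \<forall>i. 0 \<le> x $ i \<and> x $ i < 1}"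

definition torus_measure :: "(real^'d) measure" where
  "torus_measure = restrict_space lborel torus"

definition time_measure :: "real \<Rightarrow> real measure" where
  "time_measure T = restrict_space lborel {0..T}"

definition periodic :: "(real^'d \<Rightarrow> 'b) \<Rightarrow> bool" where
  "periodic f \<longleftrightarrow> (\<forall>x i. f (x + axis i 1) = f x)"

primrec Ck :: "nat \<Rightarrow> ('a::euclidean_space \<Rightarrow> real) \<Rightarrow> bool" where
  "Ck 0 f \<longleftrightarrow> continuous_on UNIV f"
| "Ck (Suc n) f \<longleftrightarrow> (\<forall>x. f differentiable (at x)) \<and>
     (\<forall>b\<in>Basis. Ck n (\<lambda>x. frechet_derivative f (at x) b))"

definition smooth :: "('a::euclidean_space \<Rightarrow> real) \<Rightarrow> bool" where
  "smooth f \<longleftrightarrow> (\<forall>n. Ck n f)"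

definition grad :: "(real^'d \<Rightarrow> real) \<Rightarrow> real^'d \<Rightarrow> real^'d" where
  "grad f x = (\<chi> i. frechet_derivative f (at x) (axis i 1))"

text \<open>\<open>C\<^sub>c\<^sup>\<infinity>(\<T>\<^sup>d \<times> (0,\<infinity>))\<close>, each function being extended by zero to \<open>\<xi> \<le> 0\<close>.\<close>

definition kinetic_test_function :: "((real^'d) \<times> real \<Rightarrow> real) \<Rightarrow> bool" where
  "kinetic_test_function \<psi> \<longleftrightarrow> smooth \<psi> \<and> (\<forall>\<xi>. periodic (\<lambda>x. \<psi> (x, \<xi>))) \<and>
     (\<exists>a b. 0 < a \<and> a < b \<and> (\<forall>x \<xi>. \<xi> \<notin> {a..b} \<longrightarrow> \<psi> (x, \<xi>) = 0))"

definition grad_x :: "((real^'d) \<times> real \<Rightarrow> real) \<Rightarrow> real^'d \<Rightarrow> real \<Rightarrow> real^'d" where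
  "grad_x \<psi> x \<xi> = grad (\<lambda>y. \<psi> (y, \<xi>)) x"

definition deriv_xi :: "((real^'d) \<times> real \<Rightarrow> real) \<Rightarrow> real^'d \<Rightarrow> real \<Rightarrow> real" where
  "deriv_xi \<psi> x \<xi> = deriv (\<lambda>\<eta>. \<psi> (x, \<eta>)) \<xi>"

text \<open>Derivatives in the sense of distributions on the torus: the test functions are periodic, so
  integrating over one cell produces no boundary terms.\<close>

definition has_weak_gradient :: "(real^'d \<Rightarrow> real) \<Rightarrow> (real^'d \<Rightarrow> real^'d) \<Rightarrow> bool" where
  "has_weak_gradient u g \<longleftrightarrow> integrable torus_measure u \<and> integrable torus_measure g \<and>
     (\<forall>\<phi>. smooth \<phi> \<and> periodic \<phi> \<longrightarrow>
        (\<integral>x. u x *\<^sub>R grad \<phi> x \<partial>torus_measure) = - (\<integral>x. \<phi> x *\<^sub>R g x \<partial>torus_measure))"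

definition has_weak_divergence :: "(real^'d \<Rightarrow> real^'d) \<Rightarrow> (real^'d \<Rightarrow> real) \<Rightarrow> bool" where
  "has_weak_divergence V D \<longleftrightarrow> integrable torus_measure V \<and> integrable torus_measure D \<and>
     (\<forall>\<phi>. smooth \<phi> \<and> periodic \<phi> \<longrightarrow>
        (\<integral>x. V x \<bullet> grad \<phi> x \<partial>torus_measure) = - (\<integral>x. D x * \<phi> x \<partial>torus_measure))"

section \<open>Filtrations, Brownian motion and the It\^o integral\<close>

definition time_filtration :: "'a measure \<Rightarrow> (real \<Rightarrow> 'a measure) \<Rightarrow> bool" where
  "time_filtration M F \<longleftrightarrow> (\<forall>t\<ge>0. subalgebra M (F t)) \<and>
     (\<forall>s t. 0 \<le> s \<and> s \<le> t \<longrightarrow> sets (F s) \<subseteq> sets (F t))"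

definition predictable :: "'a measure \<Rightarrow> (real \<Rightarrow> 'a measure) \<Rightarrow> real \<Rightarrow> ('a \<times> real) measure" where
  "predictable M F T = sigma (space M \<times> {0..T})
     ({A \<times> {s<..t} |A s t. 0 \<le> s \<and> s \<le> t \<and> t \<le> T \<and> A \<in> sets (F s)} \<union>
      {A \<times> {0} |A. A \<in> sets (F 0)})"

definition brownian_motion ::
    "'a measure \<Rightarrow> (real \<Rightarrow> 'a measure) \<Rightarrow> (real \<Rightarrow> 'a \<Rightarrow> real^'d) \<Rightarrow> bool" where
  "brownian_motion M F W \<longleftrightarrow>
     (\<forall>t\<ge>0. W t \<in> borel_measurable (F t)) \<and>
     (AE \<omega> in M. W 0 \<omega> = 0) \<and>
     (AE \<omega> in M. continuous_on {0..} (\<lambda>t. W t \<omega>)) \<and>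
     (\<forall>s t. 0 \<le> s \<and> s < t \<longrightarrow>
        prob_space.indep_set M (sets (F s))
          (sets (vimage_algebra (space M) (\<lambda>\<omega>. W t \<omega> - W s \<omega>) borel)) \<and>
        distributed M lborel (\<lambda>\<omega>. W t \<omega> - W s \<omega>)
          (\<lambda>x. ennreal (\<Prod>i\<in>UNIV. normal_density 0 (sqrt (t - s)) (x $ i))))"

text \<open>A simple process \<open>\<Sum>j<n. \<zeta> j \<cdot> 1\<^bsub>(\<tau> j, \<tau> (j + 1)]\<^esub>\<close> is given by the data \<open>n\<close>, \<open>\<tau>\<close>, \<open>\<zeta>\<close>.\<close>

definition simple_process ::
    "(real \<Rightarrow> 'a measure) \<Rightarrow> real \<Rightarrow> nat \<Rightarrow> (nat \<Rightarrow> real) \<Rightarrow> (nat \<Rightarrow> 'a \<Rightarrow> real^'d) \<Rightarrow> bool" where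
  "simple_process F T n \<tau> \<zeta> \<longleftrightarrow>
     (\<forall>j\<le>n. \<tau> j \<in> {0..T}) \<and> (\<forall>j<n. \<tau> j \<le> \<tau> (Suc j)) \<and>
     (\<forall>j<n. \<zeta> j \<in> borel_measurable (F (\<tau> j)) \<and> bounded (\<zeta> j ` space (F (\<tau> j))))"

definition simple_value ::
    "nat \<Rightarrow> (nat \<Rightarrow> real) \<Rightarrow> (nat \<Rightarrow> 'a \<Rightarrow> real^'d) \<Rightarrow> 'a \<Rightarrow> real \<Rightarrow> real^'d" where
  "simple_value n \<tau> \<zeta> \<omega> t = (\<Sum>j<n. indicator {\<tau> j<..\<tau> (Suc j)} t *\<^sub>R \<zeta> j \<omega>)"

definition simple_integral ::
    "(real \<Rightarrow> 'a \<Rightarrow> real^'d) \<Rightarrow> nat \<Rightarrow> (nat \<Rightarrow> real) \<Rightarrow> (nat \<Rightarrow> 'a \<Rightarrow> real^'d) \<Rightarrow>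
     real \<Rightarrow> 'a \<Rightarrow> real" where
  "simple_integral W n \<tau> \<zeta> t \<omega> =
     (\<Sum>j<n. \<zeta> j \<omega> \<bullet> (W (min t (\<tau> (Suc j))) \<omega> - W (min t (\<tau> j)) \<omega>))"

text \<open>\<open>I t = \<integral>\<^sub>0\<^sup>t H \<cdot> dW\<close> for \<open>t \<in> [0,T]\<close>: \<open>H\<close> is the limit in \<open>L\<^sup>2(\<Omega> \<times> [0,T])\<close> of simple processes whose
  integrals converge to \<open>I t\<close> in \<open>L\<^sup>2(\<Omega>)\<close>, and \<open>I\<close> is the version with continuous paths.  By the
  isometry this determines \<open>I\<close> up to indistinguishability.\<close>

definition ito_integral ::
    "'a measure \<Rightarrow> (real \<Rightarrow> 'a measure) \<Rightarrow> real \<Rightarrow> (real \<Rightarrow> 'a \<Rightarrow> real^'d) \<Rightarrow>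
     ('a \<Rightarrow> real \<Rightarrow> real^'d) \<Rightarrow> (real \<Rightarrow> 'a \<Rightarrow> real) \<Rightarrow> bool" where
  "ito_integral M F T W H I \<longleftrightarrow>
     (\<lambda>(\<omega>, t). H \<omega> t) \<in> borel_measurable (M \<Otimes>\<^sub>M time_measure T) \<and>
     (\<forall>t\<in>{0..T}. I t \<in> borel_measurable M) \<and>
     (AE \<omega> in M. continuous_on {0..T} (\<lambda>t. I t \<omega>)) \<and>
     (\<exists>n \<tau> \<zeta>.
        (\<forall>m. simple_process F T (n m) (\<tau> m) (\<zeta> m)) \<and>
        (\<lambda>m. \<integral>\<^sup>+ (\<omega>, t). ennreal ((norm (simple_value (n m) (\<tau> m) (\<zeta> m) \<omega> t - H \<omega> t))\<^sup>2)
               \<partial>(M \<Otimes>\<^sub>M time_measure T)) \<longlonglongrightarrow> 0 \<and>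
        (\<forall>t\<in>{0..T}.
           (\<lambda>m. \<integral>\<^sup>+ \<omega>. ennreal ((simple_integral W (n m) (\<tau> m) (\<zeta> m) t \<omega> - I t \<omega>)\<^sup>2) \<partial>M)
             \<longlonglongrightarrow> 0))"

section \<open>The noise\<close>

definition F1 :: "(nat \<Rightarrow> real^'d \<Rightarrow> real) \<Rightarrow> real^'d \<Rightarrow> real" where
  "F1 f x = (\<Sum>k. (f k x)\<^sup>2)"

definition F2 :: "(nat \<Rightarrow> real^'d \<Rightarrow> real) \<Rightarrow> real^'d \<Rightarrow> real^'d" where
  "F2 f x = (\<Sum>k. f k x *\<^sub>R grad (f k) x)"

definition F3 :: "(nat \<Rightarrow> real^'d \<Rightarrow> real) \<Rightarrow> real^'d \<Rightarrow> real" where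
  "F3 f x = (\<Sum>k. (norm (grad (f k) x))\<^sup>2)"

text \<open>\<open>\<nabla>\<cdot>F2\<close>, which is half the Laplacian of \<open>F1\<close>, is taken in the sense of distributions, since the
  \<open>f k\<close> are only continuously differentiable.\<close>

definition noise_assumption ::
    "'a measure \<Rightarrow> (real \<Rightarrow> 'a measure) \<Rightarrow> (nat \<Rightarrow> real \<Rightarrow> 'a \<Rightarrow> real^'d) \<Rightarrow>
     (nat \<Rightarrow> real^'d \<Rightarrow> real) \<Rightarrow> bool" where
  "noise_assumption M F B f \<longleftrightarrow>
     prob_space M \<and> time_filtration M F \<and>
     (\<forall>k. brownian_motion M F (B k)) \<and>
     prob_space.indep_vars M (\<lambda>k. \<Pi>\<^sub>M t\<in>{0..}. borel) (\<lambda>k \<omega>. \<lambda>t\<in>{0..}. B k t \<omega>) UNIV \<and>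
     (\<forall>k. Ck 1 (f k) \<and> periodic (f k)) \<and>
     (\<forall>x. summable (\<lambda>k. (f k x)\<^sup>2)) \<and> continuous_on UNIV (F1 f) \<and>
     (\<forall>x. summable (\<lambda>k. f k x *\<^sub>R grad (f k) x)) \<and> continuous_on UNIV (F2 f) \<and>
     (\<forall>x. summable (\<lambda>k. (norm (grad (f k) x))\<^sup>2)) \<and> continuous_on UNIV (F3 f) \<and>
     (\<exists>D. bounded (D ` torus) \<and> has_weak_divergence (F2 f) D)"

text \<open>\<open>J t = \<integral>\<^sub>0\<^sup>t \<integral> g \<nabla>\<cdot>(h d\<xi>\<^sup>F)\<close>, where \<open>Dh\<close> is the spatial gradient of \<open>h\<close>; the series over the
  Brownian motions converges in \<open>L\<^sup>2(\<Omega>)\<close>.\<close>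

definition noise_integral ::
    "'a measure \<Rightarrow> (real \<Rightarrow> 'a measure) \<Rightarrow> (nat \<Rightarrow> real \<Rightarrow> 'a \<Rightarrow> real^'d) \<Rightarrow>
     (nat \<Rightarrow> real^'d \<Rightarrow> real) \<Rightarrow> real \<Rightarrow>
     ('a \<Rightarrow> real \<Rightarrow> real^'d \<Rightarrow> real) \<Rightarrow> ('a \<Rightarrow> real \<Rightarrow> real^'d \<Rightarrow> real) \<Rightarrow>
     ('a \<Rightarrow> real \<Rightarrow> real^'d \<Rightarrow> real^'d) \<Rightarrow> (real \<Rightarrow> 'a \<Rightarrow> real) \<Rightarrow> bool" where
  "noise_integral M F B f T g h Dh J \<longleftrightarrow>
     (\<forall>t\<in>{0..T}. J t \<in> borel_measurable M) \<and>
     (AE \<omega> in M. continuous_on {0..T} (\<lambda>t. J t \<omega>)) \<and>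
     (\<exists>I I'.
        (\<forall>k. ito_integral M F T (B k)
               (\<lambda>\<omega> t. \<integral>x. (g \<omega> t x * f k x) *\<^sub>R Dh \<omega> t x \<partial>torus_measure) (I k)) \<and>
        (\<forall>k. ito_integral M F T (B k)
               (\<lambda>\<omega> t. \<integral>x. (g \<omega> t x * h \<omega> t x) *\<^sub>R grad (f k) x \<partial>torus_measure) (I' k)) \<and>
        (\<forall>t\<in>{0..T}.
           (\<lambda>n. \<integral>\<^sup>+ \<omega>. ennreal (((\<Sum>k<n. I k t \<omega> + I' k t \<omega>) - J t \<omega>)\<^sup>2) \<partial>M) \<longlonglongrightarrow> 0))"

section \<open>The coefficients\<close>

definition C11_loc :: "(real \<Rightarrow> real) \<Rightarrow> bool" where
  "C11_loc \<Phi> \<longleftrightarrow> (\<forall>\<xi>>0. \<Phi> differentiable (at \<xi>)) \<and>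
     (\<forall>a b. 0 < a \<and> a \<le> b \<longrightarrow> (\<exists>L. L-lipschitz_on {a..b} (deriv \<Phi>)))"

text \<open>The functions \<open>\<Phi>\<close>, \<open>\<sigma>\<close>, \<open>\<nu>\<close> are only constrained on \<open>[0,\<infinity>)\<close>.  The value of \<^term>\<open>deriv \<sigma> 0\<close>
  is irrelevant because the bound on \<open>\<sigma>\<^sup>2/\<xi>\<close> forces \<open>\<sigma> 0 = 0\<close>: the condition on \<^term>\<open>\<lambda>\<xi>. \<sigma> \<xi> * deriv \<sigma> \<xi>\<close> says that \<open>\<sigma> \<sigma>'\<close> extends
  continuously from \<open>(0,\<infinity>)\<close> to \<open>[0,\<infinity>)\<close> by the value 0.\<close>

definition structure_assumption ::
    "(nat \<Rightarrow> real^'d \<Rightarrow> real) \<Rightarrow> (real \<Rightarrow> real) \<Rightarrow> (real \<Rightarrow> real) \<Rightarrow> (real \<Rightarrow> real^'d) \<Rightarrow> bool" where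
  "structure_assumption f \<Phi> \<sigma> \<nu> \<longleftrightarrow>
     continuous_on {0..} \<Phi> \<and> continuous_on {0..} \<sigma> \<and> continuous_on {0..} \<nu> \<and>
     C11_loc \<Phi> \<and> C11_loc \<sigma> \<and>
     (\<forall>\<xi>>0. \<nu> differentiable (at \<xi>)) \<and> continuous_on {0<..} (\<lambda>\<xi>. vector_derivative \<nu> (at \<xi>)) \<and>
     \<Phi> 0 = 0 \<and> (\<forall>\<xi>>0. deriv \<Phi> \<xi> > 0) \<and>
     (\<exists>c>0. Limsup (at_right 0) (\<lambda>\<xi>. ereal ((\<sigma> \<xi>)\<^sup>2 / \<xi>)) \<le> ereal c) \<and>
     ((continuous_on {0..} (\<lambda>\<xi>. \<sigma> \<xi> * deriv \<sigma> \<xi>) \<and> \<sigma> 0 * deriv \<sigma> 0 = 0) \<or>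
      has_weak_divergence (F2 f) (\<lambda>x. 0)) \<and>
     (\<exists>c\<ge>1. \<forall>\<xi>\<ge>0. (SUP \<xi>'\<in>{0..\<xi>}. (\<sigma> \<xi>')\<^sup>2) \<le> c * (1 + \<xi> + (\<sigma> \<xi>)\<^sup>2)) \<and>
     (\<exists>c\<ge>1. \<forall>\<xi>\<ge>0. (SUP \<xi>'\<in>{0..\<xi>}. norm (\<nu> \<xi>')) \<le> c * (1 + \<xi> + norm (\<nu> \<xi>)))"

section \<open>Kinetic measures and stochastic kinetic solutions\<close>

text \<open>Since the torus is compact, local finiteness on \<open>\<T>\<^sup>d \<times> (0,\<infinity>) \<times> [0,T]\<close> is finiteness on all sets
  \<open>\<T>\<^sup>d \<times> [a,b] \<times> [0,T]\<close> with \<open>0 < a\<close>.\<close>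

definition kinetic_measure ::
    "'a measure \<Rightarrow> (real \<Rightarrow> 'a measure) \<Rightarrow> real \<Rightarrow> ('a \<Rightarrow> ((real^'d) \<times> real \<times> real) measure) \<Rightarrow> bool"
  where
  "kinetic_measure M F T q \<longleftrightarrow>
     (\<forall>\<omega>\<in>space M. sets (q \<omega>) = sets (restrict_space borel (torus \<times> {0<..} \<times> {0..T})) \<and>
        (\<forall>a b. 0 < a \<and> a \<le> b \<longrightarrow> emeasure (q \<omega>) (torus \<times> {a..b} \<times> {0..T}) < \<infinity>)) \<and>
     (\<forall>\<psi>. kinetic_test_function \<psi> \<longrightarrow>
        (\<lambda>(\<omega>, t). \<integral>(x, \<xi>, s). indicator {0..t} s * \<psi> (x, \<xi>) \<partial>q \<omega>)
          \<in> borel_measurable (predictable M F T))"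

text \<open>A (predictable) \<open>L\<^sup>1(\<T>\<^sup>d)\<close>-valued process is represented by a jointly measurable, everywhere
  nonnegative function of \<open>\<omega>\<close>, \<open>t\<close> and \<open>x\<close>; such a representative exists because \<open>L\<^sup>1(\<T>\<^sup>d)\<close> is separable.\<close>

definition initial_datum ::
    "'a measure \<Rightarrow> (real \<Rightarrow> 'a measure) \<Rightarrow> ('a \<Rightarrow> real^'d \<Rightarrow> real) \<Rightarrow> bool" where
  "initial_datum M F \<rho>0 \<longleftrightarrow>
     (\<forall>\<omega>\<in>space M. \<forall>x\<in>torus. 0 \<le> \<rho>0 \<omega> x) \<and>
     (\<lambda>(\<omega>, x). \<rho>0 \<omega> x) \<in> borel_measurable (F 0 \<Otimes>\<^sub>M torus_measure) \<and>
     integrable (M \<Otimes>\<^sub>M torus_measure) (\<lambda>(\<omega>, x). \<rho>0 \<omega> x)"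

definition solution_process ::
    "'a measure \<Rightarrow> (real \<Rightarrow> 'a measure) \<Rightarrow> real \<Rightarrow> ('a \<Rightarrow> real \<Rightarrow> real^'d \<Rightarrow> real) \<Rightarrow> bool" where
  "solution_process M F T \<rho> \<longleftrightarrow>
     (\<forall>\<omega>\<in>space M. \<forall>t\<in>{0..T}. \<forall>x\<in>torus. 0 \<le> \<rho> \<omega> t x) \<and>
     (\<lambda>((\<omega>, t), x). \<rho> \<omega> t x) \<in> borel_measurable (predictable M F T \<Otimes>\<^sub>M torus_measure) \<and>
     integrable (M \<Otimes>\<^sub>M (time_measure T \<Otimes>\<^sub>M torus_measure)) (\<lambda>(\<omega>, t, x). \<rho> \<omega> t x) \<and>
     (AE \<omega> in M. \<forall>t\<in>{0..T}. integrable torus_measure (\<rho> \<omega> t) \<and>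
        ((\<lambda>s. \<integral>x. \<bar>\<rho> \<omega> s x - \<rho> \<omega> t x\<bar> \<partial>torus_measure) \<longlongrightarrow> 0) (at t within {0..T}))"

text \<open>The truncations \<open>(\<rho> \<and> K) \<or> 1/K\<close> are in \<open>L\<^sup>2(\<Omega>; L\<^sup>2([0,T]; H\<^sup>1(\<T>\<^sup>d)))\<close>, and \<open>D\<rho>\<close> is the resulting
  gradient of \<open>\<rho>\<close>: \<open>\<rho>\<close> itself need not be weakly differentiable, but the gradient of the truncation at
  level \<open>K\<close> vanishes almost everywhere outside \<open>{1/K < \<rho> < K}\<close>, and inside this set it does not depend
  on \<open>K\<close>.  This fixes \<open>D\<rho>\<close> almost everywhere on \<open>{\<rho> > 0}\<close>; its values on \<open>{\<rho> = 0}\<close> are never used.\<close>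

definition truncation_gradient ::
    "'a measure \<Rightarrow> real \<Rightarrow> ('a \<Rightarrow> real \<Rightarrow> real^'d \<Rightarrow> real) \<Rightarrow>
     ('a \<Rightarrow> real \<Rightarrow> real^'d \<Rightarrow> real^'d) \<Rightarrow> bool" where
  "truncation_gradient M T \<rho> D\<rho> \<longleftrightarrow>
     (\<lambda>(\<omega>, t, x). D\<rho> \<omega> t x)
        \<in> borel_measurable (M \<Otimes>\<^sub>M (time_measure T \<Otimes>\<^sub>M torus_measure)) \<and>
     (\<forall>K::nat. K \<ge> 1 \<longrightarrow>
        (let u = (\<lambda>\<omega> t x. max (min (\<rho> \<omega> t x) (real K)) (1 / real K));
             Du = (\<lambda>\<omega> t x. if 1 / real K < \<rho> \<omega> t x \<and> \<rho> \<omega> t x < real K then D\<rho> \<omega> t x else 0)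
         in integrable (M \<Otimes>\<^sub>M (time_measure T \<Otimes>\<^sub>M torus_measure)) (\<lambda>(\<omega>, t, x). (u \<omega> t x)\<^sup>2) \<and>
            integrable (M \<Otimes>\<^sub>M (time_measure T \<Otimes>\<^sub>M torus_measure))
              (\<lambda>(\<omega>, t, x). (norm (Du \<omega> t x))\<^sup>2) \<and>
            (AE (\<omega>, t) in M \<Otimes>\<^sub>M time_measure T. has_weak_gradient (u \<omega> t) (Du \<omega> t))))"

definition kinetic_function :: "real \<Rightarrow> real \<Rightarrow> real" where
  "kinetic_function r \<xi> = (if 0 < \<xi> \<and> \<xi> < r then 1 else 0)"

text \<open>The equation at a fixed \<open>\<omega>\<close> and \<open>t\<close>; here \<open>r\<close>, \<open>Dr\<close>, \<open>r0\<close>, \<open>p\<close> and \<open>j\<close> are the values at \<open>\<omega>\<close> of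
  \<open>\<rho>\<close>, \<open>\<nabla>\<rho>\<close>, \<open>\<rho>\<^sub>0\<close>, \<open>q\<close> and, at \<open>(\<omega>, t)\<close>, of the stochastic integral.  On the support of the test
  function \<open>\<nabla>\<cdot>\<nu>(\<rho>)\<close> is \<open>\<nu>'(\<rho>)\<cdot>\<nabla>\<rho>\<close>.\<close>

definition kinetic_equation ::
    "(nat \<Rightarrow> real^'d \<Rightarrow> real) \<Rightarrow> (real \<Rightarrow> real) \<Rightarrow> (real \<Rightarrow> real) \<Rightarrow> (real \<Rightarrow> real^'d) \<Rightarrow>
     ((real^'d) \<times> real \<Rightarrow> real) \<Rightarrow> (real^'d \<Rightarrow> real) \<Rightarrow> (real \<Rightarrow> real^'d \<Rightarrow> real) \<Rightarrow>
     (real \<Rightarrow> real^'d \<Rightarrow> real^'d) \<Rightarrow> ((real^'d) \<times> real \<times> real) measure \<Rightarrow> real \<Rightarrow> real \<Rightarrow> bool" where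
  "kinetic_equation f \<Phi> \<sigma> \<nu> \<psi> r0 r Dr p t j \<longleftrightarrow>
     (let Q = time_measure t \<Otimes>\<^sub>M torus_measure in
      (\<integral>(x, \<xi>). kinetic_function (r t x) \<xi> * \<psi> (x, \<xi>) \<partial>(torus_measure \<Otimes>\<^sub>M lborel)) =
      (\<integral>(x, \<xi>). kinetic_function (r0 x) \<xi> * \<psi> (x, \<xi>) \<partial>(torus_measure \<Otimes>\<^sub>M lborel))
      - (\<integral>(s, x). deriv \<Phi> (r s x) * (Dr s x \<bullet> grad_x \<psi> x (r s x)) \<partial>Q)
      - 1/2 * (\<integral>(s, x). F1 f x * (deriv \<sigma> (r s x))\<^sup>2 * (Dr s x \<bullet> grad_x \<psi> x (r s x)) \<partial>Q)
      - 1/2 * (\<integral>(s, x). \<sigma> (r s x) * deriv \<sigma> (r s x) * (F2 f x \<bullet> grad_x \<psi> x (r s x)) \<partial>Q)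
      - (\<integral>(x, \<xi>, s). indicator {0..t} s * deriv_xi \<psi> x \<xi> \<partial>p)
      + 1/2 * (\<integral>(s, x). (\<sigma> (r s x) * deriv \<sigma> (r s x) * (Dr s x \<bullet> F2 f x)
                          + F3 f x * (\<sigma> (r s x))\<^sup>2) * deriv_xi \<psi> x (r s x) \<partial>Q)
      - (\<integral>(s, x). \<psi> (x, r s x) * (vector_derivative \<nu> (at (r s x)) \<bullet> Dr s x) \<partial>Q)
      - j)"

definition stochastic_kinetic_solution ::
    "'a measure \<Rightarrow> (real \<Rightarrow> 'a measure) \<Rightarrow> (nat \<Rightarrow> real \<Rightarrow> 'a \<Rightarrow> real^'d) \<Rightarrow>
     (nat \<Rightarrow> real^'d \<Rightarrow> real) \<Rightarrow> (real \<Rightarrow> real) \<Rightarrow> (real \<Rightarrow> real) \<Rightarrow> (real \<Rightarrow> real^'d) \<Rightarrow> real \<Rightarrow>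
     ('a \<Rightarrow> real^'d \<Rightarrow> real) \<Rightarrow> ('a \<Rightarrow> real \<Rightarrow> real^'d \<Rightarrow> real) \<Rightarrow>
     ('a \<Rightarrow> ((real^'d) \<times> real \<times> real) measure) \<Rightarrow> bool" where
  "stochastic_kinetic_solution M F B f \<Phi> \<sigma> \<nu> T \<rho>0 \<rho> q \<longleftrightarrow>
     solution_process M F T \<rho> \<and> kinetic_measure M F T q \<and>
     (AE \<omega> in M. \<forall>t\<in>{0..T}.
        (\<integral>x. \<bar>\<rho> \<omega> t x\<bar> \<partial>torus_measure) = (\<integral>x. \<bar>\<rho>0 \<omega> x\<bar> \<partial>torus_measure)) \<and>
     integrable (M \<Otimes>\<^sub>M (time_measure T \<Otimes>\<^sub>M torus_measure)) (\<lambda>(\<omega>, t, x). (\<sigma> (\<rho> \<omega> t x))\<^sup>2) \<and>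
     integrable (M \<Otimes>\<^sub>M (time_measure T \<Otimes>\<^sub>M torus_measure)) (\<lambda>(\<omega>, t, x). \<nu> (\<rho> \<omega> t x)) \<and>
     ((\<lambda>m::real. \<integral>\<^sup>+ \<omega>. emeasure (q \<omega>) (torus \<times> {m..m + 1} \<times> {0..T}) \<partial>M) \<longlongrightarrow> 0) at_top \<and>
     (\<exists>D\<rho>. truncation_gradient M T \<rho> D\<rho> \<and>
        (AE \<omega> in M. \<forall>A\<in>sets (restrict_space borel (torus \<times> {0<..} \<times> {0..T})).
           (\<integral>\<^sup>+ (t, x). indicator A (x, \<rho> \<omega> t x, t) *
                ennreal (deriv \<Phi> (\<rho> \<omega> t x) * (norm (D\<rho> \<omega> t x))\<^sup>2)
              \<partial>(time_measure T \<Otimes>\<^sub>M torus_measure)) \<le> emeasure (q \<omega>) A) \<and>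
        (\<forall>\<psi>. kinetic_test_function \<psi> \<longrightarrow>
           (\<exists>J. noise_integral M F B f T
                  (\<lambda>\<omega> t x. \<psi> (x, \<rho> \<omega> t x)) (\<lambda>\<omega> t x. \<sigma> (\<rho> \<omega> t x))
                  (\<lambda>\<omega> t x. deriv \<sigma> (\<rho> \<omega> t x) *\<^sub>R D\<rho> \<omega> t x) J \<and>
                (AE \<omega> in M. \<forall>t\<in>{0..T}.
                   kinetic_equation f \<Phi> \<sigma> \<nu> \<psi> (\<rho>0 \<omega>) (\<rho> \<omega>) (D\<rho> \<omega>) (q \<omega>) t (J t \<omega>)))))"

end

theory Submission
  imports Defs
begin

text \<open>
  The equation is tested with a smooth cutoff in \<open>\<xi>\<close> that rises from 0 to 1 near \<open>\<beta>\<close> and falls back to 0 on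
  \<open>[M, M + 1]\<close>, at the final time and in expectation. The rising part of the cutoff produces
  \<open>\<beta>\<^sup>-\<^sup>1 \<E>[q]\<close> near \<open>\<xi> = \<beta>\<close>, and everything else vanishes as \<open>\<beta> \<rightarrow> 0\<close> and \<open>M \<rightarrow> \<infinity>\<close>: the stochastic
  integral has mean zero, the kinetic functions contribute the difference of the masses at the two
  times, the falling part contributes the mass of \<open>q\<close> at infinity, the transport term is the integral of a
  divergence, \<open>F\<^sub>3 \<sigma>\<^sup>2\<close> is controlled by \<open>\<sigma>\<^sup>2 \<le> c \<xi>\<close> near zero, and \<open>\<sigma> \<sigma>' \<nabla>\<rho> \<bullet> F\<^sub>2\<close> is integrated by parts onto the
  divergence of \<open>F\<^sub>2\<close>, which vanishes unless \<open>\<sigma> \<sigma>'\<close> tends to 0 at 0. Fatou's lemma along \<open>\<beta> = 1 / (n + 1)\<close> concludes. The integrations by parts require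
  the chain rule for functions that only have a weak gradient, which is obtained by mollification.
\<close>

section \<open>Smooth functions and cutoffs\<close>

text \<open>A solution has a weak gradient only after truncation away from 0 and from infinity, so
  each integration by parts needs a weight supported in a compact part of (0, inf). The cutoff
  provides it: it depends on \<xi> alone, so the terms with an x-gradient of the test function
  vanish, and its derivative lives on two bounded intervals. One index n drives both ends, so a
  single limit remains. Near zero the weight has height of order 1/\<beta> on an interval of length
  \<beta>. As \<sigma>^2 \<le> c \<xi> there, \<sigma>^2 times the weight is bounded but not small;
  it disappears by dominated convergence, because at any fixed value of \<rho> the weight is
  eventually zero. At infinity, the primitive of \<sigma> \<sigma>' times the weight sees all values
  below \<rho>; the growth condition on the running supremum of \<sigma>^2 turns this into the
  integrable majorant 1 + \<rho> + \<sigma>^2(\<rho>). The estimate is in mean because the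
  stochastic integral has no sign and the tail of q is controlled in mean only. The return to single
  paths then yields a liminf.\<close>

lemma Ck_SucI:
  assumes "\<And>x. (f has_derivative f' x) (at x)" "\<And>b. b \<in> Basis \<Longrightarrow> Ck n (\<lambda>x. f' x b)"
  shows "Ck (Suc n) f"
proof -
  have "frechet_derivative f (at x) = f' x" for x
    using frechet_derivative_at[OF assms(1)] by simp
  then show ?thesis using assms by (auto simp: differentiable_def)
qed

lemma Ck_SucD:
  assumes "Ck (Suc n) f"
  shows "(f has_derivative frechet_derivative f (at x)) (at x)"
    and "b \<in> Basis \<Longrightarrow> Ck n (\<lambda>x. frechet_derivative f (at x) b)"
  using assms by (auto simp: frechet_derivative_works[symmetric])

lemma Ck_Suc_imp: "Ck (Suc n) f \<Longrightarrow> Ck n f"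
proof (induction n arbitrary: f)
  case 0
  then show ?case
    by (auto intro!: continuous_at_imp_continuous_on differentiable_imp_continuous_within)
next
  case (Suc n)
  then show ?case by (metis Ck.simps(2))
qed

lemma Ck_const: "Ck n (\<lambda>x. c)"
proof (induction n arbitrary: c)
  case (Suc n)
  show ?case by (rule Ck_SucI[where f' = "\<lambda>x v. 0"]) (use Suc in auto)
qed auto

lemma Ck_add:
  assumes "Ck n f" "Ck n g"
  shows "Ck n (\<lambda>x. f x + g x)"
  using assms
proof (induction n arbitrary: f g)
  case 0
  then show ?case by (auto intro: continuous_intros)
next
  case (Suc n)
  show ?case
    by (rule Ck_SucI[OF has_derivative_add[OF Ck_SucD(1)[OF Suc.prems(1)] Ck_SucD(1)[OF Suc.prems(2)]]])
      (intro Suc.IH Ck_SucD(2) Suc.prems)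
qed

lemma Ck_mult:
  assumes "Ck n f" "Ck n g"
  shows "Ck n (\<lambda>x. f x * g x)"
  using assms
proof (induction n arbitrary: f g)
  case 0
  then show ?case by (auto intro: continuous_intros)
next
  case (Suc n)
  show ?case
    by (rule Ck_SucI[OF has_derivative_mult[OF Ck_SucD(1)[OF Suc.prems(1)] Ck_SucD(1)[OF Suc.prems(2)]]])
      (intro Suc.IH Ck_add Ck_SucD(2) Suc.prems Ck_Suc_imp)
qed

text \<open>Stated for affine maps, so that dilations, translations, reflections and coordinate
  projections are covered by one induction.\<close>

lemma Ck_compose_linear:
  fixes f :: "'a::euclidean_space \<Rightarrow> real" and A :: "'b::euclidean_space \<Rightarrow> 'a"
  assumes "Ck n f" "bounded_linear A"
  shows "Ck n (\<lambda>x. f (A x + c))"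
  using assms(1)
proof (induction n arbitrary: f)
  case 0
  then show ?case
    using linear_continuous_on[OF assms(2)]
    by (auto intro!: continuous_intros continuous_on_compose2[of UNIV f UNIV "\<lambda>x. A x + c"])
next
  case (Suc n)
  have A: "((\<lambda>x. A x + c) has_derivative A) (at x)" for x
    by (auto intro!: derivative_eq_intros bounded_linear.has_derivative[OF assms(2)])
  have d: "((\<lambda>x. f (A x + c)) has_derivative (\<lambda>v. frechet_derivative f (at (A x + c)) (A v))) (at x)" for x
    using diff_chain_at[OF A Ck_SucD(1)[OF Suc.prems]] by (simp add: o_def)
  have sum: "Ck n (\<lambda>x. \<Sum>b\<in>S. g b x)" if "\<And>b. b \<in> S \<Longrightarrow> Ck n (g b)" "finite S" for S and g :: "'a \<Rightarrow> 'b \<Rightarrow> real"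
    using that(2,1) by (induction S) (auto intro: Ck_const Ck_add)
  \<comment> \<open>\<open>A v\<close> need not be a basis vector, so the derivative in its
    direction is expanded in partial derivatives, the only ones the induction hypothesis speaks
    about.\<close>
  have eq: "frechet_derivative f (at y) w = (\<Sum>b\<in>Basis. (w \<bullet> b) * frechet_derivative f (at y) b)" for y w
  proof -
    have "linear (frechet_derivative f (at y))"
      using Ck_SucD(1)[OF Suc.prems] has_derivative_linear by blast
    then show ?thesis
      by (subst (1) euclidean_representation[symmetric, of w]) (simp add: linear_sum linear_scale)
  qed
  show ?case
  proof (rule Ck_SucI[OF d], subst eq, rule sum)
    fix b :: 'a and v :: 'b assume "b \<in> Basis"
    show "Ck n (\<lambda>x. (A v \<bullet> b) * frechet_derivative f (at (A x + c)) b)"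
      by (intro Ck_mult Ck_const Suc.IH Ck_SucD(2)[OF Suc.prems] \<open>b \<in> Basis\<close>)
  qed simp
qed

lemma smooth_const [simp]: "smooth (\<lambda>x. c)"
  by (simp add: smooth_def Ck_const)

lemma smooth_add: "smooth f \<Longrightarrow> smooth g \<Longrightarrow> smooth (\<lambda>x. f x + g x)"
  by (simp add: smooth_def Ck_add)

lemma smooth_mult: "smooth f \<Longrightarrow> smooth g \<Longrightarrow> smooth (\<lambda>x. f x * g x)"
  by (simp add: smooth_def Ck_mult)

lemma smooth_cmult: "smooth f \<Longrightarrow> smooth (\<lambda>x. c * f x)"
  by (simp add: smooth_mult)

lemma smooth_diff: "smooth f \<Longrightarrow> smooth g \<Longrightarrow> smooth (\<lambda>x. f x - g x)"
  using smooth_add[OF _ smooth_cmult[of g "-1"], of f] by simp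

lemma smooth_power: "smooth f \<Longrightarrow> smooth (\<lambda>x. f x ^ n)"
  by (induction n) (auto intro: smooth_mult)

lemma smooth_sum: "(\<And>i. i \<in> S \<Longrightarrow> smooth (f i)) \<Longrightarrow> smooth (\<lambda>x. \<Sum>i\<in>S. f i x)"
  by (induction S rule: infinite_finite_induct) (auto intro: smooth_add)

lemma smooth_compose_linear: "smooth f \<Longrightarrow> bounded_linear A \<Longrightarrow> smooth (\<lambda>x. f (A x + c))"
  by (simp add: smooth_def Ck_compose_linear)

lemma smooth_has_derivative:
  assumes "smooth f"
  shows "(f has_derivative frechet_derivative f (at x)) (at x)"
  by (rule Ck_SucD(1)[of 0]) (use assms in \<open>simp add: smooth_def del: Ck.simps\<close>)

lemma smooth_frechet:
  assumes "smooth f" "b \<in> Basis"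
  shows "smooth (\<lambda>x. frechet_derivative f (at x) b)"
  unfolding smooth_def using assms Ck_SucD(2) by (metis smooth_def)

lemma smooth_continuous: "smooth f \<Longrightarrow> continuous_on S f"
  unfolding smooth_def by (metis Ck.simps(1) continuous_on_subset subset_UNIV)

lemma Ck_real:
  fixes f :: "real \<Rightarrow> real"
  assumes "\<And>x. (f has_real_derivative f' x) (at x)" "Ck n f'"
  shows "Ck (Suc n) f"
  by (rule Ck_SucI[where f' = "\<lambda>x v. f' x * v"]) (use assms in \<open>auto simp: has_field_derivative_def\<close>)

lemma smooth_real:
  fixes f :: "real \<Rightarrow> real"
  assumes "\<And>x. (f has_real_derivative f' x) (at x)" "smooth f'"
  shows "smooth f"
  unfolding smooth_def using Ck_real[OF assms(1)] assms(2) Ck_Suc_imp by (metis smooth_def)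

lemma smooth_real_deriv:
  fixes f :: "real \<Rightarrow> real"
  assumes "smooth f"
  shows "smooth (deriv f)" "(f has_real_derivative deriv f x) (at x)"
proof -
  have d: "(f has_real_derivative frechet_derivative f (at x) 1) (at x)" for x
    using smooth_has_derivative[OF assms, of x] has_derivative_bounded_linear real_bounded_linear
    by (metis has_field_derivative_def mult.commute mult.right_neutral has_derivative_imp_has_field_derivative)
  then have "deriv f = (\<lambda>x. frechet_derivative f (at x) 1)"
    by (auto simp: DERIV_imp_deriv)
  then show "smooth (deriv f)" "(f has_real_derivative deriv f x) (at x)"
    using smooth_frechet[OF assms, of 1] d by auto
qed

lemma smooth_sin_cos: "smooth (sin :: real \<Rightarrow> real)" "smooth (cos :: real \<Rightarrow> real)"
proof -
  \<comment> \<open>The span of sin and cos is closed under differentiation; generalising over a and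
    b lets one induction treat both functions.\<close>
  have "Ck n (\<lambda>x::real. a * sin x + b * cos x)" for n a b
  proof (induction n arbitrary: a b)
    case 0
    show ?case by (auto intro!: continuous_intros)
  next
    case (Suc n)
    show ?case
      by (rule Ck_real[where f' = "\<lambda>x. -b * sin x + a * cos x"])
        (use Suc[of "-b" a] in \<open>auto intro!: derivative_eq_intros\<close>)
  qed
  from this[of _ 1 0] this[of _ 0 1] show "smooth (sin :: real \<Rightarrow> real)" "smooth (cos :: real \<Rightarrow> real)"
    by (auto simp: smooth_def)
qed

section \<open>Flat functions and a smooth step\<close>

definition flat_fun :: "real poly \<Rightarrow> real \<Rightarrow> real" where
  "flat_fun p x = (if x \<le> 0 then 0 else poly p (1 / x) * exp (- 1 / x))"

lemma poly_exp_tendsto_0: "((\<lambda>y::real. poly p y * exp (- y)) \<longlongrightarrow> 0) at_top"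
proof -
  have "((\<lambda>y. \<Sum>i\<le>degree p. coeff p i * (y ^ i / exp y)) \<longlongrightarrow> (\<Sum>i\<le>degree p. coeff p i * 0)) at_top"
    by (intro tendsto_intros tendsto_power_div_exp_0)
  then show ?thesis
    by (simp add: poly_altdef exp_minus sum_distrib_right divide_inverse mult.assoc)
qed

lemma flat_fun_right_limit: "(flat_fun p \<longlongrightarrow> 0) (at_right 0)"
proof -
  have "((\<lambda>x::real. poly p (inverse x) * exp (- inverse x)) \<longlongrightarrow> 0) (at_right 0)"
    by (rule filterlim_compose[OF poly_exp_tendsto_0 filterlim_inverse_at_top_right])
  then show ?thesis
    by (rule Lim_transform_eventually)
      (auto simp: eventually_at_right_field flat_fun_def field_simps intro!: exI[of _ 1])
qed

text \<open>For x > 0 the derivative of p(1/x) exp(-1/x) is (1/x)^2 (p - p')(1/x) exp(-1/x). The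
  family is thus closed under differentiation, which reduces smoothness to an induction over all
  p.\<close>

lemma flat_fun_deriv:
  "(flat_fun p has_real_derivative flat_fun (monom 1 2 * (p - pderiv p)) x) (at x)"
proof -
  consider "x < 0" | "x = 0" | "x > 0" by linarith
  then show ?thesis
  proof cases
    case 1
    have "((\<lambda>x. 0) has_real_derivative 0) (at x)" by simp
    then have "(flat_fun p has_real_derivative 0) (at x)"
      by (rule has_field_derivative_transform_within_open[where S = "{..<0}"])
        (use 1 in \<open>auto simp: flat_fun_def\<close>)
    then show ?thesis using 1 by (simp add: flat_fun_def)
  next
    case 3
    have "((\<lambda>x. poly p (1 / x) * exp (- 1 / x)) has_real_derivative
       flat_fun (monom 1 2 * (p - pderiv p)) x) (at x)"
      using 3 by (auto intro!: derivative_eq_intros DERIV_chain2[OF poly_DERIV]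
          simp: flat_fun_def poly_monom power2_eq_square field_simps)
    then show ?thesis
      by (rule has_field_derivative_transform_within_open[where S = "{0<..}"])
        (use 3 in \<open>auto simp: flat_fun_def\<close>)
  next
    case 2
    \<comment> \<open>To the right of 0 the difference quotient is again a flat function, with one
      more factor 1/h in the polynomial.\<close>
    have "((\<lambda>h. flat_fun (monom 1 1 * p) h) \<longlongrightarrow> 0) (at_right 0)"
      by (rule flat_fun_right_limit)
    then have r: "((\<lambda>h. (flat_fun p h - flat_fun p 0) / (h - 0)) \<longlongrightarrow> 0) (at_right 0)"
      by (rule Lim_transform_eventually)
        (auto simp: eventually_at_right_field flat_fun_def poly_monom intro!: exI[of _ 1])
    have "((\<lambda>h. 0) \<longlongrightarrow> (0::real)) (at_left 0)" by simp
    then have l: "((\<lambda>h. (flat_fun p h - flat_fun p 0) / (h - 0)) \<longlongrightarrow> 0) (at_left 0)"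
      by (rule Lim_transform_eventually)
        (auto simp: eventually_at_left_field flat_fun_def intro!: exI[of _ "-1"])
    have "((\<lambda>h. (flat_fun p h - flat_fun p 0) / (h - 0)) \<longlongrightarrow> 0) (at 0)"
      using l r by (simp add: filterlim_at_split)
    then show ?thesis using 2 by (simp add: has_field_derivative_iff flat_fun_def)
  qed
qed

lemma smooth_flat_fun: "smooth (flat_fun p)"
proof -
  have "Ck n (flat_fun p)" for n p
  proof (induction n arbitrary: p)
    case 0
    show ?case by (auto intro!: DERIV_continuous_on flat_fun_deriv DERIV_subset[OF flat_fun_deriv])
  next
    case (Suc n)
    show ?case by (rule Ck_real[OF flat_fun_deriv Suc])
  qed
  then show ?thesis by (simp add: smooth_def)
qed

text \<open>Taken on the whole interval (-inf, inf), so that the two sides of the base point a need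
  no separate treatment.\<close>

lemma continuous_antiderivative:
  fixes p :: "real \<Rightarrow> real"
  assumes "continuous_on UNIV p"
  obtains P where "\<And>x. (P has_real_derivative p x) (at x)" "P a = c"
proof -
  obtain E where "\<forall>x. - \<infinity> < ereal x \<longrightarrow> ereal x < \<infinity> \<longrightarrow> (E has_vector_derivative p x) (at x)"
    using einterval_antiderivative[of "- \<infinity>" \<infinity> p] assms
    by (auto simp: continuous_on_eq_continuous_at)
  then have E: "((\<lambda>x. E x - E a + c) has_real_derivative p x) (at x)" for x
    by (auto simp: has_real_derivative_iff_has_vector_derivative[symmetric] intro!: derivative_eq_intros)
  show ?thesis
    by (rule that[of "\<lambda>x. E x - E a + c"]) (use E in auto)
qed

text \<open>A normalised primitive of the bump \<open>flat_fun 1 x * flat_fun 1 (1 - x)\<close>.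
  Strict positivity of the derivative inside the unit interval is recorded because the mass of q on
  [\<beta>/2, \<beta>] is later compared with it.\<close>

lemma smooth_step_exists:
  obtains g :: "real \<Rightarrow> real" where "smooth g" "\<And>x. x \<le> 0 \<Longrightarrow> g x = 0" "\<And>x. x \<ge> 1 \<Longrightarrow> g x = 1"
    "\<And>x. 0 \<le> g x" "\<And>x. g x \<le> 1" "\<And>x. 0 < x \<Longrightarrow> x < 1 \<Longrightarrow> deriv g x > 0" "\<And>x. deriv g x \<ge> 0"
    "\<And>x. x \<le> 0 \<or> 1 \<le> x \<Longrightarrow> deriv g x = 0"
proof -
  define e where "e x = flat_fun 1 x * flat_fun 1 (1 - x)" for x
  have e: "e x \<ge> 0" "0 < x \<Longrightarrow> x < 1 \<Longrightarrow> e x > 0" "x \<le> 0 \<or> 1 \<le> x \<Longrightarrow> e x = 0" for x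
    by (auto simp: e_def flat_fun_def)
  have "smooth (\<lambda>x. flat_fun 1 ((\<lambda>x. - x) x + 1))"
    by (rule smooth_compose_linear[OF smooth_flat_fun]) (rule bounded_linear_minus[OF bounded_linear_ident])
  then have "smooth (\<lambda>x. flat_fun 1 x * flat_fun 1 ((\<lambda>x. - x) x + 1))"
    by (rule smooth_mult[OF smooth_flat_fun])
  then have sm: "smooth e" by (simp add: e_def[abs_def])
  obtain E where E: "\<And>x. (E has_real_derivative e x) (at x)"
    by (rule continuous_antiderivative[OF smooth_continuous[OF sm], where a = 0 and c = 0]) blast
  have cont: "continuous_on S E" for S
    by (rule DERIV_continuous_on) (rule has_field_derivative_at_within[OF E])
  have "\<exists>y. (E has_real_derivative y) (at x) \<and> 0 < y" if "0 < x" "x < 1" for x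
    using E e(2)[OF that] by blast
  then have c: "E 0 < E 1"
    by (intro DERIV_pos_imp_increasing_open[of 0 1 E] cont) auto
  define g where "g x = (E x - E 0) / (E 1 - E 0)" for x
  have g': "(g has_real_derivative e x / (E 1 - E 0)) (at x)" for x
    unfolding g_def using c by (auto intro!: derivative_eq_intros E)
  have dg: "deriv g = (\<lambda>x. e x / (E 1 - E 0))"
    using g' by (auto simp: DERIV_imp_deriv)
  have flat: "(E has_real_derivative 0) (at y)" if "y \<le> 0 \<or> 1 \<le> y" for y
    using E[of y] e(3)[OF that] by simp
  have g0: "g x = 0" if "x \<le> 0" for x
  proof -
    have "E x = E 0"
    proof (cases "x = 0")
      case False
      then show ?thesis
        using that flat by (intro DERIV_isconst_end[of x 0 E, symmetric]) (auto intro!: cont) 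
    qed auto
    then show ?thesis by (simp add: g_def)
  qed
  have g1: "g x = 1" if "x \<ge> 1" for x
  proof -
    have "E x = E 1"
    proof (cases "x = 1")
      case False
      then show ?thesis
        using that flat by (intro DERIV_isconst_end[of 1 x E]) (auto intro!: cont) 
    qed auto
    then show ?thesis using c by (simp add: g_def)
  qed
  have mono: "g x \<le> g y" if "x \<le> y" for x y
    by (rule DERIV_nonneg_imp_nondecreasing[OF that]) (use g' e(1) c in \<open>auto intro!: exI\<close>)
  show ?thesis
  proof (rule that)
    show "smooth g"
      by (rule smooth_real[OF g']) (use smooth_cmult[OF sm, of "1 / (E 1 - E 0)"] in simp)
    show "0 \<le> g x" for x using mono[of "min x 0" x] g0[of "min x 0"] by simp
    show "g x \<le> 1" for x using mono[of x "max x 1"] g1[of "max x 1"] by simp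
  qed (use g0 g1 e c in \<open>auto simp: dg\<close>)
qed

text \<open>On a compact torus, compact support restricts \<xi> only, so functions of \<xi> alone
  are admissible. Their independence of x is what removes the x-gradient terms from the
  equation.\<close>

lemma kinetic_test_function_snd:
  assumes "smooth \<phi>" "0 < a" "a < b" "\<And>x. x \<notin> {a..b} \<Longrightarrow> \<phi> x = 0"
  shows "kinetic_test_function (\<lambda>p::(real^'d) \<times> real. \<phi> (snd p))"
proof -
  have "smooth (\<lambda>p::(real^'d) \<times> real. \<phi> (snd p))"
    using smooth_compose_linear[OF assms(1) bounded_linear_snd, of 0] by simp
  then show ?thesis
    using assms unfolding kinetic_test_function_def periodic_def by auto
qed

section \<open>Weak derivatives on the torus\<close>

lemma torus_borel [measurable]: "(torus :: (real^'d) set) \<in> sets borel"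
proof -
  have "torus = (\<Inter>i. {x::real^'d. 0 \<le> x $ i} \<inter> {x. x $ i < 1})"
    by (auto simp: torus_def)
  also have "\<dots> \<in> sets borel"
    by (intro sets.finite_INT sets.Int) (auto simp: borel_closed borel_open closed_halfspace_component_ge open_halfspace_component_lt)
  finally show ?thesis .
qed

lemma torus_subset_cbox: "torus \<subseteq> cbox 0 (1 :: real^'d)"
  by (auto simp: torus_def mem_box_cart less_imp_le)

lemma box_subset_torus: "box 0 (1 :: real^'d) \<subseteq> torus"
  by (auto simp: torus_def mem_box_cart less_imp_le)

lemma space_torus_measure [simp]: "space torus_measure = torus"
  by (simp add: torus_measure_def space_restrict_space)

lemma AE_torus_measure: "(AE x in torus_measure. P x) \<longleftrightarrow> (AE x in lborel. x \<in> torus \<longrightarrow> P x)"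
  unfolding torus_measure_def by (subst AE_restrict_space_iff) auto

text \<open>The half-open cube exceeds the open one only by points with a vanishing coordinate,
  which lie in null hyperplanes. Pointwise convergence of mollifications is shown in the open
  cube.\<close>

lemma AE_torus_measure_box: "AE x in (torus_measure :: (real^'d) measure). x \<in> box 0 1"
proof -
  have "(\<Union>i. {x::real^'d. x $ i = 0}) \<in> null_sets lborel"
  proof (intro null_sets_UN' countable_finite finite)
    fix i :: 'd
    have "negligible {x::real^'d. axis i 1 \<bullet> x = 0}"
      by (rule negligible_hyperplane) auto
    then have "negligible {x::real^'d. x $ i = 0}" by (simp add: inner_axis')
    moreover have "{x::real^'d. x $ i = 0} \<in> sets borel"
      by (intro borel_closed closed_Collect_eq continuous_intros)
    ultimately show "{x::real^'d. x $ i = 0} \<in> null_sets lborel"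
      by (simp add: negligible_iff_null_sets null_sets_completion_iff)
  qed
  then have "AE x::real^'d in lborel. x \<notin> (\<Union>i. {x. x $ i = 0})"
    by (rule AE_not_in)
  then show ?thesis
    unfolding AE_torus_measure
    by eventually_elim (auto simp: torus_def mem_box_cart order_less_le)
qed

interpretation torus: finite_measure "torus_measure :: (real^'d) measure"
proof
  have "emeasure lborel (torus :: (real^'d) set) \<le> emeasure lborel (cbox 0 (1::real^'d))"
    by (intro emeasure_mono torus_subset_cbox) auto
  also have "\<dots> < \<infinity>" using emeasure_lborel_cbox_finite by blast
  finally have "emeasure lborel (torus :: (real^'d) set) < \<infinity>" .
  then show "emeasure (torus_measure :: (real^'d) measure) (space torus_measure) \<noteq> \<infinity>"
    by (simp add: torus_measure_def emeasure_restrict_space space_restrict_space)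
qed

lemma measurable_torus [measurable (raw)]:
  "f \<in> measurable borel N \<Longrightarrow> f \<in> measurable torus_measure N"
  unfolding torus_measure_def by (intro measurable_restrict_space1) simp

lemma continuous_measurable_torus:
  fixes f :: "real^'d \<Rightarrow> 'b::real_normed_vector"
  shows "continuous_on UNIV f \<Longrightarrow> f \<in> borel_measurable torus_measure"
  by (intro measurable_torus borel_measurable_continuous_onI)

lemma continuous_bounded_torus:
  fixes f :: "real^'d \<Rightarrow> 'b::real_normed_vector"
  assumes "continuous_on UNIV f"
  obtains C where "C \<ge> 0" "\<And>x. x \<in> torus \<Longrightarrow> norm (f x) \<le> C"
proof -
  \<comment> \<open>The half-open cube is not compact; as f is continuous on the whole space, the
    bound is taken on the closed cube.\<close>
  have "bounded (f ` cbox 0 1)"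
    by (intro compact_imp_bounded compact_continuous_image continuous_on_subset[OF assms]) auto
  then obtain C where C: "\<And>x. x \<in> cbox 0 1 \<Longrightarrow> norm (f x) \<le> C"
    unfolding bounded_iff by auto
  show ?thesis
    by (rule that[of "max C 0"]) (use C torus_subset_cbox in fastforce)+
qed

lemma integrable_mult_bounded:
  fixes f g :: "'a \<Rightarrow> real"
  assumes "integrable M g" "f \<in> borel_measurable M" "\<And>x. x \<in> space M \<Longrightarrow> \<bar>f x\<bar> \<le> C"
  shows "integrable M (\<lambda>x. f x * g x)"
proof (rule Bochner_Integration.integrable_bound[of _ "\<lambda>x. C * g x"])
  show "AE x in M. norm (f x * g x) \<le> norm (C * g x)"
    by (rule AE_I2) (use assms(3) in \<open>fastforce simp: abs_mult intro!: mult_right_mono\<close>)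
qed (use assms in auto)

lemma continuous_integrable_torus:
  fixes f :: "real^'d \<Rightarrow> real"
  assumes "continuous_on UNIV f" "integrable torus_measure g"
  shows "integrable torus_measure (\<lambda>x. f x * g x)"
proof -
  obtain C where "\<And>x. x \<in> torus \<Longrightarrow> norm (f x) \<le> C"
    using continuous_bounded_torus[OF assms(1)] by blast
  then show ?thesis
    by (intro integrable_mult_bounded[of _ _ _ C] assms continuous_measurable_torus) auto
qed

text \<open>Fubini isolates the i-th coordinate, and the fundamental theorem of calculus leaves a
  difference of two values one period apart. This gives the weak derivatives of constants.\<close>

lemma integral_torus_derivative:
  fixes \<phi> :: "real^'d \<Rightarrow> real"
  assumes "smooth \<phi>" "periodic \<phi>"
  shows "(\<integral>x. frechet_derivative \<phi> (at x) (axis i 1) \<partial>torus_measure) = 0"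
proof -
  let ?b = "axis i 1 :: real^'d"
  define f where "f x = frechet_derivative \<phi> (at x) ?b" for x
  have b: "?b \<in> Basis" by auto
  have f: "continuous_on S f" for S
    unfolding f_def[abs_def] by (intro smooth_continuous smooth_frechet assms b)
  define g where "g x = indicator torus x *\<^sub>R f x" for x
  have int: "integrable lborel g"
  proof -
    have "integrable torus_measure f"
      using continuous_integrable_torus[OF f, of "\<lambda>_. 1"] by simp
    then show ?thesis
      by (simp add: torus_measure_def integrable_restrict_space g_def[abs_def])
  qed
  have [measurable]: "g \<in> borel_measurable borel"
    using int by auto
  interpret P: product_sigma_finite "\<lambda>b::real^'d. lborel :: real measure"
    by standard
  define h where "h x = g (\<Sum>c\<in>Basis. x c *\<^sub>R c)" for x
  have "(\<integral>x. f x \<partial>torus_measure) = (\<integral>x. g x \<partial>lborel)"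
    by (simp add: torus_measure_def integral_restrict_space g_def)
  also have "\<dots> = (\<integral>x. h x \<partial>(\<Pi>\<^sub>M b\<in>Basis. lborel))"
    unfolding h_def by (subst lborel_eq) (rule integral_distr, auto)
  also have "\<dots> = (\<integral>x. h x \<partial>(\<Pi>\<^sub>M b\<in>insert ?b (Basis - {?b}). lborel))"
    by (rule arg_cong[where f = "\<lambda>S. integral\<^sup>L (Pi\<^sub>M S _) h"]) (use b in auto)
  also have "\<dots> = (\<integral>x. (\<integral>y. h (x(?b := y)) \<partial>lborel) \<partial>(\<Pi>\<^sub>M b\<in>Basis - {?b}. lborel))"
  proof (rule P.product_integral_insert)
    have "integrable (distr (\<Pi>\<^sub>M b\<in>Basis. lborel) borel (\<lambda>f. \<Sum>b\<in>Basis. f b *\<^sub>R b)) g"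
      using int by (subst (asm) lborel_eq)
    then have "integrable (\<Pi>\<^sub>M b\<in>Basis. lborel) h"
      unfolding h_def by (subst (asm) integrable_distr_eq) auto
    also have "Basis = insert ?b (Basis - {?b})" using b by auto
    finally show "integrable (\<Pi>\<^sub>M b\<in>insert ?b (Basis - {?b}). lborel) h" .
  qed auto
  also have "\<dots> = (\<integral>x. 0 \<partial>(\<Pi>\<^sub>M b\<in>Basis - {?b}. (lborel :: real measure)))"
  proof (rule Bochner_Integration.integral_cong[OF refl])
    fix x :: "real^'d \<Rightarrow> real"
    \<comment> \<open>The point with its i-th coordinate replaced by 0: membership in the cube then
      splits into a condition on \<open>z\<close> and one on \<open>y\<close>.\<close>
    define z where "z = (\<Sum>c\<in>Basis - {?b}. x c *\<^sub>R c)"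
    have z: "(\<Sum>c\<in>Basis. (x(?b := y)) c *\<^sub>R c) = z + y *\<^sub>R ?b" for y
      using b by (subst sum.remove[of _ ?b]) (auto simp: z_def intro!: sum.cong)
    have "z \<bullet> ?b = (\<Sum>c\<in>Basis - {?b}. 0)"
      unfolding z_def inner_sum_left by (intro sum.cong refl) (use b in \<open>auto simp: inner_Basis\<close>)
    then have zi: "z $ i = 0" by (simp add: inner_axis)
    have tor: "z + y *\<^sub>R ?b \<in> torus \<longleftrightarrow> z \<in> torus \<and> y \<in> {0..<1}" for y
    proof -
      have "(z + y *\<^sub>R ?b) $ j = (if j = i then y else z $ j)" for j
        using zi by (simp add: axis_def)
      then have "z + y *\<^sub>R ?b \<in> torus \<longleftrightarrow> (\<forall>j. 0 \<le> (if j = i then y else z $ j) \<and> (if j = i then y else z $ j) < 1)"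
        by (simp add: torus_def)
      also have "\<dots> \<longleftrightarrow> z \<in> torus \<and> y \<in> {0..<1}"
        unfolding torus_def using zi by (smt (verit) atLeastLessThan_iff mem_Collect_eq)
      finally show ?thesis .
    qed
    have "(\<integral>y. h (x(?b := y)) \<partial>lborel) = (\<integral>y. indicator torus z *\<^sub>R (indicator {0..<1} y *\<^sub>R f (z + y *\<^sub>R ?b)) \<partial>lborel)"
      unfolding h_def z g_def by (intro Bochner_Integration.integral_cong) (auto simp: tor split: split_indicator)
    also have "\<dots> = indicator torus z *\<^sub>R (\<integral>y. indicator {0..<1} y *\<^sub>R f (z + y *\<^sub>R ?b) \<partial>lborel)"
      by simp
    \<comment> \<open>The fundamental theorem is applied on a closed interval; the added endpoint is
      a null set.\<close>
    also have "(\<integral>y. indicator {0..<1} y *\<^sub>R f (z + y *\<^sub>R ?b) \<partial>lborel) = (\<integral>y. indicator {0..1} y *\<^sub>R f (z + y *\<^sub>R ?b) \<partial>lborel)"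
    proof (rule integral_cong_AE)
      have [measurable]: "f \<in> borel_measurable borel"
        by (intro borel_measurable_continuous_onI f)
      show "(\<lambda>y. indicator {0..<1} y *\<^sub>R f (z + y *\<^sub>R ?b)) \<in> borel_measurable lborel"
        "(\<lambda>y. indicator {0..1} y *\<^sub>R f (z + y *\<^sub>R ?b)) \<in> borel_measurable lborel"
        by measurable
      show "AE y in lborel. indicator {0..<1} y *\<^sub>R f (z + y *\<^sub>R ?b) = indicator {0..1} y *\<^sub>R f (z + y *\<^sub>R ?b)"
        using AE_lborel_singleton[of 1] by eventually_elim (auto split: split_indicator)
    qed
    also have "\<dots> = \<phi> (z + 1 *\<^sub>R ?b) - \<phi> (z + 0 *\<^sub>R ?b)"
    proof (rule integral_FTC_Icc)
      fix y :: real
      have "((\<lambda>y. z + y *\<^sub>R ?b) has_derivative (\<lambda>h. h *\<^sub>R ?b)) (at y)"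
        by (auto intro!: derivative_eq_intros)
      from diff_chain_at[OF this smooth_has_derivative[OF assms(1)]]
      have d: "((\<lambda>y. \<phi> (z + y *\<^sub>R ?b)) has_derivative (\<lambda>h. frechet_derivative \<phi> (at (z + y *\<^sub>R ?b)) (h *\<^sub>R ?b))) (at y)"
        by (simp add: o_def)
      have "frechet_derivative \<phi> (at x) (h *\<^sub>R ?b) = h *\<^sub>R f x" for x h
        unfolding f_def by (rule linear_scale[OF has_derivative_linear[OF smooth_has_derivative[OF assms(1)]]])
      with d have "((\<lambda>y. \<phi> (z + y *\<^sub>R ?b)) has_vector_derivative f (z + y *\<^sub>R ?b)) (at y)"
        by (simp add: has_vector_derivative_def)
      then show "((\<lambda>y. \<phi> (z + y *\<^sub>R ?b)) has_vector_derivative f (z + y *\<^sub>R ?b)) (at y within {0..1})"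
        by (rule has_vector_derivative_at_within)
    qed (auto intro!: continuous_on_compose2[OF f] continuous_intros)
    also have "\<dots> = 0"
      using assms(2) by (simp add: periodic_def)
    finally show "(\<integral>y. h (x(?b := y)) \<partial>lborel) = 0" by (simp only: scaleR_zero_right)
  qed
  finally show ?thesis by (simp add: f_def)
qed

lemma smooth_grad_continuous: "smooth \<phi> \<Longrightarrow> continuous_on S (grad \<phi>)"
  unfolding grad_def[abs_def]
  by (intro continuous_on_vec_lambda smooth_continuous smooth_frechet) auto

lemma integrable_torus_bounded_scaleR:
  fixes f :: "real^'d \<Rightarrow> 'b::{banach, second_countable_topology}"
  assumes "continuous_on UNIV f" "integrable torus_measure u"
  shows "integrable torus_measure (\<lambda>x. u x *\<^sub>R f x)"
proof -
  obtain C where "C \<ge> 0" "\<And>x. x \<in> torus \<Longrightarrow> norm (f x) \<le> C"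
    using continuous_bounded_torus[OF assms(1)] by blast
  then show ?thesis
    using assms(2) continuous_measurable_torus[OF assms(1)]
    by (intro Bochner_Integration.integrable_bound[of _ "\<lambda>x. C * u x" "\<lambda>x. u x *\<^sub>R f x"])
      (auto intro!: AE_I2 mult_right_mono simp: abs_mult mult.commute[of "\<bar>_\<bar>"])
qed

lemma integrable_torus_continuous_scaleR:
  fixes f :: "real^'d \<Rightarrow> real" and u :: "real^'d \<Rightarrow> 'b::{banach, second_countable_topology}"
  assumes "continuous_on UNIV f" "integrable torus_measure u"
  shows "integrable torus_measure (\<lambda>x. f x *\<^sub>R u x)"
proof -
  obtain C where "C \<ge> 0" "\<And>x. x \<in> torus \<Longrightarrow> norm (f x) \<le> C"
    using continuous_bounded_torus[OF assms(1)] by blast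
  then show ?thesis
    using assms(2) continuous_measurable_torus[OF assms(1)]
    by (intro Bochner_Integration.integrable_bound[of _ "\<lambda>x. C *\<^sub>R u x" "\<lambda>x. f x *\<^sub>R u x"])
      (auto intro!: AE_I2 simp: mult_right_mono)
qed

lemma integral_vec_nth:
  fixes f :: "'a \<Rightarrow> real^'d"
  assumes "integrable M f"
  shows "(\<integral>x. f x $ i \<partial>M) = (\<integral>x. f x \<partial>M) $ i" "integrable M (\<lambda>x. f x $ i)"
  using integral_bounded_linear[OF bounded_linear_vec_nth assms]
    integrable_bounded_linear[OF bounded_linear_vec_nth assms] by auto

lemma has_weak_gradient_component:
  assumes "has_weak_gradient u g" "smooth \<phi>" "periodic \<phi>"
  shows "(\<integral>x. u x * frechet_derivative \<phi> (at x) (axis i 1) \<partial>torus_measure) =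
    - (\<integral>x. \<phi> x * g x $ i \<partial>torus_measure)"
proof -
  have u: "integrable torus_measure u" and g: "integrable torus_measure g"
    and eq: "(\<integral>x. u x *\<^sub>R grad \<phi> x \<partial>torus_measure) = - (\<integral>x. \<phi> x *\<^sub>R g x \<partial>torus_measure)"
    using assms by (auto simp: has_weak_gradient_def)
  have 1: "integrable torus_measure (\<lambda>x. u x *\<^sub>R grad \<phi> x)"
    by (rule integrable_torus_bounded_scaleR[OF smooth_grad_continuous[OF assms(2)] u])
  have 2: "integrable torus_measure (\<lambda>x. \<phi> x *\<^sub>R g x)"
    by (rule integrable_torus_continuous_scaleR[OF smooth_continuous[OF assms(2)] g])
  show ?thesis
    using arg_cong[OF eq, of "\<lambda>v. v $ i"] integral_vec_nth(1)[OF 1, of i] integral_vec_nth(1)[OF 2, of i]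
    by (simp add: grad_def)
qed

lemma integral_torus_grad:
  assumes "smooth \<phi>" "periodic \<phi>"
  shows "(\<integral>x. grad \<phi> x \<partial>torus_measure) = 0"
proof -
  have "integrable torus_measure (grad \<phi>)"
    using integrable_torus_bounded_scaleR[OF smooth_grad_continuous[OF assms(1)], of "\<lambda>_. 1"] by simp
  from integral_vec_nth(1)[OF this] show ?thesis
    using integral_torus_derivative[OF assms] by (simp add: grad_def vec_eq_iff)
qed

lemma has_weak_gradient_const: "has_weak_gradient (\<lambda>_. c) (\<lambda>_. 0)"
  by (simp add: has_weak_gradient_def integral_torus_grad)

text \<open>Applied to the coordinate vectors, this turns the chain rule into the statement that
  each component of the gradient of a function integrates to zero, as the transport term
  requires.\<close>

lemma has_weak_divergence_const: "has_weak_divergence (\<lambda>_. v) (\<lambda>_. 0)"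
  unfolding has_weak_divergence_def
proof (intro conjI allI impI)
  fix \<phi> :: "real^'a \<Rightarrow> real" assume "smooth \<phi> \<and> periodic \<phi>"
  then have "smooth \<phi>" "periodic \<phi>" by auto
  moreover from this have "integrable torus_measure (grad \<phi>)"
    using integrable_torus_bounded_scaleR[OF smooth_grad_continuous[OF \<open>smooth \<phi>\<close>], of "\<lambda>_. 1"] by simp
  ultimately show "(\<integral>x. v \<bullet> grad \<phi> x \<partial>torus_measure) = - (\<integral>x. 0 * \<phi> x \<partial>torus_measure)"
    by (simp add: integral_torus_grad)
qed auto

section \<open>Mollification by trigonometric kernels\<close>

text \<open>Finite sums of products a(x) b(y). Integrating out y against u leaves a finite linear
  combination of the a(x), so smoothness in x and differentiation under the integral become algebra.
  Periodicity of a makes the integral periodic in x.\<close>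

inductive separable_kernel :: "(real^'d \<Rightarrow> real^'d \<Rightarrow> real) \<Rightarrow> bool" where
  separable_kernel_prod: "smooth a \<Longrightarrow> periodic a \<Longrightarrow> smooth b \<Longrightarrow> separable_kernel (\<lambda>x y. a x * b y)"
| separable_kernel_add: "separable_kernel k \<Longrightarrow> separable_kernel l \<Longrightarrow> separable_kernel (\<lambda>x y. k x y + l x y)"

lemma separable_kernel_const: "separable_kernel (\<lambda>x y. c)"
  using separable_kernel_prod[of "\<lambda>_. c" "\<lambda>_. 1"] by (simp add: periodic_def)

lemma separable_kernel_mult:
  assumes "separable_kernel k" "separable_kernel l"
  shows "separable_kernel (\<lambda>x y. k x y * l x y)"
  using assms(1)
proof induction
  case (separable_kernel_prod a b)
  note ab = separable_kernel_prod
  show ?case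
    using assms(2)
  proof induction
    case (separable_kernel_prod c d)
    have "separable_kernel (\<lambda>x y. (a x * c x) * (b y * d y))"
      using ab separable_kernel_prod
      by (intro separable_kernel.separable_kernel_prod smooth_mult) (auto simp: periodic_def)
    then show ?case by (simp add: mult_ac)
  next
    case (separable_kernel_add k l)
    from separable_kernel.separable_kernel_add[OF separable_kernel_add.IH] show ?case
      by (simp add: algebra_simps)
  qed
next
  case (separable_kernel_add k l)
  from separable_kernel.separable_kernel_add[OF separable_kernel_add.IH] show ?case
    by (simp add: algebra_simps)
qed

lemma separable_kernel_power: "separable_kernel k \<Longrightarrow> separable_kernel (\<lambda>x y. k x y ^ n)"
  by (induction n) (auto intro: separable_kernel_const separable_kernel_mult)

lemma separable_kernel_setprod:
  "finite S \<Longrightarrow> (\<And>i. i \<in> S \<Longrightarrow> separable_kernel (k i)) \<Longrightarrow> separable_kernel (\<lambda>x y. \<Prod>i\<in>S. k i x y)"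
  by (induction S rule: finite_induct) (auto intro: separable_kernel_const separable_kernel_mult)

text \<open>The conclusions are proved as one conjunction because the sum case needs smoothness and
  integrability of both summands to split the integral and its derivative.\<close>

lemma has_derivative_integral_separable:
  fixes k :: "real^'d \<Rightarrow> real^'d \<Rightarrow> real"
  assumes "separable_kernel k" "integrable torus_measure u"
  shows "(\<forall>y. smooth (\<lambda>x. k x y)) \<and> (\<forall>x. integrable torus_measure (\<lambda>y. k x y * u y)) \<and>
    smooth (\<lambda>x. \<integral>y. k x y * u y \<partial>torus_measure) \<and> periodic (\<lambda>x. \<integral>y. k x y * u y \<partial>torus_measure) \<and>
    (\<forall>x v. integrable torus_measure (\<lambda>y. frechet_derivative (\<lambda>x. k x y) (at x) v * u y) \<and>
      ((\<lambda>x. \<integral>y. k x y * u y \<partial>torus_measure) has_derivative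
       (\<lambda>v. \<integral>y. frechet_derivative (\<lambda>x. k x y) (at x) v * u y \<partial>torus_measure)) (at x))"
  using assms(1)
proof induction
  case (separable_kernel_prod a b)
  have d: "frechet_derivative (\<lambda>x. a x * b y) (at x) = (\<lambda>v. frechet_derivative a (at x) v * b y)" for x y
    by (rule frechet_derivative_at[symmetric])
      (intro has_derivative_mult_left smooth_has_derivative separable_kernel_prod)
  have i: "integrable torus_measure (\<lambda>y. b y * u y)"
    by (intro continuous_integrable_torus smooth_continuous separable_kernel_prod assms)
  have s: "smooth (\<lambda>x. a x * c)" for c
    by (intro smooth_mult separable_kernel_prod) auto
  show ?case
    unfolding d mult.assoc
    using i s separable_kernel_prod(1,2)
    by (auto simp: periodic_def intro!: has_derivative_mult_left smooth_has_derivative)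
next
  case (separable_kernel_add k l)
  have d: "frechet_derivative (\<lambda>x. k x y + l x y) (at x) =
     (\<lambda>v. frechet_derivative (\<lambda>x. k x y) (at x) v + frechet_derivative (\<lambda>x. l x y) (at x) v)" for x y
    by (rule frechet_derivative_at[symmetric])
      (use separable_kernel_add.IH in \<open>intro has_derivative_add smooth_has_derivative; blast\<close>)
  show ?case
    unfolding d distrib_right
    using separable_kernel_add.IH
    by (auto simp: periodic_def intro!: has_derivative_add smooth_add)
qed

text \<open>A trigonometric kernel: its powers, normalised, concentrate at the lattice points, and being
  separable they can be differentiated under the integral sign without any limit theorem.\<close>

definition bump :: "real^'d \<Rightarrow> real" where
  "bump z = (\<Prod>i\<in>UNIV. (1 + cos (2 * pi * z $ i)) / 2)"

lemma bump_nonneg: "0 \<le> bump z"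
proof -
  have "0 \<le> 1 + cos x" for x :: real using cos_ge_minus_one[of x] by linarith
  then show ?thesis by (auto simp: bump_def intro!: prod_nonneg)
qed

lemma bump_0: "bump 0 = 1"
  by (simp add: bump_def)

lemma bump_minus: "bump (x - y) = bump (y - x)"
proof -
  have "cos (2 * pi * (x - y) $ i) = cos (2 * pi * (y - x) $ i)" for i
    using cos_minus[of "2 * pi * (x - y) $ i"] by (simp add: algebra_simps)
  then show ?thesis by (simp add: bump_def)
qed

lemma smooth_bump: "smooth bump"
proof -
  have c: "smooth (\<lambda>z::real^'d. cos (2 * pi * z $ i))" for i
    using smooth_compose_linear[OF smooth_sin_cos(2), of "\<lambda>z. 2 * pi * z $ i" 0]
    by (simp add: bounded_linear_const_mult[OF bounded_linear_vec_nth])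
  have "smooth (\<lambda>z::real^'d. \<Prod>i\<in>S. (1 / 2) * (1 + cos (2 * pi * z $ i)))" if "finite S" for S
    using that by induction (auto intro!: smooth_mult smooth_add c smooth_cmult simp del: times_divide_eq_left)
  from this[OF finite] show ?thesis by (simp add: bump_def[abs_def])
qed

text \<open>\<open>bump\<close> reaches 1 only at lattice points. With x in the open cube and y in
  the closed one, every coordinate of x - y has modulus below 1, so the only lattice point it can be
  is 0; with both points on the boundary, opposite faces would spoil this.\<close>

lemma bump_less_1:
  assumes "x \<in> box 0 1" "y \<in> cbox 0 1" "x \<noteq> y"
  shows "bump (x - y) < 1"
proof -
  obtain i where i: "x $ i \<noteq> y $ i" using assms(3) by (auto simp: vec_eq_iff)
  have r: "\<bar>x $ i - y $ i\<bar> < 1" "\<bar>x $ i - y $ i\<bar> > 0"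
  proof -
    have "0 < x $ i" "x $ i < 1" "0 \<le> y $ i" "y $ i \<le> 1"
      using assms(1,2) by (auto simp: mem_box_cart)
    then show "\<bar>x $ i - y $ i\<bar> < 1" "\<bar>x $ i - y $ i\<bar> > 0"
      using i by linarith+
  qed
  have "cos (2 * pi * (x - y) $ i) \<noteq> 1"
  proof
    assume "cos (2 * pi * (x - y) $ i) = 1"
    then obtain n :: int where "2 * pi * (x - y) $ i = of_int n * 2 * pi"
      by (auto simp: cos_one_2pi_int)
    then have n: "x $ i - y $ i = of_int n" by simp
    from r(1) have "n = 0" unfolding n by linarith
    with r(2) n show False by simp
  qed
  with cos_le_one have "cos (2 * pi * (x - y) $ i) < 1" by (simp add: order_less_le)
  then have c: "(1 + cos (2 * pi * (x - y) $ i)) / 2 < 1" by simp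
  have nn: "0 \<le> 1 + cos x" for x :: real using cos_ge_minus_one[of x] by linarith
  have "bump (x - y) = (1 + cos (2 * pi * (x - y) $ i)) / 2 * (\<Prod>j\<in>UNIV-{i}. (1 + cos (2 * pi * (x - y) $ j)) / 2)"
    unfolding bump_def by (rule prod.remove) auto
  also have "\<dots> \<le> (1 + cos (2 * pi * (x - y) $ i)) / 2 * 1"
    using nn by (intro mult_left_mono prod_le_1) auto
  finally show ?thesis using c by linarith
qed

text \<open>The addition theorem for the cosine separates each factor of
  \<open>bump (x - y)\<close>; products and powers of separable kernels stay separable.\<close>

lemma separable_kernel_bump: "separable_kernel (\<lambda>x y. bump (x - y) ^ n)"
proof -
  have c: "separable_kernel (\<lambda>x y::real^'d. h (2 * pi * x $ i) * h (2 * pi * y $ i))" if "h = sin \<or> h = cos" for h i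
  proof (rule separable_kernel_prod)
    have "smooth h" using that smooth_sin_cos by auto
    then show "smooth (\<lambda>z::real^'d. h (2 * pi * z $ i))" "smooth (\<lambda>z::real^'d. h (2 * pi * z $ i))"
      using smooth_compose_linear[of h "\<lambda>z. 2 * pi * z $ i" 0]
      by (simp_all add: bounded_linear_const_mult[OF bounded_linear_vec_nth])
    have "h (2 * pi * (x + d)) = h (2 * pi * x)" if "d = 0 \<or> d = 1" for x d
      using that \<open>h = sin \<or> h = cos\<close> by (auto simp: distrib_left)
    then show "periodic (\<lambda>z::real^'d. h (2 * pi * z $ i))"
      by (auto simp: periodic_def axis_def)
  qed
  have "separable_kernel (\<lambda>x y::real^'d. (1 / 2) * (1 + (cos (2 * pi * x $ i) * cos (2 * pi * y $ i)
     + sin (2 * pi * x $ i) * sin (2 * pi * y $ i))))" for i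
    by (intro separable_kernel_mult separable_kernel_const separable_kernel_add c) auto
  then have "separable_kernel (\<lambda>x y::real^'d. (1 + cos (2 * pi * (x - y) $ i)) / 2)" for i
    by (simp add: right_diff_distrib cos_diff)
  then show ?thesis
    unfolding bump_def by (intro separable_kernel_power separable_kernel_setprod) auto
qed

lemma integrable_bump:
  assumes "integrable torus_measure u"
  shows "integrable torus_measure (\<lambda>y. bump (x - y) ^ n * u y)"
  using has_derivative_integral_separable[OF separable_kernel_bump assms] by blast

text \<open>The kernel depends on x - y only, so its x-derivative is minus its y-derivative; for
  fixed x it is a smooth periodic function of y, hence a test function in the definition of the weak
  gradient.\<close>

lemma frechet_integral_bump:
  assumes "has_weak_gradient u g"
  shows "frechet_derivative (\<lambda>x. \<integral>y. bump (x - y) ^ n * u y \<partial>torus_measure) (at x) (axis i 1) =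
    (\<integral>y. bump (x - y) ^ n * g y $ i \<partial>torus_measure)"
proof -
  have u: "integrable torus_measure u" using assms by (simp add: has_weak_gradient_def)
  define b where "b z = bump z ^ n" for z :: "real^'a"
  have b: "smooth b" unfolding b_def[abs_def] by (intro smooth_power smooth_bump)
  have pb: "periodic b"
    unfolding b_def periodic_def bump_def
    by (auto intro!: arg_cong[where f = "\<lambda>x. x ^ n"] prod.cong simp: axis_def distrib_left)
  have 1: "frechet_derivative (\<lambda>x. b (x - y)) (at x) = frechet_derivative b (at (x - y))" for x y
  proof (rule frechet_derivative_at[symmetric])
    have "((\<lambda>x. x - y) has_derivative (\<lambda>v. v)) (at x)" by (auto intro!: derivative_eq_intros)
    from diff_chain_at[OF this smooth_has_derivative[OF b]]
    show "((\<lambda>x. b (x - y)) has_derivative frechet_derivative b (at (x - y))) (at x)"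
      by (simp add: o_def)
  qed
  have 2: "frechet_derivative (\<lambda>y. b (x - y)) (at y) v = - frechet_derivative b (at (x - y)) v" for x y v
  proof -
    have "((\<lambda>y. x - y) has_derivative (\<lambda>v. - v)) (at y)" by (auto intro!: derivative_eq_intros)
    from diff_chain_at[OF this smooth_has_derivative[OF b]]
    have d: "((\<lambda>y. b (x - y)) has_derivative (\<lambda>v. frechet_derivative b (at (x - y)) (- v))) (at y)"
      by (simp add: o_def)
    have "frechet_derivative (\<lambda>y. b (x - y)) (at y) v = frechet_derivative b (at (x - y)) (- v)"
      by (rule fun_cong[OF frechet_derivative_at[OF d], symmetric])
    then show ?thesis
      by (simp add: linear_neg[OF has_derivative_linear[OF smooth_has_derivative[OF b]]])
  qed
  have "smooth (\<lambda>y. b ((\<lambda>z. - z) y + x))"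
    by (intro smooth_compose_linear b bounded_linear_minus bounded_linear_ident)
  then have s: "smooth (\<lambda>y. b (x - y))" by simp
  have p: "periodic (\<lambda>y. b (x - y))"
    unfolding periodic_def
  proof (intro allI)
    fix y i
    have "x - (y + axis i 1) + axis i 1 = x - y" by simp
    then show "b (x - (y + axis i 1)) = b (x - y)"
      using pb[unfolded periodic_def, rule_format, of "x - (y + axis i 1)" i] by simp
  qed
  have d: "((\<lambda>x. \<integral>y. b (x - y) * u y \<partial>torus_measure) has_derivative
       (\<lambda>v. \<integral>y. frechet_derivative (\<lambda>x. b (x - y)) (at x) v * u y \<partial>torus_measure)) (at x)"
    using has_derivative_integral_separable[OF separable_kernel_bump u, of n] unfolding b_def by blast
  have "frechet_derivative (\<lambda>x. \<integral>y. b (x - y) * u y \<partial>torus_measure) (at x) (axis i 1) =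
     (\<integral>y. frechet_derivative (\<lambda>x. b (x - y)) (at x) (axis i 1) * u y \<partial>torus_measure)"
    by (rule fun_cong[OF frechet_derivative_at[OF d], symmetric])
  also have "\<dots> = - (\<integral>y. u y * frechet_derivative (\<lambda>y. b (x - y)) (at y) (axis i 1) \<partial>torus_measure)"
    unfolding 1 2 by (simp add: mult.commute)
  also have "\<dots> = (\<integral>y. b (x - y) * g y $ i \<partial>torus_measure)"
    unfolding has_weak_gradient_component[OF assms s p] by simp
  finally show ?thesis by (simp add: b_def)
qed

text \<open>The \<open>itself\<close> argument carries the dimension, which no other argument
  mentions. The base point 0 is arbitrary, as \<open>integral_bump\<close> shows.\<close>

definition bump_mass :: "'d::finite itself \<Rightarrow> nat \<Rightarrow> real" where
  "bump_mass _ n = (\<integral>y. bump (0 - y :: real^'d) ^ n \<partial>torus_measure)"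

text \<open>The mass does not depend on \<open>x\<close> because the constant one has weak gradient zero.\<close>

lemma integral_bump: "(\<integral>y. bump (x - y :: real^'d) ^ n \<partial>torus_measure) = bump_mass TYPE('d) n"
proof -
  let ?m = "\<lambda>x. \<integral>y. bump (x - y :: real^'d) ^ n * 1 \<partial>torus_measure"
  have sm: "smooth ?m"
    using has_derivative_integral_separable[OF separable_kernel_bump[where ?'a = 'd], of "\<lambda>_. 1" n] by simp
  have z: "frechet_derivative ?m (at x) b = 0" if b: "b \<in> Basis" for x b
  proof -
    obtain i where "b = axis i 1" using b by (auto simp: Basis_vec_def)
    then show ?thesis using frechet_integral_bump[OF has_weak_gradient_const[of 1], of n x i] by simp
  qed
  have "frechet_derivative ?m (at x) v = 0" for x v
  proof -
    have l: "linear (frechet_derivative ?m (at x))"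
      by (rule has_derivative_linear[OF smooth_has_derivative[OF sm]])
    show ?thesis
      by (rule linear_eq_0_on_span[OF l z]) auto
  qed
  then have "frechet_derivative ?m (at x) = (\<lambda>v. 0)" for x by blast
  then have "(?m has_derivative (\<lambda>v. 0)) (at x within UNIV)" for x
    using smooth_has_derivative[OF sm, of x] by simp
  from has_derivative_zero_unique[OF convex_UNIV this, of x 0]
  show ?thesis by (simp add: bump_mass_def)
qed

text \<open>By continuity \<open>bump (c - y)\<close> exceeds t on a small ball around c inside the
  cube. The mass thus decays more slowly than t^n for every t < 1, while the kernel away from its
  peak decays like s^n for some s < 1.\<close>

lemma bump_mass_lower:
  assumes c: "c \<in> box 0 (1 :: real^'d)" and t: "0 \<le> t" "t < 1"
  obtains m where "m > 0" "\<And>n. m * t ^ n \<le> bump_mass TYPE('d::finite) n"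
proof -
  have "isCont (\<lambda>y. bump (c - y)) c"
    using smooth_continuous[OF smooth_bump, of UNIV]
    by (intro continuous_intros isCont_o2[of _ "\<lambda>y. c - y" bump]) (auto simp: continuous_on_eq_continuous_at)
  then have "(\<lambda>y. bump (c - y)) \<midarrow>c\<rightarrow> 1" by (simp add: isCont_def bump_0)
  then have "eventually (\<lambda>y. bump (c - y) > t) (at c)"
    by (rule order_tendstoD) (use t in auto)
  then obtain d where d: "d > 0" "\<And>y. y \<noteq> c \<Longrightarrow> dist y c < d \<Longrightarrow> bump (c - y) > t"
    by (auto simp: eventually_at)
  have d': "bump (c - y) > t" if "dist y c < d" for y
    using d(2)[OF _ that] t by (cases "y = c") (auto simp: bump_0)
  obtain e where e: "e > 0" "ball c e \<subseteq> box 0 1"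
    using open_contains_ball[of "box 0 (1::real^'d)"] c open_box by blast
  let ?B = "ball c (min d e)"
  have B: "?B \<subseteq> torus" using e(2) box_subset_torus by fastforce
  show ?thesis
  proof (rule that)
    show "measure lborel ?B > 0"
      using d(1) e(1) by (simp add: content_ball_pos)
    fix n
    have "measure lborel ?B = measure torus_measure ?B"
      using B by (simp add: torus_measure_def measure_restrict_space)
    also have "measure torus_measure ?B * t ^ n = (\<integral>y. t ^ n * indicator ?B y \<partial>torus_measure)"
      using B by (simp add: Int_absorb2)
    also have "\<dots> \<le> (\<integral>y. bump (c - y) ^ n \<partial>torus_measure)"
    proof (rule integral_mono)
      show "integrable torus_measure (\<lambda>y. bump (c - y) ^ n)"
        using integrable_bump[of "\<lambda>_. 1" c n] by simp
      show "integrable torus_measure (\<lambda>y. t ^ n * indicat_real ?B y)"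
      proof (intro integrable_mult_right torus.integrable_const_bound[of _ 1])
        show "indicat_real ?B \<in> borel_measurable torus_measure"
          by (intro measurable_torus borel_measurable_indicator) auto
      qed (auto split: split_indicator)
      show "t ^ n * indicator ?B y \<le> bump (c - y) ^ n" for y
        using d'[of y] t by (auto simp: dist_commute bump_nonneg intro!: power_mono split: split_indicator)
    qed
    finally show "measure lborel ?B * t ^ n \<le> bump_mass TYPE('d) n" by (simp add: integral_bump)
  qed
qed

lemma bump_mass_pos: "bump_mass TYPE('d::finite) n > 0"
proof -
  have "(\<chi> i. 1 / 2) \<in> box 0 (1 :: real^'d)" by (auto simp: mem_box_cart)
  then obtain m where "m > 0" "\<And>n. m * (1 / 2) ^ n \<le> bump_mass TYPE('d) n"
    by (rule bump_mass_lower[of _ "1 / 2"]) auto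
  then show ?thesis
    by (meson less_le_trans mult_pos_pos zero_less_divide_1_iff zero_less_numeral zero_less_power)
qed

section \<open>Normalised mollification and its convergence in mean\<close>

definition mollify :: "nat \<Rightarrow> (real^'d \<Rightarrow> real) \<Rightarrow> real^'d \<Rightarrow> real" where
  "mollify n u x = (\<integral>y. bump (x - y) ^ n * u y \<partial>torus_measure) / bump_mass TYPE('d) n"

lemma smooth_mollify:
  assumes "integrable torus_measure u"
  shows "smooth (mollify n u)" "periodic (mollify n u)"
proof -
  have "smooth (\<lambda>x. \<integral>y. bump (x - y) ^ n * u y \<partial>torus_measure)"
    "periodic (\<lambda>x. \<integral>y. bump (x - y) ^ n * u y \<partial>torus_measure)"
    using has_derivative_integral_separable[OF separable_kernel_bump assms] by auto
  then show "smooth (mollify n u)" "periodic (mollify n u)"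
    using smooth_cmult[of _ "1 / bump_mass TYPE('a) n"] by (auto simp: mollify_def[abs_def] periodic_def)
qed

lemma frechet_mollify:
  fixes u :: "real^'d \<Rightarrow> real"
  assumes "has_weak_gradient u g"
  shows "frechet_derivative (mollify n u) (at x) (axis i 1) = mollify n (\<lambda>y. g y $ i) x"
proof -
  let ?I = "\<lambda>x. \<integral>y. bump (x - y) ^ n * u y \<partial>torus_measure"
  have u: "integrable torus_measure u" using assms by (simp add: has_weak_gradient_def)
  have "smooth ?I"
    using has_derivative_integral_separable[OF separable_kernel_bump u] by auto
  from has_derivative_mult_right[OF smooth_has_derivative[OF this], of "1 / bump_mass TYPE('d) n"]
  have d: "(mollify n u has_derivative (\<lambda>v. frechet_derivative ?I (at x) v / bump_mass TYPE('d) n)) (at x)"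
    by (simp add: mollify_def[abs_def])
  show ?thesis
    using fun_cong[OF frechet_derivative_at[OF d], of "axis i 1"] frechet_integral_bump[OF assms, of n x i]
    by (simp add: mollify_def)
qed

lemma mollify_const: "mollify n (\<lambda>_. c) x = c"
  unfolding mollify_def using bump_mass_pos[where ?'d = 'a, of n] by (simp add: integral_bump)

lemma mollify_mono:
  assumes "integrable torus_measure u" "integrable torus_measure v" "\<And>y. y \<in> torus \<Longrightarrow> u y \<le> v y"
  shows "mollify n u x \<le> mollify n v x"
  unfolding mollify_def
  by (intro divide_right_mono integral_mono integrable_bump assms mult_left_mono zero_le_power bump_nonneg)
    (use bump_mass_pos[where ?'d = 'a, of n] assms(3) in \<open>auto\<close>)

lemma mollify_diff:
  assumes "integrable torus_measure u" "integrable torus_measure v"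
  shows "mollify n (\<lambda>x. u x - v x) x = mollify n u x - mollify n v x"
  unfolding mollify_def right_diff_distrib diff_divide_distrib[symmetric]
  by (simp add: Bochner_Integration.integral_diff[OF integrable_bump[OF assms(1)] integrable_bump[OF assms(2)]])

lemma mollify_in_interval:
  assumes "integrable torus_measure u" "\<And>y. y \<in> torus \<Longrightarrow> u y \<in> {a..b}"
  shows "mollify n u x \<in> {a..b}"
  using mollify_mono[OF _ assms(1), of "\<lambda>_. a" n x] mollify_mono[OF assms(1), of "\<lambda>_. b" n x] assms(2)
  by (simp add: mollify_const)

lemma integrable_mollify:
  assumes "integrable torus_measure u"
  shows "integrable torus_measure (mollify n u)"
  using continuous_integrable_torus[of "mollify n u" "\<lambda>_. 1"] smooth_continuous[OF smooth_mollify(1)[OF assms]]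
  by simp

text \<open>By \<open>bump_minus\<close> the kernel has mass one in either variable; after an
  exchange of the two integrals the kernel integrates out.\<close>

lemma mollify_contraction:
  fixes u :: "real^'d \<Rightarrow> real"
  assumes "integrable torus_measure u"
  shows "(\<integral>x. \<bar>mollify n u x\<bar> \<partial>torus_measure) \<le> (\<integral>x. \<bar>u x\<bar> \<partial>torus_measure)"
proof -
  interpret P: pair_sigma_finite "torus_measure :: (real^'d) measure" "torus_measure :: (real^'d) measure" ..
  let ?c = "bump_mass TYPE('d) n"
  have c: "?c > 0" by (rule bump_mass_pos)
  have [measurable]: "bump \<in> borel_measurable (borel :: (real^'d) measure)"
    by (intro borel_measurable_continuous_onI smooth_continuous smooth_bump)
  have [measurable]: "u \<in> borel_measurable torus_measure" using assms by auto
  have id [measurable]: "(\<lambda>x. x) \<in> borel_measurable (torus_measure :: (real^'d) measure)" by (intro measurable_torus) auto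
  have "(\<integral>x. \<bar>mollify n u x\<bar> \<partial>torus_measure) \<le> (\<integral>x. mollify n (\<lambda>y. \<bar>u y\<bar>) x \<partial>torus_measure)"
  proof (rule integral_mono)
    fix x :: "real^'d"
    have "mollify n u x \<le> mollify n (\<lambda>y. \<bar>u y\<bar>) x"
      by (rule mollify_mono) (use assms in auto)
    moreover have "mollify n (\<lambda>y. 0 - u y) x \<le> mollify n (\<lambda>y. \<bar>u y\<bar>) x"
      by (rule mollify_mono) (use assms in auto)
    ultimately show "\<bar>mollify n u x\<bar> \<le> mollify n (\<lambda>y. \<bar>u y\<bar>) x"
      using mollify_diff[of "\<lambda>_. 0" u n x] assms by (simp add: mollify_const)
  next
    show "integrable torus_measure (\<lambda>x. \<bar>mollify n u x\<bar>)"
      "integrable torus_measure (mollify n (\<lambda>y. \<bar>u y\<bar>))"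
      by (intro integrable_mollify integrable_abs assms)+
  qed
  also have "\<dots> = (\<integral>x. (\<integral>y. bump (x - y) ^ n * \<bar>u y\<bar> / ?c \<partial>torus_measure) \<partial>torus_measure)"
    by (simp add: mollify_def)
  also have "\<dots> = (\<integral>y. (\<integral>x. bump (x - y) ^ n * \<bar>u y\<bar> / ?c \<partial>torus_measure) \<partial>torus_measure)"
  proof (rule P.Fubini_integral[symmetric])
    show "integrable (torus_measure \<Otimes>\<^sub>M torus_measure) (\<lambda>(x, y). bump (x - y) ^ n * \<bar>u y\<bar> / ?c)"
    proof (rule P.Fubini_integrable)
      show "(\<lambda>(x, y). bump (x - y) ^ n * \<bar>u y\<bar> / ?c) \<in> borel_measurable (torus_measure \<Otimes>\<^sub>M torus_measure)"
        by measurable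
      show "integrable torus_measure (\<lambda>x. \<integral>y. norm (case (x, y) of (x, y) \<Rightarrow> bump (x - y) ^ n * \<bar>u y\<bar> / ?c) \<partial>torus_measure)"
        using integrable_mollify[of "\<lambda>y. \<bar>u y\<bar>" n] c assms
        by (simp add: mollify_def[abs_def] abs_mult power_abs abs_of_nonneg[OF bump_nonneg])
      show "AE x in torus_measure. integrable torus_measure (\<lambda>y. case (x, y) of (x, y) \<Rightarrow> bump (x - y) ^ n * \<bar>u y\<bar> / ?c)"
        using integrable_bump[of "\<lambda>y. \<bar>u y\<bar>"] assms by (auto intro!: AE_I2)
    qed
  qed
  also have "\<dots> = (\<integral>y. \<bar>u y\<bar> \<partial>torus_measure)"
  proof (rule Bochner_Integration.integral_cong[OF refl])
    fix y :: "real^'d"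
    have "(\<integral>x. bump (x - y) ^ n * \<bar>u y\<bar> / ?c \<partial>torus_measure) = (\<integral>x. bump (y - x) ^ n \<partial>torus_measure) * \<bar>u y\<bar> / ?c"
      by (simp add: bump_minus[of _ y])
    then show "(\<integral>x. bump (x - y) ^ n * \<bar>u y\<bar> / ?c \<partial>torus_measure) = \<bar>u y\<bar>"
      using c by (simp add: integral_bump)
  qed
  finally show ?thesis .
qed

text \<open>Near x the continuity of g controls the average; on the rest of the closed cube the
  kernel is exponentially small relative to its mass. No periodicity of g is involved, since from an
  interior x the kernel peaks within the closed cube at x alone.\<close>

lemma mollify_tendsto:
  fixes g :: "real^'d \<Rightarrow> real"
  assumes g: "continuous_on UNIV g" "\<And>y. \<bar>g y\<bar> \<le> B" and x: "x \<in> box 0 1"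
  shows "(\<lambda>n. mollify n g x) \<longlonglongrightarrow> g x"
proof (rule LIMSEQ_I)
  fix e :: real assume e: "e > 0"
  have ig: "integrable torus_measure g"
    using continuous_integrable_torus[OF g(1), of "\<lambda>_. 1"] by simp
  obtain d where d: "d > 0" "\<And>y. dist y x < d \<Longrightarrow> \<bar>g y - g x\<bar> < e / 2"
    using g(1) e unfolding continuous_on_iff by (metis UNIV_I dist_real_def half_gt_zero)
  have B: "B \<ge> 0" using g(2)[of 0] by linarith
  define S where "S = cbox 0 (1::real^'d) - ball x d"
  have S: "compact S" unfolding S_def by (intro compact_diff compact_cbox open_ball)
  have cb: "continuous_on S (\<lambda>y. bump (x - y))"
    by (intro continuous_on_compose2[OF smooth_continuous[OF smooth_bump, of UNIV]] continuous_intros) auto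
  obtain s where s: "0 \<le> s" "s < 1" "\<And>y. y \<in> S \<Longrightarrow> bump (x - y) \<le> s"
  proof (cases "S = {}")
    case True
    then show ?thesis using that[of 0] by auto
  next
    case False
    obtain z where z: "z \<in> S" "\<And>y. y \<in> S \<Longrightarrow> bump (x - y) \<le> bump (x - z)"
      using continuous_attains_sup[OF S False cb] by blast
    have "z \<in> cbox 0 1" "z \<noteq> x" using z(1) d(1) by (auto simp: S_def)
    then have "bump (x - z) < 1" using x by (intro bump_less_1) auto
    then show ?thesis using that[of "bump (x - z)"] z(2) bump_nonneg by blast
  qed
  \<comment> \<open>Any t strictly between s and 1 serves: the far part is at most a constant times
    (s / t)^n.\<close>
  define t where "t = (1 + s) / 2"
  have t: "0 < t" "t < 1" "s < t" using s by (auto simp: t_def)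
  obtain m where m: "m > 0" "\<And>n. m * t ^ n \<le> bump_mass TYPE('d) n"
    by (rule bump_mass_lower[OF x, of t]) (use t in auto)
  define \<mu> where "\<mu> = measure (torus_measure :: (real^'d) measure) torus"
  have "(\<lambda>n. 2 * B * \<mu> / m * (s / t) ^ n) \<longlonglongrightarrow> 2 * B * \<mu> / m * 0"
    by (intro tendsto_intros LIMSEQ_realpow_zero) (use s t in auto)
  then have "eventually (\<lambda>n. 2 * B * \<mu> / m * (s / t) ^ n < e / 2) sequentially"
    by (rule order_tendstoD) (use e in auto)
  then obtain N where N: "\<And>n. n \<ge> N \<Longrightarrow> 2 * B * \<mu> / m * (s / t) ^ n < e / 2"
    by (auto simp: eventually_sequentially)
  have "norm (mollify n g x - g x) < e" if "n \<ge> N" for n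
  proof -
    let ?c = "bump_mass TYPE('d) n"
    have c: "?c > 0" by (rule bump_mass_pos)
    have ib: "integrable torus_measure (\<lambda>y. bump (x - y) ^ n)"
      using integrable_bump[of "\<lambda>_. 1" x n] by simp
    have "mollify n g x - g x = mollify n (\<lambda>y. g y - g x) x"
      using mollify_diff[OF ig, of "\<lambda>_. g x" n x] by (simp add: mollify_const)
    also have "\<bar>\<dots>\<bar> = \<bar>\<integral>y. bump (x - y) ^ n * (g y - g x) \<partial>torus_measure\<bar> / ?c"
      using c by (simp add: mollify_def)
    also have "\<bar>\<integral>y. bump (x - y) ^ n * (g y - g x) \<partial>torus_measure\<bar> \<le> (\<integral>y. bump (x - y) ^ n * (e / 2) + 2 * B * s ^ n \<partial>torus_measure)"
    proof (rule integral_abs_bound[THEN order_trans], rule integral_mono)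
      show "integrable torus_measure (\<lambda>y. \<bar>bump (x - y) ^ n * (g y - g x)\<bar>)"
        by (intro integrable_abs integrable_bump Bochner_Integration.integrable_diff ig) auto
      show "integrable torus_measure (\<lambda>y. bump (x - y) ^ n * (e / 2) + 2 * B * s ^ n)"
        using ib by auto
      fix y :: "real^'d" assume "y \<in> space torus_measure"
      then have y: "y \<in> cbox 0 1" using torus_subset_cbox by auto
      have bn: "0 \<le> bump (x - y) ^ n" by (simp add: bump_nonneg)
      show "\<bar>bump (x - y) ^ n * (g y - g x)\<bar> \<le> bump (x - y) ^ n * (e / 2) + 2 * B * s ^ n"
      proof (cases "y \<in> S")
        case True
        have "\<bar>g y - g x\<bar> \<le> 2 * B" using g(2)[of x] g(2)[of y] by linarith
        moreover have "bump (x - y) ^ n \<le> s ^ n" by (intro power_mono s True bump_nonneg)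
        ultimately have "bump (x - y) ^ n * \<bar>g y - g x\<bar> \<le> s ^ n * (2 * B)"
          using bn s(1) by (intro mult_mono) auto
        moreover have "0 \<le> bump (x - y) ^ n * (e / 2)" using bn e by simp
        ultimately show ?thesis using bn by (simp add: abs_mult mult_ac)
      next
        case False
        then have "\<bar>g y - g x\<bar> \<le> e / 2" using y d(2)[of y] by (auto simp: S_def dist_commute less_imp_le)
        then have "bump (x - y) ^ n * \<bar>g y - g x\<bar> \<le> bump (x - y) ^ n * (e / 2)"
          using bn by (intro mult_left_mono) auto
        moreover have "0 \<le> 2 * B * s ^ n" using B s(1) by simp
        ultimately show ?thesis using bn by (simp add: abs_mult)
      qed
    qed
    also have "\<dots> = ?c * (e / 2) + 2 * B * s ^ n * \<mu>"
      using ib by (simp add: integral_bump \<mu>_def)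
    finally have 1: "norm (mollify n g x - g x) \<le> (?c * (e / 2) + 2 * B * s ^ n * \<mu>) / ?c"
      using c by (simp add: divide_right_mono)
    also have "\<dots> = e / 2 + 2 * B * s ^ n * \<mu> / ?c" using c by (simp add: add_divide_distrib)
    also have "2 * B * s ^ n * \<mu> / ?c \<le> 2 * B * s ^ n * \<mu> / (m * t ^ n)"
      using m t c B s(1) by (intro divide_left_mono) (auto simp: \<mu>_def)
    also have "\<dots> = 2 * B * \<mu> / m * (s / t) ^ n" by (simp add: power_divide)
    also have "\<dots> < e / 2" by (rule N[OF that])
    finally show ?thesis by simp
  qed
  then show "\<exists>N. \<forall>n\<ge>N. norm (mollify n g x - g x) < e" by blast
qed

lemma mollify_L1_continuous:
  fixes g :: "real^'d \<Rightarrow> real"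
  assumes g: "continuous_on UNIV g" "\<And>y. \<bar>g y\<bar> \<le> B"
  shows "(\<lambda>n. \<integral>x. \<bar>mollify n g x - g x\<bar> \<partial>torus_measure) \<longlonglongrightarrow> 0"
proof -
  have ig: "integrable torus_measure g"
    using continuous_integrable_torus[OF g(1), of "\<lambda>_. 1"] by simp
  have "(\<lambda>n. \<integral>x. \<bar>mollify n g x - g x\<bar> \<partial>torus_measure) \<longlonglongrightarrow> (\<integral>x. 0 \<partial>(torus_measure :: (real^'d) measure))"
  proof (rule integral_dominated_convergence[where w = "\<lambda>_. 2 * B"])
    show "AE x in torus_measure. (\<lambda>n. \<bar>mollify n g x - g x\<bar>) \<longlonglongrightarrow> 0"
      using AE_torus_measure_box
    proof eventually_elim
      case (elim x)
      from mollify_tendsto[OF g elim] have "(\<lambda>n. \<bar>mollify n g x - g x\<bar>) \<longlonglongrightarrow> \<bar>g x - g x\<bar>"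
        by (intro tendsto_intros)
      then show ?case by simp
    qed
    show "AE x in torus_measure. norm \<bar>mollify n g x - g x\<bar> \<le> 2 * B" for n
    proof (rule AE_I2)
      fix x :: "real^'d"
      have "g y \<in> {- B..B}" for y using g(2)[of y] by auto
      then have "mollify n g x \<in> {- B..B}" by (intro mollify_in_interval ig)
      then show "norm \<bar>mollify n g x - g x\<bar> \<le> 2 * B" using g(2)[of x] by auto
    qed
  qed (use ig integrable_mollify[OF ig] in auto)
  then show ?thesis by simp
qed

text \<open>Clipping to [-m, m] costs little in mean. The clipped function is an almost everywhere
  limit of clipped continuous functions, and the clipping itself supplies the constant majorant for
  dominated convergence.\<close>

lemma torus_L1_approx_continuous:
  fixes u :: "real^'d \<Rightarrow> real"
  assumes u: "integrable torus_measure u" and e: "e > 0"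
  obtains g B where "continuous_on UNIV g" "\<And>x. \<bar>g x\<bar> \<le> B" "(\<integral>x. \<bar>u x - g x\<bar> \<partial>torus_measure) < e"
proof -
  define cl where "cl m r = max (- real m) (min r (real m))" for m r
  have cl: "\<bar>cl m r\<bar> \<le> real m" for m r by (auto simp: cl_def)
  have [measurable]: "cl m \<in> borel_measurable borel" for m unfolding cl_def[abs_def] by measurable
  have [measurable]: "u \<in> borel_measurable torus_measure" using u by auto
  have "(\<lambda>m. \<integral>x. \<bar>u x - cl m (u x)\<bar> \<partial>torus_measure) \<longlonglongrightarrow> (\<integral>x. 0 \<partial>(torus_measure :: (real^'d) measure))"
  proof (rule integral_dominated_convergence[where w = "\<lambda>x. \<bar>u x\<bar>"])
    show "AE x in torus_measure. (\<lambda>m. \<bar>u x - cl m (u x)\<bar>) \<longlonglongrightarrow> 0"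
    proof (rule AE_I2, rule tendsto_eventually)
      fix x
      obtain N where "real N \<ge> \<bar>u x\<bar>" using real_arch_simple by blast
      then have "\<bar>u x - cl m (u x)\<bar> = 0" if "m \<ge> N" for m
        using that by (auto simp: cl_def)
      then show "\<forall>\<^sub>F m in sequentially. \<bar>u x - cl m (u x)\<bar> = 0"
        unfolding eventually_sequentially by blast
    qed
    show "AE x in torus_measure. norm \<bar>u x - cl m (u x)\<bar> \<le> \<bar>u x\<bar>" for m
      by (rule AE_I2) (auto simp: cl_def)
  qed (use u in auto)
  then have "eventually (\<lambda>m. (\<integral>x. \<bar>u x - cl m (u x)\<bar> \<partial>torus_measure) < e / 2) sequentially"
    by (intro order_tendstoD(2)[of _ 0]) (use e in auto)
  then obtain m where m: "(\<integral>x. \<bar>u x - cl m (u x)\<bar> \<partial>torus_measure) < e / 2"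
    by (auto simp: eventually_sequentially)
  have "(\<lambda>x. indicator torus x *\<^sub>R u x) \<in> borel_measurable lborel"
    using \<open>u \<in> borel_measurable torus_measure\<close>
    by (simp add: torus_measure_def borel_measurable_restrict_space_iff)
  then have "(\<lambda>x. indicator torus x *\<^sub>R u x) \<in> borel_measurable lebesgue"
    by (rule measurable_completion)
  \<comment> \<open>\<open>measurable_on\<close> asserts approximation by continuous functions
    outside a negligible set, which is what is extracted next.\<close>
  then have "(\<lambda>x. indicator torus x *\<^sub>R u x) measurable_on UNIV"
    by (intro lebesgue_measurable_imp_measurable_on) auto
  then obtain N g where N: "negligible N" and g: "\<And>n::nat. continuous_on UNIV (g n)"
    and lim: "\<And>x. x \<notin> N \<Longrightarrow> (\<lambda>n. g n x) \<longlonglongrightarrow> indicator torus x *\<^sub>R u x"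
    unfolding measurable_on_def by auto
  have "AE x in lebesgue. x \<notin> N"
    using N by (intro AE_not_in) (simp add: negligible_iff_null_sets)
  then have "AE x in lborel. x \<notin> N" 
    by (simp add: AE_completion_iff)
  then have AE: "AE x in torus_measure. x \<notin> N"
    unfolding AE_torus_measure by eventually_elim auto
  have cg: "continuous_on UNIV (\<lambda>x. cl m (g n x))" for n
    unfolding cl_def by (intro continuous_intros g)
  have [measurable]: "(\<lambda>x. cl m (g n x)) \<in> borel_measurable torus_measure" for n
    by (rule continuous_measurable_torus[OF cg])
  have "(\<lambda>n. \<integral>x. \<bar>cl m (u x) - cl m (g n x)\<bar> \<partial>torus_measure) \<longlonglongrightarrow> (\<integral>x. 0 \<partial>(torus_measure :: (real^'d) measure))"
  proof (rule integral_dominated_convergence[where w = "\<lambda>x. 2 * real m"])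
    show "AE x in torus_measure. (\<lambda>n. \<bar>cl m (u x) - cl m (g n x)\<bar>) \<longlonglongrightarrow> 0"
      using AE AE_space
    proof eventually_elim
      case (elim x)
      then have "(\<lambda>n. g n x) \<longlonglongrightarrow> u x" using lim[of x] by simp
      then have "(\<lambda>n. \<bar>cl m (u x) - cl m (g n x)\<bar>) \<longlonglongrightarrow> \<bar>cl m (u x) - cl m (u x)\<bar>"
        unfolding cl_def by (intro tendsto_intros)
      then show ?case by simp
    qed
    show "AE x in torus_measure. norm \<bar>cl m (u x) - cl m (g n x)\<bar> \<le> 2 * real m" for n
      using cl by (intro AE_I2) (smt (verit) real_norm_def)
  qed auto
  then have "eventually (\<lambda>n. (\<integral>x. \<bar>cl m (u x) - cl m (g n x)\<bar> \<partial>torus_measure) < e / 2) sequentially"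
    by (intro order_tendstoD(2)[of _ 0]) (use e in auto)
  then obtain n where n: "(\<integral>x. \<bar>cl m (u x) - cl m (g n x)\<bar> \<partial>torus_measure) < e / 2"
    by (auto simp: eventually_sequentially)
  have i1: "integrable torus_measure (\<lambda>x. cl m (u x))"
    by (rule torus.integrable_const_bound[of _ "real m"]) (use cl in auto)
  have i2: "integrable torus_measure (\<lambda>x. cl m (g n x))"
    by (rule torus.integrable_const_bound[of _ "real m"]) (use cl in auto)
  have "(\<integral>x. \<bar>u x - cl m (g n x)\<bar> \<partial>torus_measure) \<le>
     (\<integral>x. \<bar>u x - cl m (u x)\<bar> + \<bar>cl m (u x) - cl m (g n x)\<bar> \<partial>torus_measure)"
    by (rule integral_mono) (use u i1 i2 in auto)
  also have "\<dots> = (\<integral>x. \<bar>u x - cl m (u x)\<bar> \<partial>torus_measure) + (\<integral>x. \<bar>cl m (u x) - cl m (g n x)\<bar> \<partial>torus_measure)"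
    by (rule Bochner_Integration.integral_add) (use u i1 i2 in auto)
  finally have "(\<integral>x. \<bar>u x - cl m (g n x)\<bar> \<partial>torus_measure) < e"
    using m n by linarith
  then show ?thesis using that[OF cg, of n "real m"] cl by blast
qed

text \<open>A density argument in three parts: \<open>mollify_contraction\<close> bounds the
  mollified error of the approximation by the error itself, uniformly in n.\<close>

lemma mollify_tendsto_L1:
  fixes u :: "real^'d \<Rightarrow> real"
  assumes u: "integrable torus_measure u"
  shows "(\<lambda>n. \<integral>x. \<bar>mollify n u x - u x\<bar> \<partial>torus_measure) \<longlonglongrightarrow> 0"
proof (rule LIMSEQ_I)
  fix e :: real assume e: "e > 0"
  obtain g B where g: "continuous_on UNIV g" "\<And>x. \<bar>g x\<bar> \<le> B" and ug: "(\<integral>x. \<bar>u x - g x\<bar> \<partial>torus_measure) < e / 3"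
    using torus_L1_approx_continuous[OF u, of "e / 3"] e by auto
  have ig: "integrable torus_measure g"
    using continuous_integrable_torus[OF g(1), of "\<lambda>_. 1"] by simp
  obtain N where N: "\<And>n. n \<ge> N \<Longrightarrow> (\<integral>x. \<bar>mollify n g x - g x\<bar> \<partial>torus_measure) < e / 3"
    using order_tendstoD(2)[OF mollify_L1_continuous[OF g], of "e / 3"] e
    by (auto simp: eventually_sequentially)
  have "(\<integral>x. \<bar>mollify n u x - u x\<bar> \<partial>torus_measure) < e" if "n \<ge> N" for n
  proof -
    note im = integrable_mollify[OF u] integrable_mollify[OF ig]
    have i: "integrable torus_measure (\<lambda>x. \<bar>mollify n (\<lambda>x. u x - g x) x\<bar>)"
      "integrable torus_measure (\<lambda>x. \<bar>mollify n g x - g x\<bar>)" "integrable torus_measure (\<lambda>x. \<bar>u x - g x\<bar>)"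
      using u ig im by (auto intro!: integrable_mollify)
    have "(\<integral>x. \<bar>mollify n u x - u x\<bar> \<partial>torus_measure) \<le>
      (\<integral>x. \<bar>mollify n (\<lambda>x. u x - g x) x\<bar> + \<bar>mollify n g x - g x\<bar> + \<bar>u x - g x\<bar> \<partial>torus_measure)"
      using u im i by (intro integral_mono) (auto simp: mollify_diff[OF u ig])
    also have "\<dots> = (\<integral>x. \<bar>mollify n (\<lambda>x. u x - g x) x\<bar> \<partial>torus_measure)
       + (\<integral>x. \<bar>mollify n g x - g x\<bar> \<partial>torus_measure) + (\<integral>x. \<bar>u x - g x\<bar> \<partial>torus_measure)"
      using i by simp
    also have "(\<integral>x. \<bar>mollify n (\<lambda>x. u x - g x) x\<bar> \<partial>torus_measure) \<le> (\<integral>x. \<bar>u x - g x\<bar> \<partial>torus_measure)"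
      by (rule mollify_contraction) (use u ig in auto)
    finally show ?thesis using ug N[OF that] by linarith
  qed
  moreover have "0 \<le> (\<integral>x. \<bar>mollify n u x - u x\<bar> \<partial>torus_measure)" for n by simp
  ultimately show "\<exists>N. \<forall>n\<ge>N. norm ((\<integral>x. \<bar>mollify n u x - u x\<bar> \<partial>torus_measure) - 0) < e"
    by auto
qed

section \<open>The chain rule for weak gradients\<close>

lemma Ck_compose_real:
  fixes P :: "real \<Rightarrow> real"
  assumes "Ck n P" "Ck n f"
  shows "Ck n (\<lambda>x. P (f x))"
  using assms
proof (induction n arbitrary: P f)
  case 0
  then show ?case by (auto intro: continuous_on_compose2)
next
  case (Suc n)
  \<comment> \<open>Linearity of the derivative of P on the real line turns the chain rule into a
    product, to which \<open>Ck_mult\<close> applies.\<close>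
  have d: "((\<lambda>x. P (f x)) has_derivative (\<lambda>v. frechet_derivative f (at x) v * frechet_derivative P (at (f x)) 1)) (at x)" for x
  proof -
    have "((\<lambda>x. P (f x)) has_derivative (\<lambda>v. frechet_derivative P (at (f x)) (frechet_derivative f (at x) v))) (at x)"
      using diff_chain_at[OF Ck_SucD(1)[OF Suc.prems(2)] Ck_SucD(1)[OF Suc.prems(1)]] by (simp add: o_def)
    moreover have "(\<lambda>v. frechet_derivative P (at (f x)) (frechet_derivative f (at x) v)) =
      (\<lambda>v. frechet_derivative f (at x) v * frechet_derivative P (at (f x)) 1)"
    proof
      fix v
      show "frechet_derivative P (at (f x)) (frechet_derivative f (at x) v) =
        frechet_derivative f (at x) v * frechet_derivative P (at (f x)) 1"
        using linear_scale[OF has_derivative_linear[OF Ck_SucD(1)[OF Suc.prems(1)]], of "f x" "frechet_derivative f (at x) v" 1]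
        by (simp only: real_scaleR_def mult_1_right)
    qed
    ultimately show ?thesis by (simp only:)
  qed
  show ?case
    by (rule Ck_SucI[OF d], rule Ck_mult)
      (use Suc.IH[OF Ck_SucD(2)[OF Suc.prems(1)] Ck_Suc_imp[OF Suc.prems(2)], of 1] Ck_SucD(2)[OF Suc.prems(2)] in auto)
qed

lemma smooth_compose_real: "smooth P \<Longrightarrow> smooth f \<Longrightarrow> smooth (\<lambda>x. P (f x))" for P :: "real \<Rightarrow> real"
  by (simp add: smooth_def Ck_compose_real)

lemma frechet_compose_real:
  fixes P :: "real \<Rightarrow> real"
  assumes "smooth P" "smooth f"
  shows "frechet_derivative (\<lambda>x. P (f x)) (at x) v = deriv P (f x) * frechet_derivative f (at x) v"
proof -
  have "((\<lambda>x. P (f x)) has_derivative (\<lambda>v. deriv P (f x) * frechet_derivative f (at x) v)) (at x)"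
    using diff_chain_at[OF smooth_has_derivative[OF assms(2)], of P "\<lambda>h. deriv P (f x) * h" x] smooth_real_deriv(2)[OF assms(1)]
    by (simp add: o_def has_field_derivative_def)
  from fun_cong[OF frechet_derivative_at[OF this], of v] show ?thesis by simp
qed

lemma AE_subseq_of_L1:
  fixes u :: "'a \<Rightarrow> real"
  assumes "\<And>n. integrable M (un n)" "integrable M u" "(\<lambda>n. \<integral>x. \<bar>un n x - u x\<bar> \<partial>M) \<longlonglongrightarrow> 0"
  obtains r where "strict_mono (r :: nat \<Rightarrow> nat)" "AE x in M. (\<lambda>n. un (r n) x) \<longlonglongrightarrow> u x"
proof -
  from tendsto_L1_AE_subseq[of M "\<lambda>n x. un n x - u x"] assms
  obtain r where r: "strict_mono (r :: nat \<Rightarrow> nat)" "AE x in M. (\<lambda>n. un (r n) x - u x) \<longlonglongrightarrow> 0"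
    by auto
  from r(2) have "AE x in M. (\<lambda>n. un (r n) x) \<longlonglongrightarrow> u x"
    by eventually_elim (simp add: LIM_zero_cancel)
  with r(1) show ?thesis by (rule that)
qed

text \<open>For a mollified u the composition with P is an admissible test function for the
  divergence of V. In the limit the factor containing u converges almost everywhere and boundedly,
  while the gradient converges in mean; boundedness of V lets the two be combined.\<close>

lemma weak_chain_rule_smooth:
  fixes u :: "real^'d \<Rightarrow> real"
  assumes div: "has_weak_divergence V D" and V: "\<And>x. x \<in> torus \<Longrightarrow> norm (V x) \<le> C"
    and wg: "has_weak_gradient u g" and u: "\<And>x. x \<in> torus \<Longrightarrow> u x \<in> {a..b}" and P: "smooth P"
  shows "(\<integral>x. deriv P (u x) * (g x \<bullet> V x) \<partial>torus_measure) = - (\<integral>x. P (u x) * D x \<partial>torus_measure)"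
proof -
  have iu: "integrable torus_measure u" and ig: "integrable torus_measure g"
    using wg by (auto simp: has_weak_gradient_def)
  have iV: "integrable torus_measure V" and iD: "integrable torus_measure D"
    using div by (auto simp: has_weak_divergence_def)
  have igi: "integrable torus_measure (\<lambda>x. g x $ i)" for i
    by (rule integral_vec_nth(2)[OF ig])
  have C: "\<bar>V x $ i\<bar> \<le> C" if "x \<in> torus" for x i
    using V[OF that] component_le_norm_cart[of "V x" i] by linarith
  have dP: "smooth (deriv P)" by (rule smooth_real_deriv(1)[OF P])
  have [measurable]: "P \<in> borel_measurable borel" "deriv P \<in> borel_measurable borel"
    by (intro borel_measurable_continuous_onI smooth_continuous P dP)+
  have [measurable]: "u \<in> borel_measurable torus_measure" "g \<in> borel_measurable torus_measure"
    "V \<in> borel_measurable torus_measure" "D \<in> borel_measurable torus_measure"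
    using iu ig iV iD by auto
  have [measurable]: "(\<lambda>x. g x $ i) \<in> borel_measurable torus_measure" "(\<lambda>x. V x $ i) \<in> borel_measurable torus_measure" for i
    using igi integral_vec_nth(2)[OF iV] by auto
  have "bounded (P ` {a..b})" "bounded (deriv P ` {a..b})"
    by (intro compact_imp_bounded compact_continuous_image smooth_continuous P dP compact_Icc)+
  then obtain K K' where "\<forall>r\<in>{a..b}. \<bar>P r\<bar> \<le> K" "\<forall>r\<in>{a..b}. \<bar>deriv P r\<bar> \<le> K'"
    unfolding bounded_iff by auto
  then have K: "\<And>r. r \<in> {a..b} \<Longrightarrow> \<bar>P r\<bar> \<le> K" "\<And>r. r \<in> {a..b} \<Longrightarrow> \<bar>deriv P r\<bar> \<le> K'"
    by auto
  have 0: "0 \<in> (torus :: (real^'d) set)" by (simp add: torus_def)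
  have nn: "0 \<le> K'" "0 \<le> C"
    using K(2)[OF u[OF 0]] V[OF 0] by (auto intro: order_trans[OF abs_ge_zero] order_trans[OF norm_ge_zero])
  have KC: "\<bar>deriv P r * V x $ i\<bar> \<le> K' * C" if "r \<in> {a..b}" "x \<in> torus" for r x i
    unfolding abs_mult by (rule mult_mono[OF K(2)[OF that(1)] C[OF that(2)] nn(1) abs_ge_zero])
  have KC': "\<bar>deriv P r * V x $ i * y\<bar> \<le> K' * C * \<bar>y\<bar>" if "r \<in> {a..b}" "x \<in> torus" for r x i y
    using mult_right_mono[OF KC[OF that], of "\<bar>y\<bar>" i] by (simp add: abs_mult)
  \<comment> \<open>Convergence in mean gives pointwise convergence along a subsequence only; the
    gradients are mollified along the same subsequence.\<close>
  obtain r where r: "strict_mono (r :: nat \<Rightarrow> nat)" "AE x in torus_measure. (\<lambda>n. mollify (r n) u x) \<longlonglongrightarrow> u x"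
    by (rule AE_subseq_of_L1[OF integrable_mollify[OF iu] iu mollify_tendsto_L1[OF iu]])
  define w where "w n = mollify (r n) u" for n
  define h where "h i n = mollify (r n) (\<lambda>x. g x $ i)" for i n
  have w: "smooth (w n)" "periodic (w n)" for n
    unfolding w_def by (intro smooth_mollify iu)+
  have [measurable]: "w n \<in> borel_measurable torus_measure" for n
    by (intro continuous_measurable_torus smooth_continuous w)
  have ih: "integrable torus_measure (h i n)" for i n
    unfolding h_def by (intro integrable_mollify igi)
  have [measurable]: "h i n \<in> borel_measurable torus_measure" for i n
    using ih by auto
  have wab: "w n x \<in> {a..b}" for n x
    unfolding w_def by (intro mollify_in_interval iu u)
  have wlim: "AE x in torus_measure. (\<lambda>n. w n x) \<longlonglongrightarrow> u x"
    using r(2) by (simp add: w_def)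
  have Q: "(\<lambda>n. Q (w n x)) \<longlonglongrightarrow> Q (u x)" if "smooth Q" "(\<lambda>n. w n x) \<longlonglongrightarrow> u x" for Q x
    using that smooth_continuous[of Q UNIV] by (auto simp: continuous_on_eq_continuous_at intro: isCont_tendsto_compose)
  have bd: "integrable torus_measure (\<lambda>x. deriv P (v x) * V x $ i * f x)"
    if "integrable torus_measure f" "v \<in> borel_measurable torus_measure" "\<And>x. x \<in> torus \<Longrightarrow> v x \<in> {a..b}" for i f v
  proof (rule integrable_mult_bounded[where C = "K' * C"])
    fix x :: "real^'d" assume "x \<in> space torus_measure"
    then show "\<bar>deriv P (v x) * V x $ i\<bar> \<le> K' * C"
      by (intro KC that(3)) auto
  qed (use that in measurable)
  have id: "(\<integral>x. V x \<bullet> grad (\<lambda>x. P (w n x)) x \<partial>torus_measure) = (\<Sum>i\<in>UNIV. \<integral>x. deriv P (w n x) * V x $ i * h i n x \<partial>torus_measure)" for n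
  proof -
    have "V x \<bullet> grad (\<lambda>x. P (w n x)) x = (\<Sum>i\<in>UNIV. deriv P (w n x) * V x $ i * h i n x)" for x
      unfolding inner_vec_def grad_def frechet_compose_real[OF P w(1)]
      by (intro sum.cong) (auto simp: w_def h_def frechet_mollify[OF wg])
    then show ?thesis
      using bd[OF ih _ wab] by simp
  qed
  have "(\<lambda>n. \<integral>x. deriv P (w n x) * V x $ i * h i n x \<partial>torus_measure) \<longlonglongrightarrow> (\<integral>x. deriv P (u x) * V x $ i * g x $ i \<partial>torus_measure)" for i
  proof -
    \<comment> \<open>The product is split: here the gradient is already the limit and only its
      factor varies, so dominated convergence applies. The remainder is bounded by a constant times
      the mean error of the gradient.\<close>
    have 1: "(\<lambda>n. \<integral>x. deriv P (w n x) * V x $ i * g x $ i \<partial>torus_measure) \<longlonglongrightarrow> (\<integral>x. deriv P (u x) * V x $ i * g x $ i \<partial>torus_measure)"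
    proof (rule integral_dominated_convergence[where w = "\<lambda>x. K' * C * \<bar>g x $ i\<bar>"])
      show "AE x in torus_measure. (\<lambda>n. deriv P (w n x) * V x $ i * g x $ i) \<longlonglongrightarrow> deriv P (u x) * V x $ i * g x $ i"
        using wlim by eventually_elim (intro tendsto_intros Q[OF dP])
      show "AE x in torus_measure. norm (deriv P (w n x) * V x $ i * g x $ i) \<le> K' * C * \<bar>g x $ i\<bar>" for n
        by (rule AE_I2) (use KC'[OF wab] in auto)
    qed (use igi in auto)
    have "(\<lambda>n. \<integral>x. deriv P (w n x) * V x $ i * (h i n x - g x $ i) \<partial>torus_measure) \<longlonglongrightarrow> 0"
    proof (rule Lim_null_comparison)
      have "(\<lambda>n. \<integral>x. \<bar>h i n x - g x $ i\<bar> \<partial>torus_measure) \<longlonglongrightarrow> 0"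
        using LIMSEQ_subseq_LIMSEQ[OF mollify_tendsto_L1[OF igi[of i]] r(1)] by (simp add: o_def h_def)
      then show "(\<lambda>n. K' * C * (\<integral>x. \<bar>h i n x - g x $ i\<bar> \<partial>torus_measure)) \<longlonglongrightarrow> 0"
        by (rule tendsto_mult_right_zero)
      show "\<forall>\<^sub>F n in sequentially. norm (\<integral>x. deriv P (w n x) * V x $ i * (h i n x - g x $ i) \<partial>torus_measure) \<le> K' * C * (\<integral>x. \<bar>h i n x - g x $ i\<bar> \<partial>torus_measure)"
      proof (rule always_eventually, rule allI)
        fix n
        have i: "integrable torus_measure (\<lambda>x. h i n x - g x $ i)" using ih igi by auto
        have "norm (\<integral>x. deriv P (w n x) * V x $ i * (h i n x - g x $ i) \<partial>torus_measure) \<le> (\<integral>x. K' * C * \<bar>h i n x - g x $ i\<bar> \<partial>torus_measure)"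
        proof (rule order_trans[OF integral_norm_bound], rule integral_mono)
          show "integrable torus_measure (\<lambda>x. norm (deriv P (w n x) * V x $ i * (h i n x - g x $ i)))"
            by (intro integrable_norm bd[OF i _ wab]) measurable
          show "integrable torus_measure (\<lambda>x. K' * C * \<bar>h i n x - g x $ i\<bar>)"
            using i by auto
        qed (use KC'[OF wab] in auto)
        then show "norm (\<integral>x. deriv P (w n x) * V x $ i * (h i n x - g x $ i) \<partial>torus_measure) \<le> K' * C * (\<integral>x. \<bar>h i n x - g x $ i\<bar> \<partial>torus_measure)"
          by simp
      qed
    qed
    from tendsto_add[OF this 1] show ?thesis
      using bd[OF ih _ wab] bd[OF igi _ wab] by (simp add: right_diff_distrib)
  qed
  then have "(\<lambda>n. \<integral>x. V x \<bullet> grad (\<lambda>x. P (w n x)) x \<partial>torus_measure) \<longlonglongrightarrow> (\<Sum>i\<in>UNIV. \<integral>x. deriv P (u x) * V x $ i * g x $ i \<partial>torus_measure)"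
    unfolding id by (intro tendsto_sum)
  also have "(\<Sum>i\<in>UNIV. \<integral>x. deriv P (u x) * V x $ i * g x $ i \<partial>torus_measure) = (\<integral>x. deriv P (u x) * (g x \<bullet> V x) \<partial>torus_measure)"
  proof -
    have "integrable torus_measure (\<lambda>x. deriv P (u x) * V x $ i * g x $ i)" for i
      by (rule bd[OF igi _ u]) auto
    then have "(\<Sum>i\<in>UNIV. \<integral>x. deriv P (u x) * V x $ i * g x $ i \<partial>torus_measure) =
      (\<integral>x. (\<Sum>i\<in>UNIV. deriv P (u x) * V x $ i * g x $ i) \<partial>torus_measure)"
      by (intro Bochner_Integration.integral_sum[symmetric])
    then show ?thesis by (simp add: inner_vec_def sum_distrib_left mult_ac)
  qed
  finally have L: "(\<lambda>n. \<integral>x. V x \<bullet> grad (\<lambda>x. P (w n x)) x \<partial>torus_measure) \<longlonglongrightarrow> \<dots>" .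
  have "(\<lambda>n. \<integral>x. D x * P (w n x) \<partial>torus_measure) \<longlonglongrightarrow> (\<integral>x. D x * P (u x) \<partial>torus_measure)"
  proof (rule integral_dominated_convergence[where w = "\<lambda>x. \<bar>D x\<bar> * K"])
    show "AE x in torus_measure. (\<lambda>n. D x * P (w n x)) \<longlonglongrightarrow> D x * P (u x)"
      using wlim by eventually_elim (intro tendsto_intros Q[OF P])
    show "AE x in torus_measure. norm (D x * P (w n x)) \<le> \<bar>D x\<bar> * K" for n
      using K(1)[OF wab] by (intro AE_I2) (auto simp: abs_mult intro!: mult_left_mono)
  qed (use iD in auto)
  from tendsto_minus[OF this]
  have R: "(\<lambda>n. - (\<integral>x. D x * P (w n x) \<partial>torus_measure)) \<longlonglongrightarrow> - (\<integral>x. P (u x) * D x \<partial>torus_measure)"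
    by (simp add: mult.commute)
  \<comment> \<open>The definition of the weak divergence, tested with the smooth periodic function
    \<open>P (w n x)\<close>.\<close>
  have "(\<integral>x. V x \<bullet> grad (\<lambda>x. P (w n x)) x \<partial>torus_measure) = - (\<integral>x. D x * P (w n x) \<partial>torus_measure)" for n
    using div smooth_compose_real[OF P w(1)] w(2) unfolding has_weak_divergence_def periodic_def by auto
  with L have "(\<lambda>n. - (\<integral>x. D x * P (w n x) \<partial>torus_measure)) \<longlonglongrightarrow> (\<integral>x. deriv P (u x) * (g x \<bullet> V x) \<partial>torus_measure)"
    by simp
  from LIMSEQ_unique[OF this R] show ?thesis .
qed

lemma smooth_antiderivative:
  fixes p :: "real \<Rightarrow> real"
  assumes "smooth p"
  obtains P where "smooth P" "deriv P = p" "P a = c"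
proof -
  obtain P where P: "\<And>x. (P has_real_derivative p x) (at x)" "P a = c"
    by (rule continuous_antiderivative[OF smooth_continuous[OF assms], where a = a and c = c]) blast
  show ?thesis
    by (rule that[of P]) (use smooth_real[OF P(1) assms] DERIV_imp_deriv[OF P(1)] P(2) in auto)
qed

text \<open>The coefficients met later have primitives that are only continuously differentiable on
  a compact interval. G' is approximated there uniformly by polynomials, for which the smooth chain
  rule holds, and both sides depend continuously on this approximation.\<close>

lemma weak_chain_rule:
  fixes u :: "real^'d \<Rightarrow> real"
  assumes div: "has_weak_divergence V D" and V: "\<And>x. x \<in> torus \<Longrightarrow> norm (V x) \<le> C"
    and wg: "has_weak_gradient u g" and u: "\<And>x. x \<in> torus \<Longrightarrow> u x \<in> {a..b}"
    and G: "\<And>r. r \<in> {a..b} \<Longrightarrow> (G has_real_derivative G' r) (at r within {a..b})"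
    and G': "continuous_on {a..b} G'"
  shows "integrable torus_measure (\<lambda>x. G' (u x) * (g x \<bullet> V x))"
    and "(\<integral>x. G' (u x) * (g x \<bullet> V x) \<partial>torus_measure) = - (\<integral>x. G (u x) * D x \<partial>torus_measure)"
proof -
  have iu: "integrable torus_measure u" and ig: "integrable torus_measure g"
    using wg by (auto simp: has_weak_gradient_def)
  have iV: "integrable torus_measure V" and iD: "integrable torus_measure D"
    using div by (auto simp: has_weak_divergence_def)
  have [measurable]: "u \<in> borel_measurable torus_measure" "g \<in> borel_measurable torus_measure"
    "V \<in> borel_measurable torus_measure" "D \<in> borel_measurable torus_measure"
    using iu ig iV iD by auto
  have 0: "0 \<in> (torus :: (real^'d) set)" by (simp add: torus_def)
  have ab: "a \<le> b" using u[OF 0] by auto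
  have C0: "C \<ge> 0" using V[OF 0] norm_ge_zero order_trans by blast
  have igV: "integrable torus_measure (\<lambda>x. g x \<bullet> V x)"
  proof (rule Bochner_Integration.integrable_bound[of _ "\<lambda>x. C * norm (g x)"])
    show "AE x in torus_measure. norm (g x \<bullet> V x) \<le> norm (C * norm (g x))"
    proof (rule AE_I2)
      fix x :: "real^'d" assume "x \<in> space torus_measure"
      then have "norm (g x) * norm (V x) \<le> norm (g x) * C" using V by (intro mult_left_mono) auto
      with Cauchy_Schwarz_ineq2[of "g x" "V x"] C0 show "norm (g x \<bullet> V x) \<le> norm (C * norm (g x))"
        by (simp add: mult.commute)
    qed
  qed (use ig in auto)
  have cG: "continuous_on {a..b} G" using G by (rule DERIV_continuous_on)
  have comp: "integrable torus_measure (\<lambda>x. H (u x) * f x)"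
    if "continuous_on {a..b} H" "integrable torus_measure f" for H :: "real \<Rightarrow> real" and f
  proof -
    have "bounded (H ` {a..b})"
      by (intro compact_imp_bounded compact_continuous_image that compact_Icc)
    then obtain K where K: "\<forall>r\<in>{a..b}. \<bar>H r\<bar> \<le> K"
      unfolding bounded_iff by auto
    \<comment> \<open>H is continuous on the interval only; extension by 0 gives a Borel function
      that agrees with it on the range of u.\<close>
    have "(\<lambda>r. if r \<in> {a..b} then H r else 0) \<in> borel_measurable borel"
      by (rule borel_measurable_continuous_on_if[OF _ that(1)]) auto
    then have "(\<lambda>x. if u x \<in> {a..b} then H (u x) else 0) \<in> borel_measurable torus_measure"
      by (rule measurable_compose[rotated]) simp
    also have "?this \<longleftrightarrow> (\<lambda>x. H (u x)) \<in> borel_measurable torus_measure"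
      by (rule measurable_cong) (use u in auto)
    finally show ?thesis
      using K u by (intro integrable_mult_bounded[OF that(2), of _ K]) auto
  qed
  show 1: "integrable torus_measure (\<lambda>x. G' (u x) * (g x \<bullet> V x))"
    by (rule comp[OF G' igV])
  let ?A = "(\<integral>x. \<bar>g x \<bullet> V x\<bar> \<partial>torus_measure) + (b - a) * (\<integral>x. \<bar>D x\<bar> \<partial>torus_measure)"
  have *: "\<bar>(\<integral>x. G' (u x) * (g x \<bullet> V x) \<partial>torus_measure) + (\<integral>x. G (u x) * D x \<partial>torus_measure)\<bar> \<le> e * ?A" if e: "e > 0" for e
  proof -
    obtain p where p: "real_polynomial_function p" "\<And>r. r \<in> {a..b} \<Longrightarrow> \<bar>G' r - p r\<bar> < e"
      using Stone_Weierstrass_real_polynomial_function[OF _ G' e] by auto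
    obtain c n where pc: "p = (\<lambda>x. \<Sum>i\<le>n. c i * x ^ i)"
      using p(1) unfolding real_polynomial_function_iff_sum by blast
    have ident: "smooth (\<lambda>x::real. x)"
      by (rule smooth_real[of _ "\<lambda>_. 1"]) auto
    have sp: "smooth p"
      unfolding pc by (intro smooth_sum smooth_cmult smooth_power ident)
    \<comment> \<open>Matching the primitives at a makes their distance at most e (b - a) on the
      interval, which explains the second summand of \<open>?A\<close>.\<close>
    obtain P where P: "smooth P" "deriv P = p" "P a = G a"
      by (rule smooth_antiderivative[OF sp, where a = a and c = "G a"])
    have GP: "\<bar>G r - P r\<bar> \<le> e * (b - a)" if r: "r \<in> {a..b}" for r
    proof -
      have "norm ((G r - P r) - (G a - P a)) \<le> e * norm (r - a)"
      proof (rule field_differentiable_bound[of "{a..b}" "\<lambda>r. G r - P r" "\<lambda>r. G' r - p r"])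
        show "((\<lambda>r. G r - P r) has_field_derivative G' s - p s) (at s within {a..b})" if "s \<in> {a..b}" for s
          using smooth_real_deriv(2)[OF P(1), of s] P(2)
          by (intro DERIV_diff[OF G[OF that] has_field_derivative_at_within]) simp
        show "norm (G' s - p s) \<le> e" if "s \<in> {a..b}" for s using p(2)[OF that] by simp
      qed (use r ab in auto)
      also have "\<dots> \<le> e * (b - a)" using r e by (intro mult_left_mono) auto
      finally show ?thesis using P(3) by simp
    qed
    have 2: "integrable torus_measure (\<lambda>x. p (u x) * (g x \<bullet> V x))" "integrable torus_measure (\<lambda>x. P (u x) * D x)"
      "integrable torus_measure (\<lambda>x. G (u x) * D x)"
      by (intro comp smooth_continuous sp P(1) igV iD cG)+
    have eq: "(\<integral>x. p (u x) * (g x \<bullet> V x) \<partial>torus_measure) = - (\<integral>x. P (u x) * D x \<partial>torus_measure)"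
      using weak_chain_rule_smooth[OF div V wg u P(1)] P(2) by simp
    have "(\<integral>x. G' (u x) * (g x \<bullet> V x) \<partial>torus_measure) + (\<integral>x. G (u x) * D x \<partial>torus_measure) =
      (\<integral>x. (G' (u x) - p (u x)) * (g x \<bullet> V x) + (G (u x) - P (u x)) * D x \<partial>torus_measure)"
      using 1 2 eq by (simp add: left_diff_distrib)
    also have "\<bar>\<dots>\<bar> \<le> (\<integral>x. e * \<bar>g x \<bullet> V x\<bar> + e * (b - a) * \<bar>D x\<bar> \<partial>torus_measure)"
    proof (rule integral_abs_bound[THEN order_trans], rule integral_mono)
      show "integrable torus_measure (\<lambda>x. \<bar>(G' (u x) - p (u x)) * (g x \<bullet> V x) + (G (u x) - P (u x)) * D x\<bar>)"
        using 1 2 by (auto simp: left_diff_distrib)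
      show "integrable torus_measure (\<lambda>x. e * \<bar>g x \<bullet> V x\<bar> + e * (b - a) * \<bar>D x\<bar>)"
        using igV iD by auto
      fix x :: "real^'d" assume "x \<in> space torus_measure"
      then have "u x \<in> {a..b}" using u by simp
      then have "\<bar>G' (u x) - p (u x)\<bar> * \<bar>g x \<bullet> V x\<bar> \<le> e * \<bar>g x \<bullet> V x\<bar>"
        "\<bar>G (u x) - P (u x)\<bar> * \<bar>D x\<bar> \<le> e * (b - a) * \<bar>D x\<bar>"
        using p(2)[of "u x"] GP[of "u x"] by (auto intro!: mult_right_mono)
      then show "\<bar>(G' (u x) - p (u x)) * (g x \<bullet> V x) + (G (u x) - P (u x)) * D x\<bar> \<le> e * \<bar>g x \<bullet> V x\<bar> + e * (b - a) * \<bar>D x\<bar>"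
        by (intro order_trans[OF abs_triangle_ineq]) (simp add: abs_mult)
    qed
    also have "\<dots> = e * ?A"
      using igV iD by (simp add: distrib_left mult.assoc)
    finally show ?thesis .
  qed
  have "\<bar>(\<integral>x. G' (u x) * (g x \<bullet> V x) \<partial>torus_measure) + (\<integral>x. G (u x) * D x \<partial>torus_measure)\<bar> \<le> 0"
  proof -
    have A: "?A \<ge> 0" using ab by simp
    show ?thesis
    proof (rule field_le_epsilon)
      fix d :: real assume d: "d > 0"
      have "d / (?A + 1) * ?A \<le> d" using A d by (simp add: field_simps)
      moreover have "d / (?A + 1) > 0" using A d by (intro divide_pos_pos) auto
      ultimately show "\<bar>(\<integral>x. G' (u x) * (g x \<bullet> V x) \<partial>torus_measure) + (\<integral>x. G (u x) * D x \<partial>torus_measure)\<bar> \<le> 0 + d"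
        using *[of "d / (?A + 1)"] by linarith
    qed
  qed
  then show "(\<integral>x. G' (u x) * (g x \<bullet> V x) \<partial>torus_measure) = - (\<integral>x. G (u x) * D x \<partial>torus_measure)"
    by linarith
qed

section \<open>Stochastic integrals have mean zero\<close>

lemma lborel_distr_uminus_euclidean: "distr lborel borel uminus = (lborel :: 'a::euclidean_space measure)"
proof -
  have "lborel = density (distr lborel borel (\<lambda>x::'a. 0 + (-1) *\<^sub>R x)) (\<lambda>_. ennreal (\<bar>-1\<bar> ^ DIM('a)))"
    by (rule lborel_affine) simp
  then show ?thesis by (simp add: density_1)
qed

text \<open>The first moment is finite because the density is a product, and it vanishes because the
  density is even and the coordinate is odd.\<close>

lemma normal_vector_mean:
  fixes X :: "'a \<Rightarrow> real^'d"
  assumes v: "v > 0" and d: "distributed M lborel X (\<lambda>x. ennreal (\<Prod>i\<in>UNIV. normal_density 0 v (x $ i)))"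
  shows "integrable M (\<lambda>\<omega>. X \<omega> $ j)" "(\<integral>\<omega>. X \<omega> $ j \<partial>M) = 0"
proof -
  define p where "p x = (\<Prod>i\<in>UNIV. normal_density 0 v (x $ i))" for x :: "real^'d"
  have p0: "p x \<ge> 0" for x by (simp add: p_def prod_nonneg)
  have [measurable]: "(\<lambda>x::real^'d. x $ i) \<in> borel_measurable borel" for i
    by (intro borel_measurable_continuous_onI continuous_intros)
  have [measurable]: "p \<in> borel_measurable borel" unfolding p_def[abs_def] by measurable
  have d: "distributed M lborel X (\<lambda>x. ennreal (p x))" using d by (simp add: p_def[abs_def])
  \<comment> \<open>The modulus of the j-th coordinate is absorbed into the j-th factor, so that the
    absolute moment factorises into one-dimensional integrals.\<close>
  define h where "h b x = normal_density 0 v x * (if b = axis j 1 then \<bar>x\<bar> else 1)" for b :: "real^'d" and x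
  have [measurable]: "h b \<in> borel_measurable borel" for b unfolding h_def by measurable
  have h0: "h b x \<ge> 0" for b x by (simp add: h_def)
  have B: "bij_betw (\<lambda>i. axis i 1) UNIV (Basis :: (real^'d) set)"
    by (auto simp: bij_betw_def inj_on_def axis_eq_axis Basis_vec_def)
  have hp: "p x * \<bar>x $ j\<bar> = (\<Prod>b\<in>Basis. h b (x \<bullet> b))" for x
  proof -
    have "(\<Prod>b\<in>Basis. h b (x \<bullet> b)) = (\<Prod>i\<in>UNIV. normal_density 0 v (x $ i) * (if i = j then \<bar>x $ i\<bar> else 1))"
      by (subst prod.reindex_bij_betw[OF B, symmetric]) (simp add: h_def inner_axis axis_eq_axis)
    then show ?thesis by (simp add: p_def prod.distrib)
  qed
  have "(\<integral>\<^sup>+x. ennreal (p x * \<bar>x $ j\<bar>) \<partial>lborel) = (\<Prod>b\<in>Basis. \<integral>\<^sup>+x. ennreal (h b x) \<partial>lborel)"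
    unfolding hp by (subst nn_integral_lborel_prod[symmetric]) (auto simp: prod_ennreal h0)
  also have "\<dots> < \<infinity>"
  proof -
    have "integrable lborel (h b)" for b
      using integrable_normal_moment_abs[OF v, of 0 1] v by (cases "b = axis j 1") (auto simp: h_def[abs_def])
    then have "(\<integral>\<^sup>+x. ennreal (h b x) \<partial>lborel) < \<infinity>" for b
      by (subst nn_integral_eq_integral) (auto simp: h0)
    then have "(\<integral>\<^sup>+x. ennreal (h b x) \<partial>lborel) \<noteq> \<top>" for b
      by (metis infinity_ennreal_def less_irrefl)
    then have "(\<Prod>b\<in>Basis. \<integral>\<^sup>+x. ennreal (h b x) \<partial>lborel) \<noteq> \<top>"
      by (simp add: ennreal_prod_eq_top)
    then show ?thesis by (simp add: less_top)
  qed
  finally have i: "integrable lborel (\<lambda>x. p x * x $ j)"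
    by (intro integrableI_bounded) (auto simp: abs_mult p0)
  show "integrable M (\<lambda>\<omega>. X \<omega> $ j)"
    using distributed_integrable[OF d, of "\<lambda>x. x $ j"] i p0 by simp
  have "(\<integral>x. p x * x $ j \<partial>lborel) = (\<integral>x. p x * x $ j \<partial>distr lborel borel uminus)"
    by (simp add: lborel_distr_uminus_euclidean)
  also have "\<dots> = (\<integral>x. p (- x) * (- x) $ j \<partial>lborel)"
    by (subst integral_distr) auto
  also have "\<dots> = - (\<integral>x. p x * x $ j \<partial>lborel)"
  proof -
    have "p (- x) = p x" for x by (simp add: p_def normal_density_def)
    then show ?thesis by simp
  qed
  finally have "(\<integral>x. p x * x $ j \<partial>lborel) = 0" by simp
  then show "(\<integral>\<omega>. X \<omega> $ j \<partial>M) = 0"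
    using distributed_integral[OF d, of "\<lambda>x. x $ j"] p0 by simp
qed

text \<open>The integrand is measurable for the past at time s and the increment is independent of
  that past, so each component product has expectation equal to a product with a vanishing factor.
  Boundedness of the integrand gives its integrability.\<close>

lemma brownian_increment_orthogonal:
  fixes W :: "real \<Rightarrow> 'a \<Rightarrow> real^'d"
  assumes M: "prob_space M" and F: "time_filtration M F" and W: "brownian_motion M F W"
    and st: "0 \<le> s" "s < t" and \<zeta>: "\<zeta> \<in> borel_measurable (F s)" "bounded (\<zeta> ` space (F s))"
  shows "integrable M (\<lambda>\<omega>. \<zeta> \<omega> \<bullet> (W t \<omega> - W s \<omega>))" "(\<integral>\<omega>. \<zeta> \<omega> \<bullet> (W t \<omega> - W s \<omega>) \<partial>M) = 0"
proof -
  interpret prob_space M by (rule M)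
  define \<Delta> where "\<Delta> \<omega> = W t \<omega> - W s \<omega>" for \<omega>
  have sub: "subalgebra M (F s)" using F st by (simp add: time_filtration_def)
  then have sp: "space (F s) = space M" and se: "sets (F s) \<subseteq> sets M" by (auto simp: subalgebra_def)
  have ind: "indep_set (sets (F s)) (sets (vimage_algebra (space M) \<Delta> borel))"
    and dist: "distributed M lborel \<Delta> (\<lambda>x. ennreal (\<Prod>i\<in>UNIV. normal_density 0 (sqrt (t - s)) (x $ i)))"
    using W st unfolding brownian_motion_def \<Delta>_def[abs_def] by auto
  have v: "sqrt (t - s) > 0" using st by simp
  note mean = normal_vector_mean[OF v dist]
  have [measurable]: "\<Delta> \<in> borel_measurable M" using distributed_measurable[OF dist] by simp
  have [measurable]: "\<zeta> \<in> borel_measurable M" using measurable_from_subalg[OF sub \<zeta>(1)] .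
  have vec [measurable]: "(\<lambda>x::real^'d. x $ i) \<in> borel_measurable borel" for i
    by (intro borel_measurable_continuous_onI continuous_intros)
  obtain C where C: "\<And>\<omega>. \<omega> \<in> space M \<Longrightarrow> norm (\<zeta> \<omega>) \<le> C"
    using \<zeta>(2) unfolding bounded_iff sp by auto
  have iz: "integrable M (\<lambda>\<omega>. \<zeta> \<omega> $ i)" for i
    by (rule integrable_const_bound[of _ C])
      (use C component_le_norm_cart order_trans in \<open>fastforce intro!: AE_I2\<close>)+
  have iv: "indep_var borel (\<lambda>\<omega>. \<zeta> \<omega> $ i) borel (\<lambda>\<omega>. \<Delta> \<omega> $ i)" for i
    unfolding indep_var_eq
  proof (intro conjI)
    show "indep_set (sigma_sets (space M) {(\<lambda>\<omega>. \<zeta> \<omega> $ i) -` A \<inter> space M |A. A \<in> sets borel})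
      (sigma_sets (space M) {(\<lambda>\<omega>. \<Delta> \<omega> $ i) -` A \<inter> space M |A. A \<in> sets borel})"
      using ind unfolding indep_set_def
    proof (rule indep_sets_mono_sets)
      fix b :: bool
      have 1: "sigma_sets (space M) {(\<lambda>\<omega>. \<zeta> \<omega> $ i) -` A \<inter> space M |A. A \<in> sets borel} \<subseteq> sets (F s)"
        unfolding sp[symmetric]
        by (rule sets.sigma_sets_subset) (use measurable_compose[OF \<zeta>(1) vec] in \<open>auto dest: measurable_sets\<close>)
      have 2: "sigma_sets (space M) {(\<lambda>\<omega>. \<Delta> \<omega> $ i) -` A \<inter> space M |A. A \<in> sets borel} \<subseteq> sets (vimage_algebra (space M) \<Delta> borel)"
        unfolding sets_vimage_algebra
      proof (rule sigma_sets_mono', clarify)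
        fix A :: "real set" assume A: "A \<in> sets borel"
        have "(\<lambda>\<omega>. \<Delta> \<omega> $ i) -` A \<inter> space M = \<Delta> -` ((\<lambda>x. x $ i) -` A) \<inter> space M" by auto
        moreover have "(\<lambda>x::real^'d. x $ i) -` A \<in> sets borel" using measurable_sets[OF vec A] by simp
        ultimately show "\<exists>B. (\<lambda>\<omega>. \<Delta> \<omega> $ i) -` A \<inter> space M = \<Delta> -` B \<inter> space M \<and> B \<in> sets borel" by blast
      qed
      show "(case b of True \<Rightarrow> sigma_sets (space M) {(\<lambda>\<omega>. \<zeta> \<omega> $ i) -` A \<inter> space M |A. A \<in> sets borel}
         | False \<Rightarrow> sigma_sets (space M) {(\<lambda>\<omega>. \<Delta> \<omega> $ i) -` A \<inter> space M |A. A \<in> sets borel})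
         \<subseteq> (case b of True \<Rightarrow> sets (F s) | False \<Rightarrow> sets (vimage_algebra (space M) \<Delta> borel))"
        using 1 2 by (auto split: bool.split)
    qed
  qed auto
  have *: "\<zeta> \<omega> \<bullet> \<Delta> \<omega> = (\<Sum>i\<in>UNIV. \<zeta> \<omega> $ i * \<Delta> \<omega> $ i)" for \<omega>
    by (simp add: inner_vec_def)
  have i: "integrable M (\<lambda>\<omega>. \<zeta> \<omega> $ i * \<Delta> \<omega> $ i)" for i
    by (rule indep_var_integrable[OF iv iz mean(1)])
  show "integrable M (\<lambda>\<omega>. \<zeta> \<omega> \<bullet> (W t \<omega> - W s \<omega>))"
    unfolding \<Delta>_def[symmetric] * using i by auto
  have "(\<integral>\<omega>. \<zeta> \<omega> $ i * \<Delta> \<omega> $ i \<partial>M) = 0" for i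
    using indep_var_lebesgue_integral[OF iv iz mean(1)] mean(2) by simp
  then show "(\<integral>\<omega>. \<zeta> \<omega> \<bullet> (W t \<omega> - W s \<omega>) \<partial>M) = 0"
    unfolding \<Delta>_def[symmetric] * using i by simp
qed

lemma simple_integral_mean:
  fixes W :: "real \<Rightarrow> 'a \<Rightarrow> real^'d"
  assumes M: "prob_space M" and F: "time_filtration M F" and W: "brownian_motion M F W"
    and t: "0 \<le> t" and s: "simple_process F T n \<tau> \<zeta>"
  shows "integrable M (simple_integral W n \<tau> \<zeta> t)" "(\<integral>\<omega>. simple_integral W n \<tau> \<zeta> t \<omega> \<partial>M) = 0"
proof -
  have *: "integrable M (\<lambda>\<omega>. \<zeta> j \<omega> \<bullet> (W (min t (\<tau> (Suc j))) \<omega> - W (min t (\<tau> j)) \<omega>)) \<and>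
    (\<integral>\<omega>. \<zeta> j \<omega> \<bullet> (W (min t (\<tau> (Suc j))) \<omega> - W (min t (\<tau> j)) \<omega>) \<partial>M) = 0" if j: "j < n" for j
  proof -
    have \<tau>: "0 \<le> \<tau> j" "\<tau> j \<le> \<tau> (Suc j)" and \<zeta>: "\<zeta> j \<in> borel_measurable (F (\<tau> j))" "bounded (\<zeta> j ` space (F (\<tau> j)))"
      using s j by (auto simp: simple_process_def)
    show ?thesis
    proof (cases "min t (\<tau> (Suc j)) = min t (\<tau> j)")
      case False
      \<comment> \<open>If stopping at t leaves a nonzero time interval, it still starts at
        \<open>\<tau> j\<close>, where \<open>\<zeta> j\<close> is measurable. In the other case the
        increment is zero.\<close>
      then have "min t (\<tau> j) = \<tau> j" "\<tau> j < min t (\<tau> (Suc j))" using \<tau> by auto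
      then show ?thesis
        using brownian_increment_orthogonal[OF M F W \<tau>(1) _ \<zeta>, of "min t (\<tau> (Suc j))"] by simp
    qed simp
  qed
  show "integrable M (simple_integral W n \<tau> \<zeta> t)"
    unfolding simple_integral_def[abs_def] using * by (intro Bochner_Integration.integrable_sum) auto
  show "(\<integral>\<omega>. simple_integral W n \<tau> \<zeta> t \<omega> \<partial>M) = 0"
    unfolding simple_integral_def using * by (subst Bochner_Integration.integral_sum) auto
qed

text \<open>On a probability space convergence in square mean implies convergence in mean, hence
  convergence of expectations. Integrability of the limit is part of the conclusion, since only its
  measurability is assumed.\<close>

lemma mean_zero_L2_limit:
  fixes X :: "nat \<Rightarrow> 'a \<Rightarrow> real"
  assumes M: "prob_space M" and X: "\<And>n. integrable M (X n)" "\<And>n. (\<integral>\<omega>. X n \<omega> \<partial>M) = 0"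
    and Y [measurable]: "Y \<in> borel_measurable M"
    and lim: "(\<lambda>n. \<integral>\<^sup>+ \<omega>. ennreal ((X n \<omega> - Y \<omega>)\<^sup>2) \<partial>M) \<longlonglongrightarrow> 0"
  shows "integrable M Y" "(\<integral>\<omega>. Y \<omega> \<partial>M) = 0"
proof -
  interpret prob_space M by (rule M)
  have [measurable]: "X n \<in> borel_measurable M" for n using X(1) by auto
  have *: "\<exists>n. (\<integral>\<^sup>+ \<omega>. ennreal \<bar>X n \<omega> - Y \<omega>\<bar> \<partial>M) \<le> ennreal (2 * e)" if e: "e > 0" for e :: real
  proof -
    have "eventually (\<lambda>n. (\<integral>\<^sup>+ \<omega>. ennreal ((X n \<omega> - Y \<omega>)\<^sup>2) \<partial>M) < ennreal (e\<^sup>2)) sequentially"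
      by (rule order_tendstoD(2)[OF lim]) (use e in \<open>simp add: ennreal_less_zero_iff\<close>)
    then obtain n where n: "(\<integral>\<^sup>+ \<omega>. ennreal ((X n \<omega> - Y \<omega>)\<^sup>2) \<partial>M) < ennreal (e\<^sup>2)"
      by (auto simp: eventually_sequentially)
    have "(\<integral>\<^sup>+ \<omega>. ennreal \<bar>X n \<omega> - Y \<omega>\<bar> \<partial>M) \<le> (\<integral>\<^sup>+ \<omega>. ennreal e + ennreal (1 / e) * ennreal ((X n \<omega> - Y \<omega>)\<^sup>2) \<partial>M)"
    proof (rule nn_integral_mono)
      fix \<omega>
      let ?z = "X n \<omega> - Y \<omega>"
      \<comment> \<open>This yields |z| \<le> e + z^2 / e. Once the second moment is below e^2, the
        first is at most 2 e.\<close>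
      have "0 \<le> (\<bar>?z\<bar> - e)\<^sup>2 + \<bar>?z\<bar> * e" using e by simp
      then have "\<bar>?z\<bar> * e \<le> e\<^sup>2 + ?z\<^sup>2" by (simp add: power2_eq_square algebra_simps)
      then have "\<bar>?z\<bar> \<le> e + 1 / e * ?z\<^sup>2" using e by (simp add: field_simps power2_eq_square)
      then have "ennreal \<bar>?z\<bar> \<le> ennreal (e + 1 / e * ?z\<^sup>2)" by (rule ennreal_leI)
      also have "\<dots> = ennreal e + ennreal (1 / e) * ennreal (?z\<^sup>2)"
        using e by (subst ennreal_plus) (auto simp: ennreal_mult[symmetric])
      finally show "ennreal \<bar>?z\<bar> \<le> ennreal e + ennreal (1 / e) * ennreal (?z\<^sup>2)" .
    qed
    also have "\<dots> = ennreal e + ennreal (1 / e) * (\<integral>\<^sup>+ \<omega>. ennreal ((X n \<omega> - Y \<omega>)\<^sup>2) \<partial>M)"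
      by (simp add: nn_integral_add nn_integral_cmult emeasure_space_1)
    also have "\<dots> \<le> ennreal e + ennreal (1 / e) * ennreal (e\<^sup>2)"
      using n by (intro add_left_mono mult_left_mono) auto
    also have "\<dots> = ennreal (2 * e)"
      using e by (simp add: ennreal_mult[symmetric] ennreal_plus[symmetric] power2_eq_square del: ennreal_plus)
    finally show ?thesis by blast
  qed
  have i: "integrable M (\<lambda>\<omega>. X n \<omega> - Y \<omega>)" if "(\<integral>\<^sup>+ \<omega>. ennreal \<bar>X n \<omega> - Y \<omega>\<bar> \<partial>M) \<le> ennreal c" for n c
    using that by (intro integrableI_bounded) (auto intro: le_less_trans)
  obtain n where "(\<integral>\<^sup>+ \<omega>. ennreal \<bar>X n \<omega> - Y \<omega>\<bar> \<partial>M) \<le> ennreal (2 * 1)" using *[of 1] by auto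
  from Bochner_Integration.integrable_diff[OF X(1)[of n] i[OF this]] show iY: "integrable M Y" by simp
  have "\<bar>\<integral>\<omega>. Y \<omega> \<partial>M\<bar> \<le> 0 + e" if e: "e > 0" for e
  proof -
    obtain n where n: "(\<integral>\<^sup>+ \<omega>. ennreal \<bar>X n \<omega> - Y \<omega>\<bar> \<partial>M) \<le> ennreal (2 * (e / 2))"
      using *[of "e / 2"] e by auto
    have "(\<integral>\<omega>. X n \<omega> - Y \<omega> \<partial>M) = - (\<integral>\<omega>. Y \<omega> \<partial>M)" using X iY by simp
    then have "ennreal \<bar>\<integral>\<omega>. Y \<omega> \<partial>M\<bar> \<le> ennreal e"
      using integral_norm_bound_ennreal[OF i[OF n]] n by (simp add: order_trans)
    then show ?thesis using e by (simp add: ennreal_le_iff)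
  qed
  then have "\<bar>\<integral>\<omega>. Y \<omega> \<partial>M\<bar> \<le> 0" by (rule field_le_epsilon)
  then show "(\<integral>\<omega>. Y \<omega> \<partial>M) = 0" by simp
qed

lemma ito_integral_mean:
  assumes M: "prob_space M" and F: "time_filtration M F" and W: "brownian_motion M F W"
    and I: "ito_integral M F T W H I" and t: "t \<in> {0..T}"
  shows "integrable M (I t)" "(\<integral>\<omega>. I t \<omega> \<partial>M) = 0"
proof -
  obtain n \<tau> \<zeta> where s: "\<And>m. simple_process F T (n m) (\<tau> m) (\<zeta> m)"
    and l: "(\<lambda>m. \<integral>\<^sup>+ \<omega>. ennreal ((simple_integral W (n m) (\<tau> m) (\<zeta> m) t \<omega> - I t \<omega>)\<^sup>2) \<partial>M) \<longlonglongrightarrow> 0"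
    using I t unfolding ito_integral_def by blast
  have m: "I t \<in> borel_measurable M" using I t by (auto simp: ito_integral_def)
  have t0: "0 \<le> t" using t by simp
  note mean = simple_integral_mean[OF M F W t0 s]
  show "integrable M (I t)" "(\<integral>\<omega>. I t \<omega> \<partial>M) = 0"
    by (rule mean_zero_L2_limit[OF M mean m l])+
qed

lemma noise_integral_mean:
  assumes M: "prob_space M" and F: "time_filtration M F" and B: "\<And>k. brownian_motion M F (B k)"
    and J: "noise_integral M F B f T g h Dh J" and t: "t \<in> {0..T}"
  shows "integrable M (J t)" "(\<integral>\<omega>. J t \<omega> \<partial>M) = 0"
proof -
  obtain I I' where I: "\<And>k. ito_integral M F T (B k)
       (\<lambda>\<omega> t. \<integral>x. (g \<omega> t x * f k x) *\<^sub>R Dh \<omega> t x \<partial>torus_measure) (I k)"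
     "\<And>k. ito_integral M F T (B k)
       (\<lambda>\<omega> t. \<integral>x. (g \<omega> t x * h \<omega> t x) *\<^sub>R grad (f k) x \<partial>torus_measure) (I' k)"
    and l: "(\<lambda>n. \<integral>\<^sup>+ \<omega>. ennreal (((\<Sum>k<n. I k t \<omega> + I' k t \<omega>) - J t \<omega>)\<^sup>2) \<partial>M) \<longlonglongrightarrow> 0"
    using J t unfolding noise_integral_def by blast
  have m: "J t \<in> borel_measurable M" using J t by (auto simp: noise_integral_def)
  note mean = ito_integral_mean[OF M F B I(1) t] ito_integral_mean[OF M F B I(2) t]
  have "integrable M (\<lambda>\<omega>. \<Sum>k<n. I k t \<omega> + I' k t \<omega>)" "(\<integral>\<omega>. (\<Sum>k<n. I k t \<omega> + I' k t \<omega>) \<partial>M) = 0" for n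
    using mean by simp_all
  then show "integrable M (J t)" "(\<integral>\<omega>. J t \<omega> \<partial>M) = 0"
    by (rule mean_zero_L2_limit[OF M _ _ m l])+
qed

section \<open>Cutoffs in the kinetic variable\<close>

text \<open>One profile is fixed for all cutoffs, so that the bounds on its derivatives do not
  depend on n.\<close>

definition step :: "real \<Rightarrow> real" where
  "step = (SOME g. smooth g \<and> (\<forall>x\<le>0. g x = 0) \<and> (\<forall>x\<ge>1. g x = 1) \<and> (\<forall>x. 0 \<le> g x \<and> g x \<le> 1) \<and>
     (\<forall>x. 0 < x \<longrightarrow> x < 1 \<longrightarrow> deriv g x > 0) \<and> (\<forall>x. deriv g x \<ge> 0) \<and> (\<forall>x. x \<le> 0 \<or> 1 \<le> x \<longrightarrow> deriv g x = 0))"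

lemma step:
  shows smooth_step: "smooth step"
    and step_0: "x \<le> 0 \<Longrightarrow> step x = 0" and step_1: "x \<ge> 1 \<Longrightarrow> step x = 1"
    and step_range: "0 \<le> step x" "step x \<le> 1"
    and deriv_step_pos: "0 < x \<Longrightarrow> x < 1 \<Longrightarrow> deriv step x > 0"
    and deriv_step_nonneg: "deriv step x \<ge> 0"
    and deriv_step_0: "x \<le> 0 \<or> 1 \<le> x \<Longrightarrow> deriv step x = 0"
proof -
  let ?P = "\<lambda>g. smooth g \<and> (\<forall>x\<le>0. g x = 0) \<and> (\<forall>x\<ge>1. g x = 1) \<and> (\<forall>x. 0 \<le> g x \<and> g x \<le> 1) \<and>
     (\<forall>x::real. 0 < x \<longrightarrow> x < 1 \<longrightarrow> deriv g x > 0) \<and> (\<forall>x. deriv g x \<ge> 0) \<and> (\<forall>x. x \<le> 0 \<or> 1 \<le> x \<longrightarrow> deriv g x = (0::real))"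
  have "\<exists>g. ?P g" by (rule smooth_step_exists) blast
  from someI_ex[OF this] have "?P step" unfolding step_def .
  then show "smooth step" "x \<le> 0 \<Longrightarrow> step x = 0" "x \<ge> 1 \<Longrightarrow> step x = 1" "0 \<le> step x" "step x \<le> 1"
    "0 < x \<Longrightarrow> x < 1 \<Longrightarrow> deriv step x > 0" "deriv step x \<ge> 0" "x \<le> 0 \<or> 1 \<le> x \<Longrightarrow> deriv step x = 0"
    by auto
qed

lemma smooth_deriv_step: "smooth (deriv step)"
  by (rule smooth_real_deriv(1)[OF smooth_step])

text \<open>The derivative of \<open>step\<close> is nonnegative, so each of its zeros is a
  minimum.\<close>

lemma deriv_deriv_step_0:
  assumes "x \<le> 0 \<or> 1 \<le> x"
  shows "deriv (deriv step) x = 0"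
proof -
  have "deriv step x \<le> deriv step y" for y
    using deriv_step_0[OF assms] deriv_step_nonneg[of y] by simp
  then show ?thesis
    using DERIV_local_min[OF smooth_real_deriv(2)[OF smooth_deriv_step], of 1 x] by auto
qed

lemma bounded_compact_support:
  fixes f :: "real \<Rightarrow> real"
  assumes "continuous_on {a..b} f" "\<And>x. x \<notin> {a..b} \<Longrightarrow> f x = 0"
  obtains C where "C > 0" "\<And>x. \<bar>f x\<bar> \<le> C"
proof -
  have "bounded (f ` {a..b})"
    by (intro compact_imp_bounded compact_continuous_image assms compact_Icc)
  then obtain C where C: "\<forall>x\<in>{a..b}. \<bar>f x\<bar> \<le> C" unfolding bounded_iff by auto
  have "\<bar>f x\<bar> \<le> max C 1" for x
    using C assms(2)[of x] by (cases "x \<in> {a..b}") fastforce+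
  then show ?thesis by (intro that[of "max C 1"]) auto
qed

lemma deriv_step_bounded: obtains C where "C > 0" "\<And>x. deriv step x \<le> C" "\<And>x. \<bar>deriv (deriv step) x\<bar> \<le> C"
proof -
  obtain C1 where C1: "C1 > 0" "\<And>x. \<bar>deriv step x\<bar> \<le> C1"
    by (rule bounded_compact_support[of 0 1 "deriv step"])
      (auto intro: smooth_continuous smooth_deriv_step deriv_step_0)
  obtain C2 where C2: "C2 > 0" "\<And>x. \<bar>deriv (deriv step) x\<bar> \<le> C2"
    by (rule bounded_compact_support[of 0 1 "deriv (deriv step)"])
      (auto intro: smooth_continuous smooth_real_deriv(1) smooth_deriv_step deriv_deriv_step_0)
  show ?thesis
    by (rule that[of "max C1 C2"]) (use C1 C2 in \<open>auto simp: le_max_iff_disj abs_le_iff\<close>)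
qed

text \<open>With \<open>\<beta> = 1 / (n + 1)\<close> and \<open>M = n + 2\<close>, the cutoff rises from 0 to 1 on \<open>[\<beta>/4, 5\<beta>/4]\<close> and falls back
  to 0 on \<open>[M, M + 1]\<close>.\<close>

definition lower :: "nat \<Rightarrow> real \<Rightarrow> real" where
  "lower n \<xi> = real (n + 1) * deriv step (real (n + 1) * \<xi> - 1 / 4)"

definition upper :: "nat \<Rightarrow> real \<Rightarrow> real" where
  "upper n \<xi> = deriv step (\<xi> - real (n + 2))"

definition cutoff :: "nat \<Rightarrow> real \<Rightarrow> real" where
  "cutoff n \<xi> = step (real (n + 1) * \<xi> - 1 / 4) - step (\<xi> - real (n + 2))"

lemma smooth_affine: "smooth f \<Longrightarrow> smooth (\<lambda>x. f (c * x - d))" for f :: "real \<Rightarrow> real"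
  using smooth_compose_linear[of f "\<lambda>x. c * x" "- d"] by (simp add: bounded_linear_mult_right)

lemma smooth_lower: "smooth (lower n)"
  unfolding lower_def[abs_def] by (intro smooth_cmult smooth_affine smooth_deriv_step)

lemma smooth_upper: "smooth (upper n)"
  unfolding upper_def[abs_def] using smooth_affine[OF smooth_deriv_step, of 1] by simp

lemma smooth_cutoff: "smooth (cutoff n)"
  unfolding cutoff_def[abs_def]
  using smooth_affine[OF smooth_step, of 1] by (intro smooth_diff smooth_affine smooth_step) simp

lemma step_affine_deriv: "((\<lambda>\<xi>. step (c * \<xi> - d)) has_real_derivative c * deriv step (c * \<xi> - d)) (at \<xi>)"
proof -
  have "((\<lambda>\<xi>. c * \<xi> - d) has_real_derivative c) (at \<xi>)" by (auto intro!: derivative_eq_intros)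
  from DERIV_chain2[OF smooth_real_deriv(2)[OF smooth_step] this] show ?thesis
    by (simp add: mult.commute)
qed

lemma cutoff_deriv: "(cutoff n has_real_derivative lower n \<xi> - upper n \<xi>) (at \<xi>)"
  unfolding cutoff_def[abs_def] lower_def upper_def
  using step_affine_deriv[of 1 "real (n + 2)"] by (intro DERIV_diff step_affine_deriv) simp

lemma lower_support: "lower n \<xi> \<noteq> 0 \<Longrightarrow> \<xi> \<in> {1 / (4 * real (n + 1))..5 / (4 * real (n + 1))}"
proof -
  assume "lower n \<xi> \<noteq> 0"
  then have "\<not> (real (n + 1) * \<xi> - 1 / 4 \<le> 0 \<or> 1 \<le> real (n + 1) * \<xi> - 1 / 4)"
    using deriv_step_0 unfolding lower_def by (metis mult_zero_right)
  then show ?thesis by (auto simp: field_simps)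
qed

lemma upper_support: "upper n \<xi> \<noteq> 0 \<Longrightarrow> \<xi> \<in> {real (n + 2)<..<real (n + 3)}"
proof -
  assume "upper n \<xi> \<noteq> 0"
  then have "\<not> (\<xi> - real (n + 2) \<le> 0 \<or> 1 \<le> \<xi> - real (n + 2))"
    using deriv_step_0 unfolding upper_def by metis
  then show ?thesis by auto
qed

lemma lower_nonneg: "0 \<le> lower n \<xi>" and upper_nonneg: "0 \<le> upper n \<xi>"
  by (simp_all add: lower_def upper_def deriv_step_nonneg)

text \<open>Where the falling part of the cutoff is active, the rising part has already reached 1;
  hence the cutoff stays nonnegative.\<close>

lemma large_affine:
  assumes "real (n + 2) \<le> \<xi>"
  shows "1 \<le> real (n + 1) * \<xi> - 1 / 4"
proof -
  have "1 * \<xi> \<le> real (n + 1) * \<xi>" using assms by (intro mult_right_mono) auto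
  moreover have "2 \<le> real (n + 2)" by simp
  ultimately show ?thesis using assms by linarith
qed

lemma cutoff_range: "0 \<le> cutoff n \<xi>" "cutoff n \<xi> \<le> 1"
proof -
  show "cutoff n \<xi> \<le> 1"
    using step_range(1)[of "\<xi> - real (n + 2)"] step_range(2)[of "real (n + 1) * \<xi> - 1 / 4"] by (simp add: cutoff_def)
  show "0 \<le> cutoff n \<xi>"
  proof (cases "\<xi> \<le> real (n + 2)")
    case True
    then show ?thesis by (simp add: cutoff_def step_0 step_range)
  next
    case False
    then have "step (real (n + 1) * \<xi> - 1 / 4) = 1" by (intro step_1 large_affine) auto
    then show ?thesis by (simp add: cutoff_def step_range)
  qed
qed

lemma cutoff_support: "cutoff n \<xi> \<noteq> 0 \<Longrightarrow> \<xi> \<in> {1 / (4 * real (n + 1))..real (n + 3)}"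
proof (rule ccontr)
  assume 1: "cutoff n \<xi> \<noteq> 0" and 2: "\<xi> \<notin> {1 / (4 * real (n + 1))..real (n + 3)}"
  have pos: "1 / (4 * real (n + 1)) \<le> real (n + 2)"
    by (rule order_trans[of _ 1]) (auto simp: field_simps)
  from 2 consider "\<xi> < 1 / (4 * real (n + 1))" | "\<xi> > real (n + 3)" by fastforce
  then show False
  proof cases
    case 1
    then have "real (n + 1) * \<xi> - 1 / 4 \<le> 0" by (simp add: field_simps)
    moreover have "\<xi> - real (n + 2) \<le> 0" using 1 pos by linarith
    ultimately show False using \<open>cutoff n \<xi> \<noteq> 0\<close> by (simp add: cutoff_def step_0)
  next
    case 2
    then have "step (real (n + 1) * \<xi> - 1 / 4) = 1" by (intro step_1 large_affine) auto
    moreover have "step (\<xi> - real (n + 2)) = 1" using 2 by (intro step_1) auto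
    ultimately show False using \<open>cutoff n \<xi> \<noteq> 0\<close> by (simp add: cutoff_def)
  qed
qed

lemma cutoff_tendsto: "\<xi> > 0 \<Longrightarrow> (\<lambda>n. cutoff n \<xi>) \<longlonglongrightarrow> 1"
  and lower_tendsto: "\<xi> > 0 \<Longrightarrow> eventually (\<lambda>n. lower n \<xi> = 0) sequentially"
  and upper_tendsto: "eventually (\<lambda>n. upper n \<zeta> = 0) sequentially"
proof -
  show u: "eventually (\<lambda>n. upper n \<zeta> = 0) sequentially" for \<zeta>
  proof -
    obtain N where "\<zeta> \<le> real N" using real_arch_simple by blast
    then have "\<zeta> \<le> real (n + 2)" if "n \<ge> N" for n using that by auto
    then show ?thesis using upper_support unfolding eventually_sequentially
      by (metis greaterThanLessThan_iff linorder_not_less)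
  qed
  assume \<xi>: "\<xi> > 0"
  obtain N where N: "max \<xi> (5 / (4 * \<xi>)) < real N" using reals_Archimedean2 by blast
  have b: "real (n + 1) * \<xi> - 1 / 4 \<ge> 1" "\<xi> \<le> real (n + 2)" if "n \<ge> N" for n
  proof -
    have "5 / (4 * \<xi>) \<le> real (n + 1)" using N that by auto
    then show "real (n + 1) * \<xi> - 1 / 4 \<ge> 1" using \<xi> by (simp add: field_simps)
    show "\<xi> \<le> real (n + 2)" using N that by auto
  qed
  show "eventually (\<lambda>n. lower n \<xi> = 0) sequentially"
    unfolding eventually_sequentially lower_def using b deriv_step_0 by (metis mult_zero_right)
  have "eventually (\<lambda>n. cutoff n \<xi> = 1) sequentially"
    unfolding eventually_sequentially
  proof (intro exI[of _ N] allI impI)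
    fix n assume "n \<ge> N"
    from b[OF this] show "cutoff n \<xi> = 1" by (simp add: cutoff_def step_0 step_1)
  qed
  then show "(\<lambda>n. cutoff n \<xi>) \<longlonglongrightarrow> 1" by (rule tendsto_eventually)
qed

section \<open>The coefficients near zero and at infinity\<close>

lemma continuous_mult_support:
  fixes f c :: "real \<Rightarrow> real"
  assumes f: "continuous_on {0<..} f" and c: "continuous_on UNIV c" "\<And>x. x \<notin> {a..b} \<Longrightarrow> c x = 0" and a: "0 < a"
  shows "continuous_on UNIV (\<lambda>x. f x * c x)"
proof -
  \<comment> \<open>f may be singular at 0, but the product is zero below a; two overlapping open
    sets cover the line, and the product is continuous on each.\<close>
  have "continuous_on ({0<..} \<union> {..<a}) (\<lambda>x. f x * c x)"
  proof (rule continuous_on_open_Un)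
    show "continuous_on {0<..} (\<lambda>x. f x * c x)"
      by (intro continuous_intros f continuous_on_subset[OF c(1)]) auto
    have "continuous_on {..<a} (\<lambda>x::real. 0::real)" by simp
    then show "continuous_on {..<a} (\<lambda>x. f x * c x)"
      by (rule continuous_on_cong[THEN iffD1, rotated 2]) (use c(2) in auto)
  qed auto
  also have "{0<..} \<union> {..<a} = UNIV" using a by auto
  finally show ?thesis .
qed

lemma C11_loc_continuous:
  assumes "C11_loc \<sigma>"
  shows "continuous_on {0<..} (deriv \<sigma>)" "\<xi> > 0 \<Longrightarrow> (\<sigma> has_real_derivative deriv \<sigma> \<xi>) (at \<xi>)"
proof -
  show d: "(\<sigma> has_real_derivative deriv \<sigma> \<xi>) (at \<xi>)" if "\<xi> > 0" for \<xi>
    using assms that unfolding C11_loc_def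
    by (metis DERIV_deriv_iff_real_differentiable)
  have "isCont (deriv \<sigma>) \<xi>" if \<xi>: "\<xi> > 0" for \<xi>
  proof -
    have "0 < \<xi> / 2" "\<xi> / 2 \<le> 2 * \<xi>" using \<xi> by auto
    then obtain L where L: "L-lipschitz_on {\<xi> / 2..2 * \<xi>} (deriv \<sigma>)"
      using assms unfolding C11_loc_def by blast
    have "continuous_on {\<xi> / 2<..<2 * \<xi>} (deriv \<sigma>)"
      by (rule continuous_on_subset[OF lipschitz_on_continuous_on[OF L]]) auto
    then show ?thesis using \<xi> by (simp add: continuous_on_eq_continuous_at)
  qed
  then show "continuous_on {0<..} (deriv \<sigma>)" by (auto intro!: continuous_at_imp_continuous_on)
qed

lemma C11_loc_product_continuous:
  assumes "C11_loc \<sigma>"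
  shows "continuous_on {0<..} (\<lambda>\<xi>. \<sigma> \<xi> * deriv \<sigma> \<xi>)"
proof (intro continuous_on_mult C11_loc_continuous(1)[OF assms])
  show "continuous_on {0<..} \<sigma>"
    by (rule DERIV_continuous_on) (rule has_field_derivative_at_within[OF C11_loc_continuous(2)[OF assms]], simp)
qed

lemma square_linear_bound:
  assumes c: "continuous_on {0..} \<sigma>" and l: "Limsup (at_right 0) (\<lambda>\<xi>. ereal ((\<sigma> \<xi>)\<^sup>2 / \<xi>)) \<le> ereal c0"
  obtains c where "c > 0" "\<And>\<xi>. \<xi> \<in> {0<..b} \<Longrightarrow> (\<sigma> \<xi>)\<^sup>2 \<le> c * \<xi>"
proof -
  have "Limsup (at_right 0) (\<lambda>\<xi>. ereal ((\<sigma> \<xi>)\<^sup>2 / \<xi>)) < ereal (c0 + 1)"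
    using l by (rule le_less_trans) simp
  then have "eventually (\<lambda>\<xi>. ereal ((\<sigma> \<xi>)\<^sup>2 / \<xi>) < ereal (c0 + 1)) (at_right 0)"
    by (rule Limsup_lessD)
  then obtain d where d: "d > 0" "\<And>\<xi>. 0 < \<xi> \<Longrightarrow> \<xi> < d \<Longrightarrow> (\<sigma> \<xi>)\<^sup>2 / \<xi> < c0 + 1"
    by (auto simp: eventually_at_right_field)
  have "bounded ((\<lambda>\<xi>. (\<sigma> \<xi>)\<^sup>2) ` {0..b})"
    by (intro compact_imp_bounded compact_continuous_image continuous_intros continuous_on_subset[OF c]) auto
  then obtain S where S: "\<forall>\<xi>\<in>{0..b}. (\<sigma> \<xi>)\<^sup>2 \<le> S" unfolding bounded_iff by auto
  \<comment> \<open>On (0, d) the limsup bound applies. On [d, b] the maximum S is at most (S / d)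
    \<xi>. The 1 makes the constant positive.\<close>
  define k where "k = max 1 (max (c0 + 1) (S / d))"
  have "(\<sigma> \<xi>)\<^sup>2 \<le> k * \<xi>" if \<xi>: "\<xi> \<in> {0<..b}" for \<xi>
  proof (cases "\<xi> < d")
    case True
    then have "(\<sigma> \<xi>)\<^sup>2 \<le> (c0 + 1) * \<xi>" using d(2)[of \<xi>] \<xi> by (simp add: field_simps)
    also have "\<dots> \<le> k * \<xi>" using \<xi> by (intro mult_right_mono) (auto simp: k_def)
    finally show ?thesis .
  next
    case False
    have "(\<sigma> \<xi>)\<^sup>2 \<le> S" using S \<xi> by auto
    also have "S = S / d * d" using d(1) by simp
    also have "\<dots> \<le> k * d" using d(1) by (intro mult_right_mono) (auto simp: k_def)
    also have "\<dots> \<le> k * \<xi>" using False by (intro mult_left_mono) (auto simp: k_def)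
    finally show ?thesis .
  qed
  then show ?thesis by (intro that[of k]) (auto simp: k_def)
qed

text \<open>The derivative splits along \<^const>\<open>lower\<close> and \<^const>\<open>upper\<close>. Near zero, \<open>\<sigma> \<sigma>'\<close> is small on the
  support of \<^const>\<open>lower\<close>, whose integral is one; at infinity, the derivative is moved from \<open>\<sigma>\<^sup>2\<close> onto
  \<^const>\<open>upper\<close> because \<open>\<sigma> \<sigma>'\<close> is not controlled by \<open>\<sigma>\<^sup>2\<close>.\<close>

lemma lower_primitive:
  assumes C: "C11_loc \<sigma>" and e: "\<And>\<xi>. 0 < \<xi> \<Longrightarrow> \<xi> \<le> 5 / (4 * real (n + 1)) \<Longrightarrow> \<bar>\<sigma> \<xi> * deriv \<sigma> \<xi>\<bar> \<le> e"
  obtains H where "\<And>\<xi>. (H has_real_derivative \<sigma> \<xi> * deriv \<sigma> \<xi> * lower n \<xi>) (at \<xi>)"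
    "\<And>\<xi>. 0 \<le> \<xi> \<Longrightarrow> \<bar>H \<xi>\<bar> \<le> e"
proof -
  have cont: "continuous_on UNIV (\<lambda>\<xi>. \<sigma> \<xi> * deriv \<sigma> \<xi> * lower n \<xi>)"
    by (rule continuous_mult_support[OF C11_loc_product_continuous[OF C], of _ "1 / (4 * real (n + 1))" "5 / (4 * real (n + 1))"])
      (use lower_support smooth_continuous[OF smooth_lower] in auto)
  obtain H where H: "\<And>\<xi>. (H has_real_derivative \<sigma> \<xi> * deriv \<sigma> \<xi> * lower n \<xi>) (at \<xi>)" "H 0 = 0"
    by (rule continuous_antiderivative[OF cont, where a = 0 and c = 0]) blast
  \<comment> \<open>A primitive of \<open>e * lower n\<close> with values in [0, e]. Monotonicity of
    G - H and G + H then bounds |H| by G.\<close>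
  define G where "G \<xi> = e * step (real (n + 1) * \<xi> - 1 / 4)" for \<xi>
  have G: "(G has_real_derivative e * lower n \<xi>) (at \<xi>)" for \<xi>
    unfolding G_def lower_def using DERIV_cmult[OF step_affine_deriv] by blast
  have e0: "0 \<le> e"
    using e[of "5 / (4 * real (n + 1))"] by (auto intro: order_trans[OF abs_ge_zero])
  have b: "\<bar>\<sigma> \<xi> * deriv \<sigma> \<xi> * lower n \<xi>\<bar> \<le> e * lower n \<xi>" for \<xi>
  proof (cases "lower n \<xi> = 0")
    case False
    have "0 < 1 / (4 * real (n + 1))" by simp
    also have "\<dots> \<le> \<xi>" using lower_support[OF False] by simp
    finally have "\<bar>\<sigma> \<xi> * deriv \<sigma> \<xi>\<bar> \<le> e"
      by (rule e) (use lower_support[OF False] in simp)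
    then show ?thesis using lower_nonneg[of n \<xi>] by (auto simp: abs_mult intro!: mult_right_mono)
  qed simp
  have "\<bar>H \<xi>\<bar> \<le> e" if \<xi>: "0 \<le> \<xi>" for \<xi>
  proof -
    have "G 0 - H 0 \<le> G \<xi> - H \<xi>"
    proof (rule DERIV_nonneg_imp_nondecreasing[OF \<xi>])
      fix x show "\<exists>y. ((\<lambda>x. G x - H x) has_real_derivative y) (at x) \<and> 0 \<le> y"
        using b[of x] by (intro exI[of _ "e * lower n x - \<sigma> x * deriv \<sigma> x * lower n x"] conjI DERIV_diff G H(1)) linarith
    qed
    moreover have "G 0 + H 0 \<le> G \<xi> + H \<xi>"
    proof (rule DERIV_nonneg_imp_nondecreasing[OF \<xi>])
      fix x show "\<exists>y. ((\<lambda>x. G x + H x) has_real_derivative y) (at x) \<and> 0 \<le> y"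
        using b[of x] by (intro exI[of _ "e * lower n x + \<sigma> x * deriv \<sigma> x * lower n x"] conjI DERIV_add G H(1)) linarith
    qed
    moreover have "G 0 = 0" by (simp add: G_def step_0)
    moreover have "G \<xi> \<le> e * 1" unfolding G_def by (intro mult_left_mono step_range e0)
    ultimately show ?thesis using H(2) by linarith
  qed
  then show ?thesis using that H(1) by blast
qed

text \<open>Integration by parts of \<sigma> \<sigma>' against the weight: half of \<sigma>^2 times
  the weight, minus half the integral of \<sigma>^2 times its derivative. That integral runs over
  all values between n + 2 and \<xi>, so S must bound \<sigma>^2 on all of [0, \<xi>]. It is
  constant beyond n + 3 and possibly nonzero there, so the bound is on the half-line \<xi> > n + 2
  and not only on the support of \<open>upper n\<close>.\<close>

lemma upper_primitive:
  assumes C: "C11_loc \<sigma>" and c: "continuous_on {0..} \<sigma>"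
    and K: "\<And>x. deriv step x \<le> K" "\<And>x. \<bar>deriv (deriv step) x\<bar> \<le> K"
  obtains H where "\<And>\<xi>. 0 < \<xi> \<Longrightarrow> (H has_real_derivative \<sigma> \<xi> * deriv \<sigma> \<xi> * upper n \<xi>) (at \<xi>)"
    "\<And>\<xi> S. 0 \<le> \<xi> \<Longrightarrow> (\<And>s. s \<in> {0..\<xi>} \<Longrightarrow> (\<sigma> s)\<^sup>2 \<le> S) \<Longrightarrow> \<bar>H \<xi>\<bar> \<le> (if real (n + 2) < \<xi> then K * S else 0)"
proof -
  define m where "m = real (n + 2)"
  have m: "m > 0" by (simp add: m_def)
  define u' where "u' \<xi> = deriv (deriv step) (\<xi> - m)" for \<xi>
  have u': "(upper n has_real_derivative u' \<xi>) (at \<xi>)" for \<xi>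
  proof -
    have "((\<lambda>\<xi>. \<xi> - m) has_real_derivative 1) (at \<xi>)" by (auto intro!: derivative_eq_intros)
    from DERIV_chain2[OF smooth_real_deriv(2)[OF smooth_deriv_step] this] show ?thesis
      by (simp add: upper_def[abs_def] u'_def m_def)
  qed
  have u'0: "u' \<xi> = 0" if "\<xi> \<notin> {m..m + 1}" for \<xi>
    using that deriv_deriv_step_0[of "\<xi> - m"] by (auto simp: u'_def)
  have cu: "continuous_on UNIV u'"
    unfolding u'_def
    by (intro continuous_on_compose2[OF smooth_continuous[OF smooth_real_deriv(1)[OF smooth_deriv_step], of UNIV]] continuous_intros) auto
  have cont: "continuous_on UNIV (\<lambda>\<xi>. (\<sigma> \<xi>)\<^sup>2 * u' \<xi>)"
    by (rule continuous_mult_support[OF _ cu u'0 m])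
      (auto intro!: continuous_intros continuous_on_subset[OF c])
  obtain E where E: "\<And>\<xi>. (E has_real_derivative (\<sigma> \<xi>)\<^sup>2 * u' \<xi>) (at \<xi>)" "E m = 0"
    by (rule continuous_antiderivative[OF cont, where a = m and c = 0]) blast
  \<comment> \<open>\<open>E\<close> is the primitive of \<sigma>^2 times the derivative of
    \<open>upper n\<close>, normalised to vanish up to m.\<close>
  define H where "H \<xi> = 1 / 2 * ((\<sigma> \<xi>)\<^sup>2 * upper n \<xi> - E \<xi>)" for \<xi>
  have flat: "(E has_real_derivative 0) (at \<xi>)" if "\<xi> < m \<or> m + 1 < \<xi>" for \<xi>
    using E(1)[of \<xi>] u'0[of \<xi>] that by auto
  have cE: "continuous_on T E" for T
    by (rule DERIV_continuous_on) (rule has_field_derivative_at_within[OF E(1)])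
  have E0: "E \<xi> = 0" if "\<xi> \<le> m" for \<xi>
  proof (cases "\<xi> = m")
    case False
    then show ?thesis using DERIV_isconst_end[of \<xi> m E] that E(2) cE flat by auto
  qed (use E in simp)
  have E1: "E \<xi> = E (m + 1)" if "m + 1 \<le> \<xi>" for \<xi>
  proof (cases "\<xi> = m + 1")
    case False
    then show ?thesis using DERIV_isconst_end[of "m + 1" \<xi> E] that cE flat by auto
  qed simp
  have K0: "0 \<le> K" using K(2)[of 0] by linarith
  show ?thesis
  proof (rule that)
    fix \<xi> :: real assume "0 < \<xi>"
    note d = C11_loc_continuous(2)[OF C this]
    show "(H has_real_derivative \<sigma> \<xi> * deriv \<sigma> \<xi> * upper n \<xi>) (at \<xi>)"
      unfolding H_def[abs_def]
      by (rule derivative_eq_intros d u' E refl)+ (simp add: field_simps)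
  next
    fix \<xi> S assume \<xi>: "0 \<le> \<xi>" and S: "\<And>s. s \<in> {0..\<xi>} \<Longrightarrow> (\<sigma> s)\<^sup>2 \<le> S"
    have up: "\<bar>upper n \<xi>\<bar> \<le> K" using K(1) upper_nonneg[of n \<xi>] by (simp add: upper_def)
    show "\<bar>H \<xi>\<bar> \<le> (if real (n + 2) < \<xi> then K * S else 0)"
    proof (cases "m < \<xi>")
      case False
      then have "upper n \<xi> = 0" using upper_support[of n \<xi>] by (auto simp: m_def)
      then show ?thesis using False E0 by (simp add: H_def m_def)
    next
      case True
      have S0: "0 \<le> S" using S[of 0] \<xi> by (auto intro: order_trans[OF zero_le_power2])
      have "norm (E (min \<xi> (m + 1)) - E m) \<le> S * K * norm (min \<xi> (m + 1) - m)"
      proof (rule field_differentiable_bound[of "{m..min \<xi> (m + 1)}" E "\<lambda>\<xi>. (\<sigma> \<xi>)\<^sup>2 * u' \<xi>"])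
        fix s assume s: "s \<in> {m..min \<xi> (m + 1)}"
        show "(E has_real_derivative (\<sigma> s)\<^sup>2 * u' s) (at s within {m..min \<xi> (m + 1)})"
          by (rule has_field_derivative_at_within[OF E(1)])
        have "(\<sigma> s)\<^sup>2 \<le> S" using s m by (intro S) auto
        then show "norm ((\<sigma> s)\<^sup>2 * u' s) \<le> S * K"
          unfolding norm_mult using K(2)[of "s - m"] S0 by (intro mult_mono) (auto simp: u'_def)
      qed (use True in auto)
      also have "\<dots> \<le> S * K * 1" using True S0 K0 by (intro mult_left_mono) auto
      finally have "\<bar>E \<xi>\<bar> \<le> S * K" using E(2) E1[of \<xi>] by (auto simp: min_def split: if_splits)
      moreover have "\<bar>(\<sigma> \<xi>)\<^sup>2 * upper n \<xi>\<bar> \<le> S * K"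
        unfolding abs_mult using up S[of \<xi>] \<xi> S0 by (intro mult_mono) auto
      ultimately have "\<bar>(\<sigma> \<xi>)\<^sup>2 * upper n \<xi> - E \<xi>\<bar> \<le> 2 * (S * K)" by linarith
      then have "\<bar>H \<xi>\<bar> \<le> K * S" unfolding H_def abs_mult by (simp add: mult.commute)
      then show ?thesis using True by (simp add: m_def)
    qed
  qed
qed

text \<open>Merges the two alternatives for \<sigma> \<sigma>' and the divergence of
  \<open>F2\<close> into one bound on the product of the primitive and D, which is what appears
  after integration by parts. S ranges over arbitrary bounds of \<sigma>^2, so that the caller can
  insert the growth condition at a different point.\<close>

lemma noise_primitive:
  fixes f :: "nat \<Rightarrow> real^'d \<Rightarrow> real"
  assumes noise: "noise_assumption M F B f" and str: "structure_assumption f \<Phi> \<sigma> \<nu>"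
  obtains D CD K e where "has_weak_divergence (F2 f) D" "\<And>x. x \<in> torus \<Longrightarrow> \<bar>D x\<bar> \<le> CD" "K > 0"
    "\<And>n. 0 \<le> e n" "e \<longlonglongrightarrow> (0::real)"
    "\<And>n. \<exists>H. (\<forall>\<xi>>0. (H has_real_derivative \<sigma> \<xi> * deriv \<sigma> \<xi> * (lower n \<xi> - upper n \<xi>)) (at \<xi>)) \<and>
      (\<forall>x\<in>torus. \<forall>\<xi>\<ge>0. \<forall>S. (\<forall>s\<in>{0..\<xi>}. (\<sigma> s)\<^sup>2 \<le> S) \<longrightarrow>
        \<bar>H \<xi> * D x\<bar> \<le> e n + (if real (n + 2) < \<xi> then K * S else 0))"
proof -
  have C: "C11_loc \<sigma>" and c: "continuous_on {0..} \<sigma>"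
    using str by (auto simp: structure_assumption_def)
  obtain K where K: "K > 0" "\<And>x. deriv step x \<le> K" "\<And>x. \<bar>deriv (deriv step) x\<bar> \<le> K"
    using deriv_step_bounded by blast
  consider (zero) "has_weak_divergence (F2 f) (\<lambda>x. 0)"
    | (cont) "continuous_on {0..} (\<lambda>\<xi>. \<sigma> \<xi> * deriv \<sigma> \<xi>)" "\<sigma> 0 * deriv \<sigma> 0 = 0"
    using str unfolding structure_assumption_def by blast
  then show ?thesis
  proof cases
    case zero
    \<comment> \<open>With D = 0 the product with D vanishes, so the existence of a primitive
      suffices here.\<close>
    have ex0: "\<exists>H. (\<forall>\<xi>>0. (H has_real_derivative \<sigma> \<xi> * deriv \<sigma> \<xi> * (lower n \<xi> - upper n \<xi>)) (at \<xi>))" for n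
    proof -
      obtain H1 where H1: "\<And>\<xi>. 0 < \<xi> \<Longrightarrow> (H1 has_real_derivative \<sigma> \<xi> * deriv \<sigma> \<xi> * upper n \<xi>) (at \<xi>)"
        by (rule upper_primitive[OF C c K(2,3)]) blast
      have cont: "continuous_on UNIV (\<lambda>\<xi>. \<sigma> \<xi> * deriv \<sigma> \<xi> * lower n \<xi>)"
        by (rule continuous_mult_support[OF C11_loc_product_continuous[OF C], of _ "1 / (4 * real (n + 1))" "5 / (4 * real (n + 1))"])
          (use lower_support smooth_continuous[OF smooth_lower] in auto)
      obtain H2 where H2: "\<And>\<xi>. (H2 has_real_derivative \<sigma> \<xi> * deriv \<sigma> \<xi> * lower n \<xi>) (at \<xi>)"
        by (rule continuous_antiderivative[OF cont, where a = 0 and c = 0]) blast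
      have "((\<lambda>\<xi>. H2 \<xi> - H1 \<xi>) has_real_derivative \<sigma> \<xi> * deriv \<sigma> \<xi> * (lower n \<xi> - upper n \<xi>)) (at \<xi>)" if "0 < \<xi>" for \<xi>
        using DERIV_diff[OF H2 H1[OF that]] by (simp add: right_diff_distrib)
      then show ?thesis by blast
    qed
    have ex: "\<exists>H. (\<forall>\<xi>>0. (H has_real_derivative \<sigma> \<xi> * deriv \<sigma> \<xi> * (lower n \<xi> - upper n \<xi>)) (at \<xi>)) \<and>
      (\<forall>x\<in>torus. \<forall>\<xi>\<ge>0. \<forall>S. (\<forall>s\<in>{0..\<xi>}. (\<sigma> s)\<^sup>2 \<le> S) \<longrightarrow>
        \<bar>H \<xi> * 0\<bar> \<le> 0 + (if real (n + 2) < \<xi> then K * S else 0))" for n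
    proof -
      have "0 \<le> K * S" if "\<forall>s\<in>{0..\<xi>}. (\<sigma> s)\<^sup>2 \<le> S" "0 \<le> \<xi>" for S \<xi> :: real
      proof -
        have "(\<sigma> 0)\<^sup>2 \<le> S" using that by auto
        then have "0 \<le> S" by (rule order_trans[OF zero_le_power2])
        then show ?thesis using K(1) by simp
      qed
      then show ?thesis using ex0[of n] by auto
    qed
    show ?thesis
      by (rule that[of "\<lambda>x. 0" 0 K "\<lambda>n. 0", OF zero _ K(1) _ _ ex]) auto
  next
    case cont
    obtain D where D: "bounded (D ` torus)" "has_weak_divergence (F2 f) D"
      using noise by (auto simp: noise_assumption_def)
    \<comment> \<open>The bound is taken at least 1 so that the resulting constant
      \<open>CD * K\<close> is positive.\<close>
    then obtain CD where CD: "\<And>x. x \<in> torus \<Longrightarrow> \<bar>D x\<bar> \<le> CD" "CD \<ge> 1"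
      unfolding bounded_iff by (metis imageI max.cobounded1 max.coboundedI2 max.commute real_norm_def)
    define b where "b n = 5 / (4 * real (n + 1))" for n
    have "\<exists>\<xi>\<in>{0..b n}. \<forall>\<zeta>\<in>{0..b n}. \<bar>\<sigma> \<zeta> * deriv \<sigma> \<zeta>\<bar> \<le> \<bar>\<sigma> \<xi> * deriv \<sigma> \<xi>\<bar>" for n
      by (rule continuous_attains_sup)
        (auto simp: b_def intro!: continuous_intros continuous_on_subset[OF cont(1)])
    then obtain z where z: "\<And>n. z n \<in> {0..b n}" "\<And>n \<zeta>. \<zeta> \<in> {0..b n} \<Longrightarrow> \<bar>\<sigma> \<zeta> * deriv \<sigma> \<zeta>\<bar> \<le> \<bar>\<sigma> (z n) * deriv \<sigma> (z n)\<bar>"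
      by metis
    \<comment> \<open>The maximum of |\<sigma> \<sigma>'| on an interval containing the part of the
      support of \<open>lower n\<close> near 0. It tends to 0 because the maximisers do and \<sigma>
      \<sigma>' is continuous with value 0 at 0.\<close>
    define e0 where "e0 n = \<bar>\<sigma> (z n) * deriv \<sigma> (z n)\<bar>" for n
    have b0: "b \<longlonglongrightarrow> 0"
    proof -
      have "b = (\<lambda>n. 5 / 4 * inverse (real (Suc n)))"
        by (rule ext) (simp add: b_def inverse_eq_divide)
      moreover have "(\<lambda>n. 5 / 4 * inverse (real (Suc n))) \<longlonglongrightarrow> 5 / 4 * 0"
        by (intro tendsto_intros LIMSEQ_inverse_real_of_nat)
      ultimately show ?thesis by (simp only: mult_zero_right)
    qed
    have z0: "z \<longlonglongrightarrow> 0"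
      by (rule tendsto_sandwich[OF _ _ tendsto_const b0]) (use z(1) in \<open>auto intro!: always_eventually\<close>)
    have "(\<lambda>n. \<sigma> (z n) * deriv \<sigma> (z n)) \<longlonglongrightarrow> \<sigma> 0 * deriv \<sigma> 0"
      by (rule continuous_on_tendsto_compose[OF cont(1) z0]) (use z(1) in auto)
    then have e0: "e0 \<longlonglongrightarrow> 0"
      unfolding e0_def cont(2) by (rule tendsto_rabs_zero)
    have ex: "\<exists>H. (\<forall>\<xi>>0. (H has_real_derivative \<sigma> \<xi> * deriv \<sigma> \<xi> * (lower n \<xi> - upper n \<xi>)) (at \<xi>)) \<and>
      (\<forall>x\<in>torus. \<forall>\<xi>\<ge>0. \<forall>S. (\<forall>s\<in>{0..\<xi>}. (\<sigma> s)\<^sup>2 \<le> S) \<longrightarrow>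
        \<bar>H \<xi> * D x\<bar> \<le> CD * e0 n + (if real (n + 2) < \<xi> then CD * K * S else 0))" for n
    proof -
      obtain H1 where H1: "\<And>\<xi>. 0 < \<xi> \<Longrightarrow> (H1 has_real_derivative \<sigma> \<xi> * deriv \<sigma> \<xi> * upper n \<xi>) (at \<xi>)"
        "\<And>\<xi> S. 0 \<le> \<xi> \<Longrightarrow> (\<And>s. s \<in> {0..\<xi>} \<Longrightarrow> (\<sigma> s)\<^sup>2 \<le> S) \<Longrightarrow> \<bar>H1 \<xi>\<bar> \<le> (if real (n + 2) < \<xi> then K * S else 0)"
        by (rule upper_primitive[OF C c K(2,3)]) blast
      obtain H2 where H2: "\<And>\<xi>. (H2 has_real_derivative \<sigma> \<xi> * deriv \<sigma> \<xi> * lower n \<xi>) (at \<xi>)" "\<And>\<xi>. 0 \<le> \<xi> \<Longrightarrow> \<bar>H2 \<xi>\<bar> \<le> e0 n"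
        by (rule lower_primitive[OF C, of n "e0 n"]) (use z(2)[of _ n] in \<open>auto simp: b_def e0_def\<close>)
      show ?thesis
      proof (intro exI[of _ "\<lambda>\<xi>. H2 \<xi> - H1 \<xi>"] conjI allI impI ballI)
        fix \<xi> :: real assume "0 < \<xi>"
        then show "((\<lambda>\<xi>. H2 \<xi> - H1 \<xi>) has_real_derivative \<sigma> \<xi> * deriv \<sigma> \<xi> * (lower n \<xi> - upper n \<xi>)) (at \<xi>)"
          using DERIV_diff[OF H2(1) H1(1)] by (simp add: right_diff_distrib)
      next
        fix x :: "real^'d" and \<xi> S assume x: "x \<in> torus" and \<xi>: "0 \<le> \<xi>" and S: "\<forall>s\<in>{0..\<xi>}. (\<sigma> s)\<^sup>2 \<le> S"
        have "\<bar>(H2 \<xi> - H1 \<xi>) * D x\<bar> \<le> (e0 n + (if real (n + 2) < \<xi> then K * S else 0)) * CD"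
          unfolding abs_mult
          using H2(2)[OF \<xi>] H1(2)[OF \<xi>, of S] S CD(1)[OF x] by (intro mult_mono) auto
        also have "\<dots> = CD * e0 n + (if real (n + 2) < \<xi> then CD * K * S else 0)"
          by (simp add: algebra_simps)
        finally show "\<bar>(H2 \<xi> - H1 \<xi>) * D x\<bar> \<le> CD * e0 n + (if real (n + 2) < \<xi> then CD * K * S else 0)" .
      qed
    qed
    show ?thesis
      by (rule that[of D CD "CD * K" "\<lambda>n. CD * e0 n", OF D(2) CD(1) _ _ _ ex])
        (use CD(2) K(1) tendsto_mult_right_zero[OF e0, of CD] in \<open>auto simp: e0_def\<close>)
  qed
qed

section \<open>The kinetic equation along a path\<close>

lemma space_time_measure [simp]: "space (time_measure T) = {0..T}"
  by (simp add: time_measure_def space_restrict_space)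

interpretation time: finite_measure "time_measure T" for T
proof
  show "emeasure (time_measure T) (space (time_measure T)) \<noteq> \<infinity>"
    by (simp add: time_measure_def emeasure_restrict_space space_restrict_space emeasure_lborel_Icc_eq)
qed

interpretation Q: pair_sigma_finite "time_measure T" "torus_measure :: (real^'d) measure" for T ..

interpretation Q: finite_measure "time_measure T \<Otimes>\<^sub>M (torus_measure :: (real^'d) measure)" for T
  by (intro finite_measure_pair_measure time.finite_measure_axioms torus.finite_measure_axioms)

definition truncate :: "nat \<Rightarrow> real \<Rightarrow> real" where
  "truncate K y = max (min y (real K)) (1 / real K)"

lemma truncate_range: "K \<ge> 1 \<Longrightarrow> truncate K y \<in> {1 / real K..real K}"
  by (auto simp: truncate_def divide_le_eq mult_ge1_I le_max_iff_disj)

text \<open>Since h vanishes outside (1/K, K), the function r and its formal gradient may be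
  replaced by the truncation and its genuine weak gradient, to which the chain rule applies at
  almost every time. The primitive H need not vanish off that interval, so on the right it is
  evaluated at the truncation, which has values in a compact interval.\<close>

lemma weak_chain_rule_time:
  fixes r :: "real \<Rightarrow> real^'d \<Rightarrow> real" and Dr :: "real \<Rightarrow> real^'d \<Rightarrow> real^'d" and K :: nat
  defines "\<D> \<equiv> \<lambda>t x. if 1 / real K < r t x \<and> r t x < real K then Dr t x else 0"
  assumes r: "(\<lambda>(t, x). r t x) \<in> borel_measurable (time_measure T \<Otimes>\<^sub>M torus_measure)"
    and Dr: "(\<lambda>(t, x). Dr t x) \<in> borel_measurable (time_measure T \<Otimes>\<^sub>M torus_measure)"
    and K: "K \<ge> 1"
    and L2: "integrable (time_measure T \<Otimes>\<^sub>M torus_measure) (\<lambda>(t, x). (norm (\<D> t x))\<^sup>2)"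
    and wg: "AE t in time_measure T. has_weak_gradient (\<lambda>x. truncate K (r t x)) (\<D> t)"
    and h: "continuous_on UNIV h" "\<And>\<xi>. \<xi> \<notin> {1 / real K<..<real K} \<Longrightarrow> h \<xi> = 0"
    and H: "\<And>\<xi>. 0 < \<xi> \<Longrightarrow> (H has_real_derivative h \<xi>) (at \<xi>)"
    and div: "has_weak_divergence V D" and V: "\<And>x. x \<in> torus \<Longrightarrow> norm (V x) \<le> C"
    and D: "\<And>x. x \<in> torus \<Longrightarrow> \<bar>D x\<bar> \<le> CD"
  shows "integrable (time_measure T \<Otimes>\<^sub>M torus_measure) (\<lambda>(t, x). h (r t x) * (Dr t x \<bullet> V x))"
    and "(\<integral>(t, x). h (r t x) * (Dr t x \<bullet> V x) \<partial>(time_measure T \<Otimes>\<^sub>M torus_measure)) =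
      - (\<integral>(t, x). H (truncate K (r t x)) * D x \<partial>(time_measure T \<Otimes>\<^sub>M torus_measure))"
proof -
  let ?Q = "time_measure T \<Otimes>\<^sub>M (torus_measure :: (real^'d) measure)"
  have Kp: "0 < 1 / real K" using K by simp
  have [measurable]: "V \<in> borel_measurable torus_measure" "D \<in> borel_measurable torus_measure"
    using div by (auto simp: has_weak_divergence_def)
  have [measurable]: "h \<in> borel_measurable borel" by (intro borel_measurable_continuous_onI h)
  note [measurable] = r Dr
  have cH: "continuous_on {0<..} H"
    by (rule DERIV_continuous_on) (rule has_field_derivative_at_within[OF H], simp)
  \<comment> \<open>H is controlled on (0, inf) only. The inner maximum keeps the argument positive,
    and it is exactly the lower truncation.\<close>
  have "continuous_on UNIV (\<lambda>y. H (max y (1 / real K)))"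
    by (rule continuous_on_compose2[OF cH]) (use Kp in \<open>auto intro!: continuous_intros simp: less_max_iff_disj\<close>)
  then have [measurable]: "(\<lambda>y. H (max y (1 / real K))) \<in> borel_measurable borel"
    by (rule borel_measurable_continuous_onI)
  have mH: "(\<lambda>(t, x). H (truncate K (r t x)) * D x) \<in> borel_measurable ?Q"
    unfolding truncate_def by measurable
  \<comment> \<open>Where r is not truncated the two sides coincide; elsewhere h and the truncated
    gradient both vanish.\<close>
  have eq: "h (r t x) * (Dr t x \<bullet> V x) = h (truncate K (r t x)) * (\<D> t x \<bullet> V x)" for t x
  proof (cases "1 / real K < r t x \<and> r t x < real K")
    case True
    then show ?thesis by (simp add: \<D>_def truncate_def)
  next
    case False
    then have "h (r t x) = 0" by (intro h(2)) auto
    then show ?thesis using False by (auto simp: \<D>_def)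
  qed
  have \<D>m [measurable]: "(\<lambda>(t, x). \<D> t x) \<in> borel_measurable ?Q"
    unfolding \<D>_def by measurable
  obtain Ch where Ch: "Ch > 0" "\<And>x. \<bar>h x\<bar> \<le> Ch"
    by (rule bounded_compact_support[of "1 / real K" "real K" h]) (use h in \<open>auto intro: continuous_on_subset\<close>)
  have "(0 :: real^'d) \<in> torus" by (simp add: torus_def)
  from order_trans[OF norm_ge_zero V[OF this]] have C0: "0 \<le> C" .
  \<comment> \<open>The gradient is square integrable and the measure is finite; norm \<le> 1 +
    norm^2 passes to a majorant in mean.\<close>
  show int: "integrable ?Q (\<lambda>(t, x). h (r t x) * (Dr t x \<bullet> V x))"
  proof (rule Bochner_Integration.integrable_bound[of _ "\<lambda>z. Ch * C * (1 + (case z of (t, x) \<Rightarrow> (norm (\<D> t x))\<^sup>2))"])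
    show "AE z in ?Q. norm (case z of (t, x) \<Rightarrow> h (r t x) * (Dr t x \<bullet> V x)) \<le> norm (Ch * C * (1 + (case z of (t, x) \<Rightarrow> (norm (\<D> t x))\<^sup>2)))"
    proof (rule AE_I2, clarify)
      fix t and x :: "real^'d" assume "(t, x) \<in> space ?Q"
      then have x: "x \<in> torus" by (simp add: space_pair_measure)
      have "\<bar>\<D> t x \<bullet> V x\<bar> \<le> norm (\<D> t x) * norm (V x)" by (rule Cauchy_Schwarz_ineq2)
      also have "\<dots> \<le> norm (\<D> t x) * C" by (intro mult_left_mono V x) auto
      also have "\<dots> \<le> (1 + (norm (\<D> t x))\<^sup>2) * C"
      proof (rule mult_right_mono[OF _ C0])
        have "0 \<le> (norm (\<D> t x) - 1)\<^sup>2 + norm (\<D> t x)" by simp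
        then show "norm (\<D> t x) \<le> 1 + (norm (\<D> t x))\<^sup>2" by (simp add: power2_eq_square algebra_simps)
      qed
      finally have "\<bar>h (truncate K (r t x))\<bar> * \<bar>\<D> t x \<bullet> V x\<bar> \<le> Ch * ((1 + (norm (\<D> t x))\<^sup>2) * C)"
        using Ch by (intro mult_mono) (auto intro: less_imp_le)
      then show "norm (h (r t x) * (Dr t x \<bullet> V x)) \<le> norm (Ch * C * (1 + (norm (\<D> t x))\<^sup>2))"
        unfolding eq using Ch C0 by (simp add: abs_mult mult_ac)
    qed
    show "integrable ?Q (\<lambda>z. Ch * C * (1 + (case z of (t, x) \<Rightarrow> (norm (\<D> t x))\<^sup>2)))"
      by (intro integrable_mult_right Bochner_Integration.integrable_add L2) simp
  qed measurable
  have "bounded (H ` {1 / real K..real K})"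
    by (intro compact_imp_bounded compact_continuous_image compact_Icc continuous_on_subset[OF cH]) (use less_le_trans[OF Kp] in auto)
  then obtain CH where CH: "\<forall>y\<in>{1 / real K..real K}. \<bar>H y\<bar> \<le> CH"
    unfolding bounded_iff by auto
  have intH: "integrable ?Q (\<lambda>(t, x). H (truncate K (r t x)) * D x)"
  proof (rule Q.integrable_const_bound[OF AE_I2 mH], clarify)
    fix t and x :: "real^'d" assume "(t, x) \<in> space ?Q"
    then have x: "x \<in> torus" by (simp add: space_pair_measure)
    have H1: "\<bar>H (truncate K (r t x))\<bar> \<le> CH" using CH truncate_range[OF K] by blast
    show "norm (H (truncate K (r t x)) * D x) \<le> CH * CD"
      unfolding norm_mult using H1 D[OF x] by (intro mult_mono) auto
  qed
  have "(\<integral>(t, x). h (r t x) * (Dr t x \<bullet> V x) \<partial>?Q) = (\<integral>t. (\<integral>x. h (r t x) * (Dr t x \<bullet> V x) \<partial>torus_measure) \<partial>time_measure T)"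
    using Q.integral_fst'[OF int] by simp
  also have "\<dots> = (\<integral>t. - (\<integral>x. H (truncate K (r t x)) * D x \<partial>torus_measure) \<partial>time_measure T)"
  proof (rule integral_cong_AE)
    show "(\<lambda>t. \<integral>x. h (r t x) * (Dr t x \<bullet> V x) \<partial>torus_measure) \<in> borel_measurable (time_measure T)"
      by measurable
    show "(\<lambda>t. - (\<integral>x. H (truncate K (r t x)) * D x \<partial>torus_measure)) \<in> borel_measurable (time_measure T)"
      using mH by measurable
    show "AE t in time_measure T. (\<integral>x. h (r t x) * (Dr t x \<bullet> V x) \<partial>torus_measure) = - (\<integral>x. H (truncate K (r t x)) * D x \<partial>torus_measure)"
      using wg
    proof eventually_elim
      case (elim t)
      show ?case
        unfolding eq
      proof (rule weak_chain_rule(2)[OF div V elim truncate_range[OF K]])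
        fix y assume "y \<in> {1 / real K..real K}"
        then have "0 < y" using less_le_trans[OF Kp] by auto
        then show "(H has_real_derivative h y) (at y within {1 / real K..real K})"
          by (rule has_field_derivative_at_within[OF H])
      qed (use h in \<open>auto intro: continuous_on_subset\<close>)
    qed
  qed
  also have "\<dots> = - (\<integral>(t, x). H (truncate K (r t x)) * D x \<partial>?Q)"
    using Q.integral_fst'[OF intH] by simp
  finally show "(\<integral>(t, x). h (r t x) * (Dr t x \<bullet> V x) \<partial>?Q) = - (\<integral>(t, x). H (truncate K (r t x)) * D x \<partial>?Q)" .
qed

lemma structure_sup:
  assumes "structure_assumption f \<Phi> \<sigma> \<nu>"
  obtains c where "c \<ge> 1" "\<And>\<xi> s. 0 \<le> \<xi> \<Longrightarrow> s \<in> {0..\<xi>} \<Longrightarrow> (\<sigma> s)\<^sup>2 \<le> c * (1 + \<xi> + (\<sigma> \<xi>)\<^sup>2)"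
proof -
  obtain c where c: "c \<ge> 1" "\<And>\<xi>. 0 \<le> \<xi> \<Longrightarrow> (SUP s\<in>{0..\<xi>}. (\<sigma> s)\<^sup>2) \<le> c * (1 + \<xi> + (\<sigma> \<xi>)\<^sup>2)"
    using assms unfolding structure_assumption_def by blast
  have cont: "continuous_on {0..} \<sigma>" using assms by (simp add: structure_assumption_def)
  have "(\<sigma> s)\<^sup>2 \<le> c * (1 + \<xi> + (\<sigma> \<xi>)\<^sup>2)" if "0 \<le> \<xi>" "s \<in> {0..\<xi>}" for \<xi> s
  proof -
    have "bounded ((\<lambda>s. (\<sigma> s)\<^sup>2) ` {0..\<xi>})"
      by (intro compact_imp_bounded compact_continuous_image compact_Icc continuous_intros continuous_on_subset[OF cont]) auto
    \<comment> \<open>A real supremum dominates its elements only for sets bounded above, which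
      continuity on the compact interval guarantees.\<close>
    then have "bdd_above ((\<lambda>s. (\<sigma> s)\<^sup>2) ` {0..\<xi>})" by (rule bounded_imp_bdd_above)
    from cSUP_upper[OF that(2) this] c(2)[OF that(1)] show ?thesis by linarith
  qed
  with c(1) show ?thesis by (rule that)
qed

section \<open>Integrals against the kinetic measure and mass balance\<close>

lemma kinetic_box_sets:
  fixes p :: "((real^'d) \<times> real \<times> real) measure"
  assumes sets: "sets p = sets (restrict_space borel (torus \<times> {0<..} \<times> {0..T}))" and a: "0 < a"
  shows "torus \<times> {a..b} \<times> {0..T} \<in> sets p"
proof -
  have "(torus :: (real^'d) set) \<times> {a..b} \<times> {0..T} \<in> sets borel"
    "torus \<times> {0<..} \<times> {0..T} \<in> sets (borel :: ((real^'d) \<times> real \<times> real) measure)"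
    by (intro borel_Times; auto)+
  then show ?thesis unfolding sets using a by (subst sets_restrict_space_iff) auto
qed

lemma kinetic_integrable:
  fixes p :: "((real^'d) \<times> real \<times> real) measure"
  assumes sets: "sets p = sets (restrict_space borel (torus \<times> {0<..} \<times> {0..T}))"
    and fin: "emeasure p (torus \<times> {a..b} \<times> {0..T}) < \<infinity>" and a: "0 < a"
    and h: "continuous_on UNIV h" "\<And>\<xi>. \<xi> \<notin> {a..b} \<Longrightarrow> h \<xi> = 0"
  shows "integrable p (\<lambda>(x, \<xi>, s). h \<xi> :: real)"
proof -
  have sp: "space p = torus \<times> {0<..} \<times> {0..T}"
    using sets_eq_imp_space_eq[OF sets] by (simp add: space_restrict_space)
  have [measurable]: "h \<in> borel_measurable borel" by (intro borel_measurable_continuous_onI h)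
  note B = kinetic_box_sets[OF sets a]
  obtain C where C: "\<And>x. \<bar>h x\<bar> \<le> C"
    by (rule bounded_compact_support[of a b h]) (use h in \<open>auto intro: continuous_on_subset\<close>)
  have m: "(\<lambda>(x, \<xi>, s). h \<xi>) \<in> borel_measurable p"
  proof -
    have "(\<lambda>(x :: real^'d, \<xi>, s :: real). h \<xi>) \<in> borel_measurable borel"
      unfolding borel_prod[symmetric] by measurable
    then have "(\<lambda>(x :: real^'d, \<xi>, s :: real). h \<xi>) \<in> borel_measurable (restrict_space borel (torus \<times> {0<..} \<times> {0..T}))"
      by (rule measurable_restrict_space1)
    then show ?thesis by (simp add: measurable_cong_sets[OF sets refl])
  qed
  show ?thesis
  proof (rule Bochner_Integration.integrable_bound[OF _ m])
    show "integrable p (\<lambda>z. C * indicator (torus \<times> {a..b} \<times> {0..T}) z)"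
      by (intro integrable_mult_right integrable_real_indicator B fin)
    show "AE z in p. norm (case z of (x, \<xi>, s) \<Rightarrow> h \<xi>) \<le> norm (C * indicator (torus \<times> {a..b} \<times> {0..T}) z)"
      by (rule AE_I2) (use C h(2) sp in \<open>force simp: indicator_def intro: order_trans[OF _ abs_ge_self]\<close>)
  qed
qed

lemma kinetic_integrable_lower:
  fixes p :: "((real^'d) \<times> real \<times> real) measure"
  assumes sets: "sets p = sets (restrict_space borel (torus \<times> {0<..} \<times> {0..T}))"
    and fin: "\<And>a b. 0 < a \<Longrightarrow> a \<le> b \<Longrightarrow> emeasure p (torus \<times> {a..b} \<times> {0..T}) < \<infinity>"
  shows "integrable p (\<lambda>(x, \<xi>, s). lower n \<xi>)"
proof (rule kinetic_integrable[OF sets fin, of "1 / (4 * real (n + 1))" "5 / (4 * real (n + 1))"])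
  show "lower n \<xi> = 0" if "\<xi> \<notin> {1 / (4 * real (n + 1))..5 / (4 * real (n + 1))}" for \<xi>
    using lower_support[of n \<xi>] that by blast
qed (auto intro: smooth_continuous smooth_lower divide_right_mono)

lemma kinetic_integrable_upper:
  fixes p :: "((real^'d) \<times> real \<times> real) measure"
  assumes sets: "sets p = sets (restrict_space borel (torus \<times> {0<..} \<times> {0..T}))"
    and fin: "\<And>a b. 0 < a \<Longrightarrow> a \<le> b \<Longrightarrow> emeasure p (torus \<times> {a..b} \<times> {0..T}) < \<infinity>"
  shows "integrable p (\<lambda>(x, \<xi>, s). upper n \<xi>)"
proof (rule kinetic_integrable[OF sets fin, of "real (n + 2)" "real (n + 3)"])
  show "upper n \<xi> = 0" if "\<xi> \<notin> {real (n + 2)..real (n + 3)}" for \<xi>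
    using upper_support[of n \<xi>] that by fastforce
qed (auto intro: smooth_continuous smooth_upper)

text \<open>The layer-cake formula. For negative values both sides are zero, as
  \<open>ennreal\<close> sends negative reals to 0.\<close>

lemma kinetic_function_integral:
  assumes m [measurable]: "\<rho> \<in> borel_measurable torus_measure"
  shows "(\<integral>\<^sup>+(x, \<xi>). ennreal (kinetic_function (\<rho> x) \<xi>) \<partial>(torus_measure \<Otimes>\<^sub>M lborel)) = (\<integral>\<^sup>+x. ennreal (\<rho> x) \<partial>torus_measure)"
proof -
  have "(\<integral>\<^sup>+\<xi>. ennreal (kinetic_function y \<xi>) \<partial>lborel) = ennreal y" for y
  proof -
    have "(\<integral>\<^sup>+\<xi>. ennreal (kinetic_function y \<xi>) \<partial>lborel) = (\<integral>\<^sup>+\<xi>. indicator {0<..<y} \<xi> \<partial>lborel)"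
      by (intro nn_integral_cong) (auto simp: kinetic_function_def)
    then show ?thesis by (cases "0 \<le> y") (auto simp: ennreal_neg)
  qed
  moreover have "(\<lambda>(x, \<xi>). ennreal (kinetic_function (\<rho> x) \<xi>)) \<in> borel_measurable (torus_measure \<Otimes>\<^sub>M lborel)"
    unfolding kinetic_function_def by measurable
  ultimately show ?thesis by (subst lborel.nn_integral_fst[symmetric]) auto
qed

text \<open>Because the masses agree, the difference of the integrals against c equals the integral
  of the opposite difference of kinetic functions against 1 - c. Only the region where the cutoff is
  not yet 1 counts.\<close>

lemma mass_difference_bound:
  assumes i: "integrable torus_measure \<rho>1" "integrable torus_measure \<rho>2"
    and nn: "\<And>x. x \<in> torus \<Longrightarrow> 0 \<le> \<rho>1 x" "\<And>x. x \<in> torus \<Longrightarrow> 0 \<le> \<rho>2 x"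
    and eq: "(\<integral>x. \<bar>\<rho>1 x\<bar> \<partial>torus_measure) = (\<integral>x. \<bar>\<rho>2 x\<bar> \<partial>torus_measure)"
    and c: "c \<in> borel_measurable borel" "\<And>\<xi>. 0 \<le> c \<xi>" "\<And>\<xi>. c \<xi> \<le> 1"
  shows "ennreal \<bar>(\<integral>(x, \<xi>). kinetic_function (\<rho>1 x) \<xi> * c \<xi> \<partial>(torus_measure \<Otimes>\<^sub>M lborel)) -
      (\<integral>(x, \<xi>). kinetic_function (\<rho>2 x) \<xi> * c \<xi> \<partial>(torus_measure \<Otimes>\<^sub>M lborel))\<bar>
    \<le> (\<integral>\<^sup>+(x, \<xi>). ennreal ((kinetic_function (\<rho>1 x) \<xi> + kinetic_function (\<rho>2 x) \<xi>) * (1 - c \<xi>)) \<partial>(torus_measure \<Otimes>\<^sub>M lborel))"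
proof -
  let ?N = "torus_measure \<Otimes>\<^sub>M (lborel :: real measure)"
  note [measurable] = c(1)
  have *: "integrable ?N (\<lambda>(x, \<xi>). kinetic_function (\<rho> x) \<xi>) \<and>
      integrable ?N (\<lambda>(x, \<xi>). kinetic_function (\<rho> x) \<xi> * c \<xi>) \<and>
      (\<integral>(x, \<xi>). kinetic_function (\<rho> x) \<xi> \<partial>?N) = (\<integral>x. \<bar>\<rho> x\<bar> \<partial>torus_measure)"
    if i: "integrable torus_measure \<rho>" and nn: "\<And>x. x \<in> torus \<Longrightarrow> 0 \<le> \<rho> x" for \<rho>
  proof -
    have [measurable]: "\<rho> \<in> borel_measurable torus_measure" using i by auto
    have m [measurable]: "(\<lambda>(x, \<xi>). kinetic_function (\<rho> x) \<xi>) \<in> borel_measurable ?N"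
      unfolding kinetic_function_def by measurable
    have k: "0 \<le> kinetic_function y \<xi>" for y \<xi> by (simp add: kinetic_function_def)
    have n: "(\<integral>\<^sup>+z. ennreal (case z of (x, \<xi>) \<Rightarrow> kinetic_function (\<rho> x) \<xi>) \<partial>?N) = ennreal (\<integral>x. \<bar>\<rho> x\<bar> \<partial>torus_measure)"
    proof -
      have "(\<integral>\<^sup>+z. ennreal (case z of (x, \<xi>) \<Rightarrow> kinetic_function (\<rho> x) \<xi>) \<partial>?N) = (\<integral>\<^sup>+x. ennreal (\<rho> x) \<partial>torus_measure)"
        using kinetic_function_integral[of \<rho>] by (simp add: case_prod_unfold)
      also have "\<dots> = (\<integral>\<^sup>+x. ennreal \<bar>\<rho> x\<bar> \<partial>torus_measure)"
        by (intro nn_integral_cong) (use nn in auto)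
      also have "\<dots> = ennreal (\<integral>x. \<bar>\<rho> x\<bar> \<partial>torus_measure)"
        using i by (intro nn_integral_eq_integral) auto
      finally show ?thesis .
    qed
    have 1: "integrable ?N (\<lambda>(x, \<xi>). kinetic_function (\<rho> x) \<xi>)"
      by (rule integrableI_nn_integral_finite[OF m _ n]) (auto simp: k)
    have 2: "integrable ?N (\<lambda>(x, \<xi>). kinetic_function (\<rho> x) \<xi> * c \<xi>)"
    proof (rule Bochner_Integration.integrable_bound[OF 1])
      show "AE z in ?N. norm (case z of (x, \<xi>) \<Rightarrow> kinetic_function (\<rho> x) \<xi> * c \<xi>) \<le> norm (case z of (x, \<xi>) \<Rightarrow> kinetic_function (\<rho> x) \<xi>)"
        using c by (intro AE_I2) (auto simp: kinetic_function_def)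
    qed measurable
    have "(\<integral>z. (case z of (x, \<xi>) \<Rightarrow> kinetic_function (\<rho> x) \<xi>) \<partial>?N) = (\<integral>x. \<bar>\<rho> x\<bar> \<partial>torus_measure)"
    proof -
      have "(\<integral>z. (case z of (x, \<xi>) \<Rightarrow> kinetic_function (\<rho> x) \<xi>) \<partial>?N) =
        enn2real (\<integral>\<^sup>+z. ennreal (case z of (x, \<xi>) \<Rightarrow> kinetic_function (\<rho> x) \<xi>) \<partial>?N)"
        by (rule integral_eq_nn_integral) (auto simp: k)
      then show ?thesis unfolding n by simp
    qed
    with 1 2 show ?thesis by simp
  qed
  note 1 = *[OF i(1) nn(1)] and 2 = *[OF i(2) nn(2)]
  let ?d = "\<lambda>z. case z of (x, \<xi>) \<Rightarrow> (kinetic_function (\<rho>2 x) \<xi> - kinetic_function (\<rho>1 x) \<xi>) * (1 - c \<xi>)"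
  have deq: "?d = (\<lambda>z. ((case z of (x, \<xi>) \<Rightarrow> kinetic_function (\<rho>2 x) \<xi>) - (case z of (x, \<xi>) \<Rightarrow> kinetic_function (\<rho>2 x) \<xi> * c \<xi>))
      - ((case z of (x, \<xi>) \<Rightarrow> kinetic_function (\<rho>1 x) \<xi>) - (case z of (x, \<xi>) \<Rightarrow> kinetic_function (\<rho>1 x) \<xi> * c \<xi>)))"
    by (auto simp: fun_eq_iff algebra_simps)
  have d: "integrable ?N ?d" "(\<integral>z. ?d z \<partial>?N) = (\<integral>(x, \<xi>). kinetic_function (\<rho>1 x) \<xi> * c \<xi> \<partial>?N) -
      (\<integral>(x, \<xi>). kinetic_function (\<rho>2 x) \<xi> * c \<xi> \<partial>?N)"
    unfolding deq using 1 2 eq unfolding case_prod_unfold by simp_all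
  have "ennreal \<bar>\<integral>z. ?d z \<partial>?N\<bar> \<le> (\<integral>\<^sup>+z. ennreal \<bar>?d z\<bar> \<partial>?N)"
    using integral_norm_bound_ennreal[OF d(1)] by simp
  also have "\<dots> \<le> (\<integral>\<^sup>+(x, \<xi>). ennreal ((kinetic_function (\<rho>1 x) \<xi> + kinetic_function (\<rho>2 x) \<xi>) * (1 - c \<xi>)) \<partial>?N)"
  proof (intro nn_integral_mono, clarify)
    fix x \<xi>
    have "\<bar>(kinetic_function (\<rho>2 x) \<xi> - kinetic_function (\<rho>1 x) \<xi>) * (1 - c \<xi>)\<bar> \<le>
      (kinetic_function (\<rho>1 x) \<xi> + kinetic_function (\<rho>2 x) \<xi>) * (1 - c \<xi>)"
      using c(3)[of \<xi>] unfolding abs_mult by (intro mult_mono) (auto simp: kinetic_function_def)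
    then show "ennreal \<bar>(kinetic_function (\<rho>2 x) \<xi> - kinetic_function (\<rho>1 x) \<xi>) * (1 - c \<xi>)\<bar> \<le>
      ennreal ((kinetic_function (\<rho>1 x) \<xi> + kinetic_function (\<rho>2 x) \<xi>) * (1 - c \<xi>))" by (rule ennreal_leI)
  qed
  finally show ?thesis unfolding d(2) .
qed

text \<open>4 n + 5 is the first integer above 4 (n + 1), the reciprocal of the left end of the
  supports of \<open>lower n\<close> and \<open>cutoff n\<close>.\<close>

lemma cut_range_aux: "1 / real (4 * n + 5) < 1 / (4 * real (n + 1))" "real (n + 3) < real (4 * n + 5)"
  "5 / (4 * real (n + 1)) < real (4 * n + 5)" "1 / real (4 * n + 5) < real (n + 2)"
proof -
  show "1 / real (4 * n + 5) < 1 / (4 * real (n + 1))" by (intro divide_strict_left_mono) auto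
  show "real (n + 3) < real (4 * n + 5)" by simp
  have "5 / (4 * real (n + 1)) \<le> 5 / 4" by (intro divide_left_mono) auto
  also have "\<dots> < real (4 * n + 5)" by simp
  finally show "5 / (4 * real (n + 1)) < real (4 * n + 5)" .
  have "1 / real (4 * n + 5) \<le> 1" by simp
  also have "1 < real (n + 2)" by simp
  finally show "1 / real (4 * n + 5) < real (n + 2)" .
qed

lemma cut_ranges:
  assumes "\<xi> \<notin> {1 / real (4 * n + 5)<..<real (4 * n + 5)}"
  shows "lower n \<xi> = 0" "upper n \<xi> = 0" "cutoff n \<xi> = 0"
proof -
  note aux = cut_range_aux[of n]
  show "lower n \<xi> = 0"
    by (rule ccontr) (drule lower_support, use assms aux in \<open>unfold atLeastAtMost_iff greaterThanLessThan_iff, linarith\<close>)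
  show "upper n \<xi> = 0"
    by (rule ccontr) (drule upper_support, use assms aux in \<open>unfold greaterThanLessThan_iff, linarith\<close>)
  show "cutoff n \<xi> = 0"
    by (rule ccontr) (drule cutoff_support, use assms aux in \<open>unfold atLeastAtMost_iff greaterThanLessThan_iff, linarith\<close>)
qed

text \<open>Holds without integrability, because the Bochner integral of a non-integrable function
  is 0.\<close>

lemma abs_integral_le: "ennreal \<bar>\<integral>x. f x \<partial>M\<bar> \<le> (\<integral>\<^sup>+x. ennreal \<bar>f x\<bar> \<partial>M)"
  using integral_norm_bound_ennreal[of M f] by (cases "integrable M f") (auto simp: not_integrable_integral_eq)

text \<open>The truncation level \<open>4 n + 5\<close> is large enough for the supports of \<^const>\<open>lower\<close>, \<^const>\<open>upper\<close> and
  \<^const>\<open>cutoff\<close> to lie strictly between \<open>1 / (4 n + 5)\<close> and \<open>4 n + 5\<close>.\<close>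

locale truncated_path =
  fixes T :: real and r :: "real \<Rightarrow> real^'d \<Rightarrow> real" and Dr :: "real \<Rightarrow> real^'d \<Rightarrow> real^'d" and n :: nat
  assumes r: "(\<lambda>(t, x). r t x) \<in> borel_measurable (time_measure T \<Otimes>\<^sub>M torus_measure)"
    and Dr: "(\<lambda>(t, x). Dr t x) \<in> borel_measurable (time_measure T \<Otimes>\<^sub>M torus_measure)"
    and L2: "integrable (time_measure T \<Otimes>\<^sub>M torus_measure) (\<lambda>(t, x). (norm
      (if 1 / real (4 * n + 5) < r t x \<and> r t x < real (4 * n + 5) then Dr t x else 0))\<^sup>2)"
    and wg: "AE t in time_measure T. has_weak_gradient (\<lambda>x. truncate (4 * n + 5) (r t x))
      (\<lambda>x. if 1 / real (4 * n + 5) < r t x \<and> r t x < real (4 * n + 5) then Dr t x else 0)"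
    and r_nonneg: "\<And>t x. t \<in> {0..T} \<Longrightarrow> x \<in> torus \<Longrightarrow> 0 \<le> r t x"
begin

abbreviation "Q \<equiv> time_measure T \<Otimes>\<^sub>M (torus_measure :: (real^'d) measure)"

text \<open>Each component of the weighted derivative of \<nu> has a primitive; tested against the
  constant coordinate field, whose divergence is zero, the chain rule makes each component integral
  vanish.\<close>

lemma transport_term:
  assumes str: "structure_assumption f \<Phi> \<sigma> \<nu>"
  shows "(\<integral>(s, x). cutoff n (r s x) * (vector_derivative \<nu> (at (r s x)) \<bullet> Dr s x) \<partial>Q) = 0"
proof -
  define h where "h i \<xi> = vector_derivative \<nu> (at \<xi>) $ i * cutoff n \<xi>" for i \<xi>
  have \<nu>: "continuous_on {0<..} (\<lambda>\<xi>. vector_derivative \<nu> (at \<xi>))"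
    using str by (simp add: structure_assumption_def)
  have i: "integrable Q (\<lambda>(s, x). h i (r s x) * (Dr s x \<bullet> axis i 1)) \<and>
    (\<integral>(s, x). h i (r s x) * (Dr s x \<bullet> axis i 1) \<partial>Q) = 0" for i
  proof -
    have h: "continuous_on UNIV (h i)"
      unfolding h_def
    proof (rule continuous_mult_support)
      show "continuous_on {0<..} (\<lambda>\<xi>. vector_derivative \<nu> (at \<xi>) $ i)"
        by (intro continuous_intros \<nu>)
      show "cutoff n \<xi> = 0" if "\<xi> \<notin> {1 / (4 * real (n + 1))..real (n + 3)}" for \<xi>
        using cutoff_support[of n \<xi>] that by blast
    qed (auto intro: smooth_continuous smooth_cutoff)
    have h0: "h i \<xi> = 0" if "\<xi> \<notin> {1 / real (4 * n + 5)<..<real (4 * n + 5)}" for \<xi>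
      using cut_ranges(3)[OF that] by (simp add: h_def)
    obtain H where H: "\<And>\<xi>. (H has_real_derivative h i \<xi>) (at \<xi>)"
      by (rule continuous_antiderivative[OF h, where a = 0 and c = 0]) blast
    have V: "norm (axis i 1 :: real^'d) \<le> 1" by simp
    have D: "\<bar>0::real\<bar> \<le> 0" by simp
    note c = weak_chain_rule_time[OF r Dr _ L2 wg h h0 H has_weak_divergence_const V D]
    show ?thesis using c by (simp add: case_prod_unfold)
  qed
  have "(\<lambda>(s, x). cutoff n (r s x) * (vector_derivative \<nu> (at (r s x)) \<bullet> Dr s x)) =
     (\<lambda>z. \<Sum>i\<in>UNIV. case z of (s, x) \<Rightarrow> h i (r s x) * (Dr s x \<bullet> axis i 1))"
    by (auto simp: fun_eq_iff h_def inner_vec_def[of "vector_derivative _ _"] inner_axis sum_distrib_left mult_ac)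
  then show ?thesis using i by simp
qed

text \<open>The part with the gradient is integrated by parts onto the divergence of
  \<open>F2\<close>, which leaves the primitive H times D; the part with \<open>F3\<close> is
  bounded directly. The constant e is paid on the whole space-time domain because H need not vanish
  off the support of the weights; that domain has finite measure.\<close>

lemma noise_term_bound:
  assumes C11: "C11_loc \<sigma>" and cont: "continuous_on {0..} \<sigma>"
    and div: "has_weak_divergence (F2 f) D" and D: "\<And>x. x \<in> torus \<Longrightarrow> \<bar>D x\<bar> \<le> CD"
    and F2: "\<And>x. x \<in> torus \<Longrightarrow> norm (F2 f x) \<le> C2"
    and F3: "\<And>x. x \<in> torus \<Longrightarrow> \<bar>F3 f x\<bar> \<le> C3" and F3m: "F3 f \<in> borel_measurable torus_measure"
    and H: "\<And>\<xi>. 0 < \<xi> \<Longrightarrow> (H has_real_derivative \<sigma> \<xi> * deriv \<sigma> \<xi> * (lower n \<xi> - upper n \<xi>)) (at \<xi>)"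
    and HD: "\<And>x \<xi> S. x \<in> torus \<Longrightarrow> 0 \<le> \<xi> \<Longrightarrow> (\<And>s. s \<in> {0..\<xi>} \<Longrightarrow> (\<sigma> s)\<^sup>2 \<le> S) \<Longrightarrow>
        \<bar>H \<xi> * D x\<bar> \<le> e + (if real (n + 2) < \<xi> then K * S else 0)"
    and K: "K \<ge> 0" and e: "e \<ge> 0"
    and c: "c \<ge> 0" "\<And>\<xi> s. 0 \<le> \<xi> \<Longrightarrow> s \<in> {0..\<xi>} \<Longrightarrow> (\<sigma> s)\<^sup>2 \<le> c * (1 + \<xi> + (\<sigma> \<xi>)\<^sup>2)"
    and \<sigma>m: "(\<lambda>(t, x). (\<sigma> (r t x))\<^sup>2) \<in> borel_measurable Q"
  shows "ennreal \<bar>1 / 2 * (\<integral>(s, x). (\<sigma> (r s x) * deriv \<sigma> (r s x) * (Dr s x \<bullet> F2 f x)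
        + F3 f x * (\<sigma> (r s x))\<^sup>2) * (lower n (r s x) - upper n (r s x)) \<partial>Q)\<bar>
    \<le> (\<integral>\<^sup>+(s, x). ennreal (C3 * (\<sigma> (r s x))\<^sup>2 * (lower n (r s x) + upper n (r s x))
        + e + (if real (n + 2) < r s x then K * c * (1 + r s x + (\<sigma> (r s x))\<^sup>2) else 0)) \<partial>Q)"
    (is "ennreal \<bar>1 / 2 * ?R\<bar> \<le> ?B")
proof -
  note [measurable] = r Dr F3m \<sigma>m
  have [measurable]: "lower n \<in> borel_measurable borel" "upper n \<in> borel_measurable borel"
    by (intro borel_measurable_continuous_onI smooth_continuous smooth_lower smooth_upper)+
  define h where "h \<xi> = \<sigma> \<xi> * deriv \<sigma> \<xi> * (lower n \<xi> - upper n \<xi>)" for \<xi>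
  have lu0: "lower n \<xi> - upper n \<xi> = 0" if "\<xi> \<notin> {1 / real (4 * n + 5)<..<real (4 * n + 5)}" for \<xi>
    using cut_ranges[OF that] by simp
  have h: "continuous_on UNIV h"
    unfolding h_def
  proof (rule continuous_mult_support[OF C11_loc_product_continuous[OF C11]])
    show "lower n \<xi> - upper n \<xi> = 0" if "\<xi> \<notin> {1 / real (4 * n + 5)..real (4 * n + 5)}" for \<xi>
      by (rule lu0) (use that in auto)
  qed (auto intro!: smooth_continuous smooth_diff smooth_lower smooth_upper)
  have h0: "h \<xi> = 0" if "\<xi> \<notin> {1 / real (4 * n + 5)<..<real (4 * n + 5)}" for \<xi>
    using lu0[OF that] by (simp add: h_def)
  have Hh: "(H has_real_derivative h \<xi>) (at \<xi>)" if "0 < \<xi>" for \<xi>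
    unfolding h_def by (rule H[OF that])
  have K1: "1 \<le> 4 * n + 5" by simp
  have chain: "integrable Q (\<lambda>(s, x). h (r s x) * (Dr s x \<bullet> F2 f x))"
    "(\<integral>(s, x). h (r s x) * (Dr s x \<bullet> F2 f x) \<partial>Q) = - (\<integral>(s, x). H (truncate (4 * n + 5) (r s x)) * D x \<partial>Q)"
    by (rule weak_chain_rule_time[OF r Dr K1 L2 wg h h0 Hh div F2 D]; assumption)+
  let ?v1 = "\<lambda>z. case z of (s, x) \<Rightarrow> h (r s x) * (Dr s x \<bullet> F2 f x)"
  let ?v2 = "\<lambda>z. case z of (s, x) \<Rightarrow> F3 f x * (\<sigma> (r s x))\<^sup>2 * (lower n (r s x) - upper n (r s x))"
  let ?w1 = "\<lambda>z. case z of (s, x) \<Rightarrow> e + (if real (n + 2) < r s x then K * c * (1 + r s x + (\<sigma> (r s x))\<^sup>2) else 0)"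
  let ?w2 = "\<lambda>z. case z of (s, x) \<Rightarrow> C3 * (\<sigma> (r s x))\<^sup>2 * (lower n (r s x) + upper n (r s x))"
  have rn: "0 \<le> r s x" "x \<in> torus" if "(s, x) \<in> space Q" for s x
    using that r_nonneg by (auto simp: space_pair_measure)
  have C3: "C3 \<ge> 0"
  proof -
    have "(0 :: real^'d) \<in> torus" by (simp add: torus_def)
    from order_trans[OF abs_ge_zero F3[OF this]] show ?thesis .
  qed
  have "continuous_on {0..real (4 * n + 5)} (\<lambda>\<xi>. (\<sigma> \<xi>)\<^sup>2 * (lower n \<xi> - upper n \<xi>))"
    by (intro continuous_intros continuous_on_subset[OF cont] smooth_continuous smooth_lower smooth_upper) auto
  then have "bounded ((\<lambda>\<xi>. (\<sigma> \<xi>)\<^sup>2 * (lower n \<xi> - upper n \<xi>)) ` {0..real (4 * n + 5)})"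
    by (intro compact_imp_bounded compact_continuous_image compact_Icc)
  then obtain B where B: "\<forall>\<xi>\<in>{0..real (4 * n + 5)}. \<bar>(\<sigma> \<xi>)\<^sup>2 * (lower n \<xi> - upper n \<xi>)\<bar> \<le> B"
    unfolding bounded_iff by auto
  have B': "\<bar>(\<sigma> \<xi>)\<^sup>2 * (lower n \<xi> - upper n \<xi>)\<bar> \<le> max B 0" if "0 \<le> \<xi>" for \<xi>
  proof (cases "\<xi> \<in> {0..real (4 * n + 5)}")
    case True
    then show ?thesis using B by (auto simp: le_max_iff_disj)
  next
    case False
    then have "lower n \<xi> - upper n \<xi> = 0" using that by (intro lu0) auto
    then show ?thesis by simp
  qed
  have sum_le: "ennreal y \<le> ennreal \<bar>a\<bar> + ennreal \<bar>b\<bar>" if "y \<le> \<bar>a\<bar> + \<bar>b\<bar>" for y a b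
    using ennreal_leI[OF that] by simp
  have i2: "integrable Q ?v2"
  proof (rule Q.integrable_const_bound[of _ "C3 * max B 0"])
    show "AE z in Q. norm (?v2 z) \<le> C3 * max B 0"
    proof (rule AE_I2, clarify)
      fix s x assume z: "(s, x) \<in> space Q"
      have "\<bar>F3 f x\<bar> * \<bar>(\<sigma> (r s x))\<^sup>2 * (lower n (r s x) - upper n (r s x))\<bar> \<le> C3 * max B 0"
        using C3 by (intro mult_mono F3 B' rn[OF z]) auto
      then show "norm (F3 f x * (\<sigma> (r s x))\<^sup>2 * (lower n (r s x) - upper n (r s x))) \<le> C3 * max B 0"
        by (simp add: abs_mult mult.assoc)
    qed
    have "(\<lambda>z. (case z of (s, x) \<Rightarrow> F3 f x) * (case z of (s, x) \<Rightarrow> (\<sigma> (r s x))\<^sup>2) * (case z of (s, x) \<Rightarrow> lower n (r s x) - upper n (r s x)))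
      \<in> borel_measurable Q" by measurable
    then show "?v2 \<in> borel_measurable Q" by (simp add: case_prod_unfold)
  qed
  have "?R = (\<integral>z. ?v1 z + ?v2 z \<partial>Q)"
    by (intro Bochner_Integration.integral_cong) (auto simp: h_def algebra_simps)
  also have "\<dots> = (\<integral>z. ?v1 z \<partial>Q) + (\<integral>z. ?v2 z \<partial>Q)"
    by (rule Bochner_Integration.integral_add[OF chain(1) i2])
  finally have "\<bar>1 / 2 * ?R\<bar> \<le> \<bar>\<integral>z. ?v1 z \<partial>Q\<bar> + \<bar>\<integral>z. ?v2 z \<partial>Q\<bar>"
    by linarith
  then have "ennreal \<bar>1 / 2 * ?R\<bar> \<le> ennreal \<bar>\<integral>z. ?v1 z \<partial>Q\<bar> + ennreal \<bar>\<integral>z. ?v2 z \<partial>Q\<bar>"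
    by (rule sum_le)
  also have "ennreal \<bar>\<integral>z. ?v1 z \<partial>Q\<bar> \<le> (\<integral>\<^sup>+z. ennreal (?w1 z) \<partial>Q)"
  proof -
    have "ennreal \<bar>\<integral>z. ?v1 z \<partial>Q\<bar> = ennreal \<bar>\<integral>(s, x). H (truncate (4 * n + 5) (r s x)) * D x \<partial>Q\<bar>"
      by (simp add: chain(2))
    also have "\<dots> \<le> (\<integral>\<^sup>+z. ennreal \<bar>case z of (s, x) \<Rightarrow> H (truncate (4 * n + 5) (r s x)) * D x\<bar> \<partial>Q)"
      by (rule abs_integral_le)
    also have "\<dots> \<le> (\<integral>\<^sup>+z. ennreal (?w1 z) \<partial>Q)"
    proof (rule nn_integral_mono, clarify, rule ennreal_leI)
      fix s x assume z: "(s, x) \<in> space Q"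
      let ?u = "truncate (4 * n + 5) (r s x)"
      have u: "0 \<le> ?u" using truncate_range[OF K1, of "r s x"] order_trans[of 0 "1 / real (4 * n + 5)"] by simp
      show "\<bar>H ?u * D x\<bar> \<le> e + (if real (n + 2) < r s x then K * c * (1 + r s x + (\<sigma> (r s x))\<^sup>2) else 0)"
      proof (cases "real (n + 2) < ?u")
        case True
        \<comment> \<open>Truncation raises values only to 1 / (4 n + 5), which is below n + 2, so
          here it can only have lowered r. The growth condition may therefore be used at r itself,
          whose bound is integrable.\<close>
        then have le: "?u \<le> r s x" using cut_range_aux(4)[of n] by (auto simp: truncate_def)
        have "\<bar>H ?u * D x\<bar> \<le> e + (if real (n + 2) < ?u then K * (c * (1 + r s x + (\<sigma> (r s x))\<^sup>2)) else 0)"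
          by (rule HD[OF rn(2)[OF z] u]) (use c(2)[OF rn(1)[OF z]] le in auto)
        then show ?thesis using True le by (auto simp: mult.assoc)
      next
        case False
        have "\<bar>H ?u * D x\<bar> \<le> e + (if real (n + 2) < ?u then K * (c * (1 + ?u + (\<sigma> ?u)\<^sup>2)) else 0)"
          by (rule HD[OF rn(2)[OF z] u]) (use c(2)[OF u] in auto)
        moreover have "0 \<le> K * c * (1 + r s x + (\<sigma> (r s x))\<^sup>2)"
          using K c(1) rn(1)[OF z] by (intro mult_nonneg_nonneg add_nonneg_nonneg) auto
        ultimately show ?thesis using False by auto
      qed
    qed
    finally show ?thesis .
  qed
  also have "ennreal \<bar>\<integral>z. ?v2 z \<partial>Q\<bar> \<le> (\<integral>\<^sup>+z. ennreal (?w2 z) \<partial>Q)"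
  proof (rule order_trans[OF abs_integral_le], rule nn_integral_mono, clarify, rule ennreal_leI)
    fix s x assume z: "(s, x) \<in> space Q"
    have "\<bar>F3 f x\<bar> * (\<sigma> (r s x))\<^sup>2 * \<bar>lower n (r s x) - upper n (r s x)\<bar> \<le>
      C3 * (\<sigma> (r s x))\<^sup>2 * (lower n (r s x) + upper n (r s x))"
      using F3[OF rn(2)[OF z]] lower_nonneg[of n "r s x"] upper_nonneg[of n "r s x"] C3
      by (intro mult_mono) auto
    then show "\<bar>F3 f x * (\<sigma> (r s x))\<^sup>2 * (lower n (r s x) - upper n (r s x))\<bar> \<le>
      C3 * (\<sigma> (r s x))\<^sup>2 * (lower n (r s x) + upper n (r s x))"
      by (simp add: abs_mult)
  qed
  finally have "ennreal \<bar>1 / 2 * ?R\<bar>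
    \<le> (\<integral>\<^sup>+z. ennreal (?w1 z) \<partial>Q) + (\<integral>\<^sup>+z. ennreal (?w2 z) \<partial>Q)"
    by (simp add: add_mono)
  also have "\<dots> = (\<integral>\<^sup>+z. ennreal (?w1 z) + ennreal (?w2 z) \<partial>Q)"
  proof (rule nn_integral_add[symmetric])
    have rm [measurable]: "(\<lambda>z. r (fst z) (snd z)) \<in> borel_measurable Q" "(\<lambda>z. (\<sigma> (r (fst z) (snd z)))\<^sup>2) \<in> borel_measurable Q"
      using r \<sigma>m by (simp_all add: case_prod_unfold)
    show "(\<lambda>z. ennreal (?w1 z)) \<in> borel_measurable Q" "(\<lambda>z. ennreal (?w2 z)) \<in> borel_measurable Q"
      unfolding case_prod_unfold by measurable
  qed
  also have "\<dots> \<le> ?B"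
  proof (rule nn_integral_mono, clarify)
    fix s x assume z: "(s, x) \<in> space Q"
    have "0 \<le> e + (if real (n + 2) < r s x then K * c * (1 + r s x + (\<sigma> (r s x))\<^sup>2) else 0)"
      using K c(1) rn(1)[OF z] e by (auto intro!: mult_nonneg_nonneg add_nonneg_nonneg)
    moreover have "0 \<le> C3 * (\<sigma> (r s x))\<^sup>2 * (lower n (r s x) + upper n (r s x))"
      using C3 lower_nonneg upper_nonneg by (intro mult_nonneg_nonneg add_nonneg_nonneg) auto
    ultimately show "ennreal (e + (if real (n + 2) < r s x then K * c * (1 + r s x + (\<sigma> (r s x))\<^sup>2) else 0)) +
      ennreal (C3 * (\<sigma> (r s x))\<^sup>2 * (lower n (r s x) + upper n (r s x))) \<le>
      ennreal (C3 * (\<sigma> (r s x))\<^sup>2 * (lower n (r s x) + upper n (r s x)) + e +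
        (if real (n + 2) < r s x then K * c * (1 + r s x + (\<sigma> (r s x))\<^sup>2) else 0))"
      by (subst ennreal_plus[symmetric]) (auto simp: add_ac)
  qed
  finally show ?thesis .
qed

text \<open>The equation at the final time, solved for the kinetic mass near zero: the x-gradient
  terms vanish as the cutoff depends on \<xi> only, the transport term vanishes by
  \<open>transport_term\<close>, and the \<xi>-derivative of the cutoff is \<open>lower n\<close>
  minus \<open>upper n\<close>.\<close>

lemma cutoff_equation:
  assumes eq: "kinetic_equation f \<Phi> \<sigma> \<nu> (\<lambda>z. cutoff n (snd z)) r0 r Dr p T j"
    and str: "structure_assumption f \<Phi> \<sigma> \<nu>"
    and sets: "sets p = sets (restrict_space borel (torus \<times> {0<..} \<times> {0..T}))"
    and fin: "\<And>a b. 0 < a \<Longrightarrow> a \<le> b \<Longrightarrow> emeasure p (torus \<times> {a..b} \<times> {0..T}) < \<infinity>"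
  shows "(\<integral>(x, \<xi>, s). lower n \<xi> \<partial>p) + j - (\<integral>(x, \<xi>, s). upper n \<xi> \<partial>p) =
    ((\<integral>(x, \<xi>). kinetic_function (r0 x) \<xi> * cutoff n \<xi> \<partial>(torus_measure \<Otimes>\<^sub>M lborel)) -
     (\<integral>(x, \<xi>). kinetic_function (r T x) \<xi> * cutoff n \<xi> \<partial>(torus_measure \<Otimes>\<^sub>M lborel))) +
    1 / 2 * (\<integral>(s, x). (\<sigma> (r s x) * deriv \<sigma> (r s x) * (Dr s x \<bullet> F2 f x)
        + F3 f x * (\<sigma> (r s x))\<^sup>2) * (lower n (r s x) - upper n (r s x)) \<partial>Q)"
proof -
  have gx: "grad_x (\<lambda>z. cutoff n (snd z)) x \<xi> = 0" for x :: "real^'d" and \<xi>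
    by (simp add: grad_x_def grad_def vec_eq_iff)
  have dx: "deriv_xi (\<lambda>z :: (real^'d) \<times> real. cutoff n (snd z)) x \<xi> = lower n \<xi> - upper n \<xi>" for x \<xi>
    using DERIV_imp_deriv[OF cutoff_deriv] by (simp add: deriv_xi_def)
  have sp: "space p = torus \<times> {0<..} \<times> {0..T}"
    using sets_eq_imp_space_eq[OF sets] by (simp add: space_restrict_space)
  have 1: "integrable p (\<lambda>(x, \<xi>, s). lower n \<xi>)" by (rule kinetic_integrable_lower[OF sets fin])
  have 2: "integrable p (\<lambda>(x, \<xi>, s). upper n \<xi>)" by (rule kinetic_integrable_upper[OF sets fin])
  have "(\<integral>(x, \<xi>, s). indicator {0..T} s * (lower n \<xi> - upper n \<xi>) \<partial>p) =
      (\<integral>z. (case z of (x, \<xi>, s) \<Rightarrow> lower n \<xi>) - (case z of (x, \<xi>, s) \<Rightarrow> upper n \<xi>) \<partial>p)"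
    by (rule Bochner_Integration.integral_cong) (auto simp: sp)
  also have "\<dots> = (\<integral>(x, \<xi>, s). lower n \<xi> \<partial>p) - (\<integral>(x, \<xi>, s). upper n \<xi> \<partial>p)"
    by (rule Bochner_Integration.integral_diff[OF 1 2])
  finally have p: "(\<integral>(x, \<xi>, s). indicator {0..T} s * (lower n \<xi> - upper n \<xi>) \<partial>p) =
    (\<integral>(x, \<xi>, s). lower n \<xi> \<partial>p) - (\<integral>(x, \<xi>, s). upper n \<xi> \<partial>p)" .
  have z: "(\<integral>(s, x). 0 \<partial>Q) = (0 :: real)" by (simp add: case_prod_unfold)
  show ?thesis
    using eq unfolding kinetic_equation_def Let_def gx dx p snd_conv transport_term[OF str]
      inner_zero_right mult_zero_right z
    by linarith
qed

end

section \<open>Passage to the limit\<close>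

text \<open>Freezes a predictable process at time T into a random variable: the section of a
  generating rectangle at T is its base or empty.\<close>

lemma measurable_terminal_time:
  assumes F: "time_filtration M F" and T: "0 \<le> T"
  shows "(\<lambda>\<omega>. (\<omega>, T)) \<in> measurable M (predictable M F T)"
  unfolding predictable_def
proof (rule measurable_measure_of)
  have sub: "space (F s) = space M" "sets (F s) \<subseteq> sets M" if "0 \<le> s" for s
    using F that by (auto simp: time_filtration_def subalgebra_def)
  show "{A \<times> {s<..t} |A s t. 0 \<le> s \<and> s \<le> t \<and> t \<le> T \<and> A \<in> sets (F s)} \<union>
      {A \<times> {0} |A. A \<in> sets (F 0)} \<subseteq> Pow (space M \<times> {0..T})"
  proof -
    have "A \<subseteq> space M" if "A \<in> sets (F s)" "0 \<le> s" for A s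
      using sets.sets_into_space[OF that(1)] sub(1)[OF that(2)] by simp
    then show ?thesis using T by (auto dest: subsetD)
  qed
  show "(\<lambda>\<omega>. (\<omega>, T)) \<in> space M \<rightarrow> space M \<times> {0..T}" using T by auto
  fix y assume "y \<in> {A \<times> {s<..t} |A s t. 0 \<le> s \<and> s \<le> t \<and> t \<le> T \<and> A \<in> sets (F s)} \<union>
      {A \<times> {0} |A. A \<in> sets (F 0)}"
  then obtain A S s where y: "y = A \<times> S" "0 \<le> s" "A \<in> sets (F s)" by blast
  have A: "A \<in> sets M" using sub(2)[OF y(2)] y(3) by auto
  have "(\<lambda>\<omega>. (\<omega>, T)) -` y \<inter> space M = (if T \<in> S then A else {})"
    using sets.sets_into_space[OF A] by (auto simp: y(1))
  then show "(\<lambda>\<omega>. (\<omega>, T)) -` y \<inter> space M \<in> sets M" using A by simp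
qed

text \<open>The dependence of q on \<omega> is measurable only through its action on test functions.
  For this reason the argument works with the integral of a smooth weight and not with the mass of a
  slab.\<close>

lemma measurable_kinetic_integral:
  assumes F: "time_filtration M F" and T: "0 \<le> T" and q: "kinetic_measure M F T q"
    and h: "smooth h" "0 < a" "a < b" "\<And>\<xi>. \<xi> \<notin> {a..b} \<Longrightarrow> h \<xi> = 0"
  shows "(\<lambda>\<omega>. \<integral>(x :: real^'d, \<xi>, s). h \<xi> \<partial>q \<omega>) \<in> borel_measurable M"
proof -
  have "kinetic_test_function (\<lambda>p :: (real^'d) \<times> real. h (snd p))"
    by (rule kinetic_test_function_snd[OF h])
  then have "(\<lambda>(\<omega>, t). \<integral>(x, \<xi>, s). indicator {0..t} s * h (snd (x, \<xi>)) \<partial>q \<omega>) \<in> borel_measurable (predictable M F T)"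
    using q unfolding kinetic_measure_def by blast
  from measurable_compose[OF measurable_terminal_time[OF F T] this]
  have "(\<lambda>\<omega>. \<integral>(x, \<xi>, s). indicator {0..T} s * h \<xi> \<partial>q \<omega>) \<in> borel_measurable M" by simp
  also have "?this \<longleftrightarrow> ?thesis"
  proof (rule measurable_cong)
    fix \<omega> assume "\<omega> \<in> space M"
    then have "sets (q \<omega>) = sets (restrict_space borel (torus \<times> {0<..} \<times> {0..T}))"
      using q by (simp add: kinetic_measure_def)
    from sets_eq_imp_space_eq[OF this] have sp: "space (q \<omega>) = torus \<times> {0<..} \<times> {0..T}"
      by (simp add: space_restrict_space)
    show "(\<integral>(x, \<xi>, s). indicator {0..T} s * h \<xi> \<partial>q \<omega>) = (\<integral>(x, \<xi>, s). h \<xi> \<partial>q \<omega>)"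
      by (rule Bochner_Integration.integral_cong) (auto simp: sp)
  qed
  finally show ?thesis .
qed

lemma kinetic_function_nonneg: "0 \<le> kinetic_function y \<xi>"
  by (simp add: kinetic_function_def)

text \<open>Dominated convergence on the product of \<Omega>, torus and \<xi>-axis. The majorant is
  the sum of the two kinetic functions, whose integral is the sum of the two expected
  masses.\<close>

lemma cutoff_tail_tendsto:
  fixes \<rho>1 \<rho>2 :: "'a \<Rightarrow> real^'d \<Rightarrow> real"
  assumes M: "prob_space M"
    and m: "(\<lambda>(\<omega>, x). \<rho>1 \<omega> x) \<in> borel_measurable (M \<Otimes>\<^sub>M torus_measure)" "(\<lambda>(\<omega>, x). \<rho>2 \<omega> x) \<in> borel_measurable (M \<Otimes>\<^sub>M torus_measure)"
    and f: "(\<integral>\<^sup>+\<omega>. \<integral>\<^sup>+x. ennreal (\<rho>1 \<omega> x) \<partial>torus_measure \<partial>M) < \<infinity>" "(\<integral>\<^sup>+\<omega>. \<integral>\<^sup>+x. ennreal (\<rho>2 \<omega> x) \<partial>torus_measure \<partial>M) < \<infinity>"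
  defines "a \<equiv> \<lambda>n \<omega>. \<integral>\<^sup>+(x, \<xi>). ennreal ((kinetic_function (\<rho>1 \<omega> x) \<xi> + kinetic_function (\<rho>2 \<omega> x) \<xi>) * (1 - cutoff n \<xi>)) \<partial>(torus_measure \<Otimes>\<^sub>M lborel)"
  shows "a n \<in> borel_measurable M" "(\<lambda>n. \<integral>\<^sup>+\<omega>. a n \<omega> \<partial>M) \<longlonglongrightarrow> 0"
proof -
  interpret prob_space M by (rule M)
  let ?N = "(torus_measure :: (real^'d) measure) \<Otimes>\<^sub>M (lborel :: real measure)"
  interpret TL: pair_sigma_finite "torus_measure :: (real^'d) measure" "lborel :: real measure" ..
  have N: "sigma_finite_measure ?N" ..
  have [measurable]: "cutoff n \<in> borel_measurable borel" for n
    by (intro borel_measurable_continuous_onI smooth_continuous smooth_cutoff)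
  have mm [measurable]: "(\<lambda>z. \<rho>1 (fst z) (fst (snd z))) \<in> borel_measurable (M \<Otimes>\<^sub>M ?N)" "(\<lambda>z. \<rho>2 (fst z) (fst (snd z))) \<in> borel_measurable (M \<Otimes>\<^sub>M ?N)"
  proof -
    have "(\<lambda>z. (fst z, fst (snd z))) \<in> measurable (M \<Otimes>\<^sub>M ?N) (M \<Otimes>\<^sub>M torus_measure)" by measurable
    from measurable_compose[OF this m(1)] measurable_compose[OF this m(2)]
    show "(\<lambda>z. \<rho>1 (fst z) (fst (snd z))) \<in> borel_measurable (M \<Otimes>\<^sub>M ?N)" "(\<lambda>z. \<rho>2 (fst z) (fst (snd z))) \<in> borel_measurable (M \<Otimes>\<^sub>M ?N)"
      by simp_all
  qed
  define k where "k z = kinetic_function (\<rho>1 (fst z) (fst (snd z))) (snd (snd z)) + kinetic_function (\<rho>2 (fst z) (fst (snd z))) (snd (snd z))" for z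
  have [measurable]: "k \<in> borel_measurable (M \<Otimes>\<^sub>M ?N)"
    unfolding k_def[abs_def] kinetic_function_def by measurable
  have k0: "0 \<le> k z" for z by (simp add: k_def kinetic_function_nonneg)
  define u where "u n z = ennreal (k z * (1 - cutoff n (snd (snd z))))" for n z
  have [measurable]: "u n \<in> borel_measurable (M \<Otimes>\<^sub>M ?N)" for n
    unfolding u_def[abs_def] by measurable
  have a: "a n = (\<lambda>\<omega>. \<integral>\<^sup>+y. u n (\<omega>, y) \<partial>?N)" for n
    by (simp add: a_def u_def k_def case_prod_unfold)
  show "a n \<in> borel_measurable M" unfolding a by measurable
  have s: "\<rho>1 \<omega> \<in> borel_measurable torus_measure" "\<rho>2 \<omega> \<in> borel_measurable torus_measure" if "\<omega> \<in> space M" for \<omega>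
    using measurable_Pair2[OF m(1) that] measurable_Pair2[OF m(2) that] by simp_all
  have "(\<integral>\<^sup>+z. ennreal (k z) \<partial>(M \<Otimes>\<^sub>M ?N)) = (\<integral>\<^sup>+\<omega>. \<integral>\<^sup>+y. ennreal (k (\<omega>, y)) \<partial>?N \<partial>M)"
    by (rule sigma_finite_measure.nn_integral_fst[OF N, symmetric]) measurable
  also have "\<dots> = (\<integral>\<^sup>+\<omega>. (\<integral>\<^sup>+x. ennreal (\<rho>1 \<omega> x) \<partial>torus_measure) + (\<integral>\<^sup>+x. ennreal (\<rho>2 \<omega> x) \<partial>torus_measure) \<partial>M)"
  proof (rule nn_integral_cong)
    fix \<omega> assume \<omega>: "\<omega> \<in> space M"
    note [measurable] = s[OF \<omega>]
    have "(\<integral>\<^sup>+y. ennreal (k (\<omega>, y)) \<partial>?N) = (\<integral>\<^sup>+y. ennreal (kinetic_function (\<rho>1 \<omega> (fst y)) (snd y)) + ennreal (kinetic_function (\<rho>2 \<omega> (fst y)) (snd y)) \<partial>?N)"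
      by (simp add: k_def kinetic_function_nonneg)
    also have "\<dots> = (\<integral>\<^sup>+y. ennreal (kinetic_function (\<rho>1 \<omega> (fst y)) (snd y)) \<partial>?N) + (\<integral>\<^sup>+y. ennreal (kinetic_function (\<rho>2 \<omega> (fst y)) (snd y)) \<partial>?N)"
      by (rule nn_integral_add) (unfold kinetic_function_def, measurable)
    also have "\<dots> = (\<integral>\<^sup>+x. ennreal (\<rho>1 \<omega> x) \<partial>torus_measure) + (\<integral>\<^sup>+x. ennreal (\<rho>2 \<omega> x) \<partial>torus_measure)"
      using kinetic_function_integral[OF s(1)[OF \<omega>]] kinetic_function_integral[OF s(2)[OF \<omega>]] by (simp add: case_prod_unfold)
    finally show "(\<integral>\<^sup>+y. ennreal (k (\<omega>, y)) \<partial>?N) = \<dots>" .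
  qed
  also have "\<dots> = (\<integral>\<^sup>+\<omega>. \<integral>\<^sup>+x. ennreal (\<rho>1 \<omega> x) \<partial>torus_measure \<partial>M) + (\<integral>\<^sup>+\<omega>. \<integral>\<^sup>+x. ennreal (\<rho>2 \<omega> x) \<partial>torus_measure \<partial>M)"
    by (rule nn_integral_add) (use m in measurable)
  also have "\<dots> < \<infinity>" using f by simp
  finally have fin: "(\<integral>\<^sup>+z. ennreal (k z) \<partial>(M \<Otimes>\<^sub>M ?N)) < \<infinity>" .
  have "(\<lambda>n. \<integral>\<^sup>+z. u n z \<partial>(M \<Otimes>\<^sub>M ?N)) \<longlonglongrightarrow> (\<integral>\<^sup>+z. 0 \<partial>(M \<Otimes>\<^sub>M ?N))"
  proof (rule nn_integral_dominated_convergence[OF _ _ _ _ fin])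
    show "AE z in M \<Otimes>\<^sub>M ?N. u n z \<le> ennreal (k z)" for n
      using cutoff_range[of n] k0 by (intro AE_I2) (auto simp: u_def intro!: ennreal_leI mult_left_le)
    show "AE z in M \<Otimes>\<^sub>M ?N. (\<lambda>n. u n z) \<longlonglongrightarrow> 0"
    proof (rule AE_I2)
      fix z
      have "(\<lambda>n. k z * (1 - cutoff n (snd (snd z)))) \<longlonglongrightarrow> 0"
      proof (cases "0 < snd (snd z)")
        case True
        from tendsto_mult[OF tendsto_const tendsto_diff[OF tendsto_const cutoff_tendsto[OF True]], of "k z" 1]
        show ?thesis by simp
      next
        case False
        \<comment> \<open>For \<xi> \<le> 0 the cutoff does not tend to 1, but the kinetic functions
          vanish there.\<close>
        then have "k z = 0" by (simp add: k_def kinetic_function_def)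
        then show ?thesis by simp
      qed
      from tendsto_ennrealI[OF this] show "(\<lambda>n. u n z) \<longlonglongrightarrow> 0" by (simp add: u_def)
    qed
  qed measurable
  moreover have "(\<integral>\<^sup>+\<omega>. a n \<omega> \<partial>M) = (\<integral>\<^sup>+z. u n z \<partial>(M \<Otimes>\<^sub>M ?N))" for n
    unfolding a by (rule sigma_finite_measure.nn_integral_fst[OF N]) measurable
  ultimately show "(\<lambda>n. \<integral>\<^sup>+\<omega>. a n \<omega> \<partial>M) \<longlonglongrightarrow> 0" by simp
qed

text \<open>The weights vanish eventually at each fixed value of \<rho>, and the whole bound is at
  most a constant times 1 + \<rho> + \<sigma>^2(\<rho>), which is integrable over \<Omega>, time and
  space.\<close>

lemma noise_bound_tendsto:
  fixes \<rho> :: "'a \<Rightarrow> real \<Rightarrow> real^'d \<Rightarrow> real"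
  assumes M: "prob_space M"
    and i: "integrable (M \<Otimes>\<^sub>M (time_measure T \<Otimes>\<^sub>M torus_measure)) (\<lambda>(\<omega>, t, x). \<rho> \<omega> t x)"
      "integrable (M \<Otimes>\<^sub>M (time_measure T \<Otimes>\<^sub>M torus_measure)) (\<lambda>(\<omega>, t, x). (\<sigma> (\<rho> \<omega> t x))\<^sup>2)"
    and nn: "\<And>\<omega> t x. \<omega> \<in> space M \<Longrightarrow> t \<in> {0..T} \<Longrightarrow> x \<in> torus \<Longrightarrow> 0 \<le> \<rho> \<omega> t x"
    and c: "c > 0" "\<And>\<xi>. \<xi> \<in> {0<..5 / 4} \<Longrightarrow> (\<sigma> \<xi>)\<^sup>2 \<le> c * \<xi>"
    and C: "C \<ge> 0" and L: "L \<ge> 0" and e: "\<And>n. 0 \<le> e n" "e \<longlonglongrightarrow> 0"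
  defines "w \<equiv> \<lambda>n \<xi>. C * (\<sigma> \<xi>)\<^sup>2 * (lower n \<xi> + upper n \<xi>) + e n + (if real (n + 2) < \<xi> then L * (1 + \<xi> + (\<sigma> \<xi>)\<^sup>2) else 0)"
  defines "b \<equiv> \<lambda>n \<omega>. \<integral>\<^sup>+(t, x). ennreal (w n (\<rho> \<omega> t x)) \<partial>(time_measure T \<Otimes>\<^sub>M torus_measure)"
  shows "b n \<in> borel_measurable M" "(\<lambda>n. \<integral>\<^sup>+\<omega>. b n \<omega> \<partial>M) \<longlonglongrightarrow> 0"
proof -
  interpret prob_space M by (rule M)
  let ?Q = "time_measure T \<Otimes>\<^sub>M (torus_measure :: (real^'d) measure)"
  interpret MQ: pair_sigma_finite M ?Q ..
  interpret P: finite_measure "M \<Otimes>\<^sub>M ?Q"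
    by (intro finite_measure_pair_measure Q.finite_measure_axioms finite_measure_axioms)
  have [measurable]: "lower n \<in> borel_measurable borel" "upper n \<in> borel_measurable borel" for n
    by (intro borel_measurable_continuous_onI smooth_continuous smooth_lower smooth_upper)+
  define r where "r z = \<rho> (fst z) (fst (snd z)) (snd (snd z))" for z
  define s where "s z = (\<sigma> (r z))\<^sup>2" for z
  have ir: "integrable (M \<Otimes>\<^sub>M ?Q) r" "integrable (M \<Otimes>\<^sub>M ?Q) s"
    using i by (simp_all add: r_def[abs_def] s_def[abs_def] case_prod_unfold)
  then have [measurable]: "r \<in> borel_measurable (M \<Otimes>\<^sub>M ?Q)" "s \<in> borel_measurable (M \<Otimes>\<^sub>M ?Q)" by auto
  have r0: "0 \<le> r z" if "z \<in> space (M \<Otimes>\<^sub>M ?Q)" for z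
    using that nn by (auto simp: r_def space_pair_measure)
  define u where "u n z = ennreal (w n (r z))" for n z
  have w: "w n (r z) = C * s z * (lower n (r z) + upper n (r z)) + e n + (if real (n + 2) < r z then L * (1 + r z + s z) else 0)" for n z
    by (simp add: w_def s_def)
  have [measurable]: "u n \<in> borel_measurable (M \<Otimes>\<^sub>M ?Q)" for n
    unfolding u_def[abs_def] w by measurable
  have b: "b n = (\<lambda>\<omega>. \<integral>\<^sup>+y. u n (\<omega>, y) \<partial>?Q)" for n
    by (simp add: b_def u_def r_def case_prod_unfold)
  show "b n \<in> borel_measurable M" unfolding b by measurable
  obtain K where K: "K > 0" "\<And>x. deriv step x \<le> K" using deriv_step_bounded by metis
  obtain E where E: "\<And>n. e n \<le> E" "E \<ge> 0"
  proof -
    have "Bseq e" using e(2) convergent_imp_Bseq convergent_def by blast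
    then obtain E where "E > 0" "\<And>n. norm (e n) \<le> E" unfolding Bseq_def by blast
    then show ?thesis using that[of E] by (auto simp: abs_le_iff)
  qed
  define D where "D = C * (5 / 4 * c * K) + C * K + E + L"
  have up: "upper n \<xi> \<le> K" for n \<xi> using K(2) by (simp add: upper_def)
  \<comment> \<open>On the support of \<open>lower n\<close>, \<sigma>^2 is at most 5 c / (4 (n +
    1)) and the weight at most (n + 1) K. The factors n + 1 cancel, so the product is bounded
    uniformly in n.\<close>
  have lo: "(\<sigma> \<xi>)\<^sup>2 * lower n \<xi> \<le> 5 / 4 * c * K" for n \<xi>
  proof (cases "lower n \<xi> = 0")
    case True
    then show ?thesis using c(1) K(1) by simp
  next
    case False
    have "0 < 1 / (4 * real (n + 1))" by simp
    also have "\<dots> \<le> \<xi>" using lower_support[OF False] by simp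
    finally have \<xi>0: "0 < \<xi>" .
    have \<xi>1: "\<xi> \<le> 5 / (4 * real (n + 1))" using lower_support[OF False] by simp
    also have "\<dots> \<le> 5 / 4" by (intro divide_left_mono) auto
    finally have "(\<sigma> \<xi>)\<^sup>2 \<le> c * \<xi>" using \<xi>0 by (intro c(2)) auto
    also have "\<dots> \<le> c * (5 / (4 * real (n + 1)))" using \<xi>1 c(1) by (intro mult_left_mono) auto
    finally have "(\<sigma> \<xi>)\<^sup>2 * lower n \<xi> \<le> c * (5 / (4 * real (n + 1))) * (real (n + 1) * K)"
      using c(1) K lower_nonneg[of n \<xi>] by (intro mult_mono) (auto simp: lower_def intro!: mult_left_mono)
    also have "\<dots> = 5 / 4 * c * K" by (simp add: field_simps)
    finally show ?thesis .
  qed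
  have dom: "w n \<xi> \<le> D * (1 + \<xi> + (\<sigma> \<xi>)\<^sup>2)" if \<xi>: "0 \<le> \<xi>" for n \<xi>
  proof -
    let ?y = "1 + \<xi> + (\<sigma> \<xi>)\<^sup>2"
    have y: "1 \<le> ?y" "(\<sigma> \<xi>)\<^sup>2 \<le> ?y" using \<xi> by auto
    have "C * (\<sigma> \<xi>)\<^sup>2 * (lower n \<xi> + upper n \<xi>) = C * ((\<sigma> \<xi>)\<^sup>2 * lower n \<xi>) + C * ((\<sigma> \<xi>)\<^sup>2 * upper n \<xi>)"
      by (simp add: algebra_simps)
    also have "\<dots> \<le> C * (5 / 4 * c * K) + C * (?y * K)"
    proof (rule add_mono)
      show "C * ((\<sigma> \<xi>)\<^sup>2 * lower n \<xi>) \<le> C * (5 / 4 * c * K)"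
        by (rule mult_left_mono[OF lo C])
      have "(\<sigma> \<xi>)\<^sup>2 * upper n \<xi> \<le> ?y * K"
        by (rule mult_mono[OF y(2) up]) (use y(1) upper_nonneg in auto)
      then show "C * ((\<sigma> \<xi>)\<^sup>2 * upper n \<xi>) \<le> C * (?y * K)"
        by (rule mult_left_mono[OF _ C])
    qed
    also have "\<dots> \<le> C * (5 / 4 * c * K) * ?y + C * K * ?y"
      using mult_left_mono[OF y(1), of "C * (5 / 4 * c * K)"] C c(1) K(1) by simp
    finally have 1: "C * (\<sigma> \<xi>)\<^sup>2 * (lower n \<xi> + upper n \<xi>) \<le> C * (5 / 4 * c * K) * ?y + C * K * ?y" .
    have 2: "e n \<le> E * ?y" using E(1)[of n] mult_left_mono[OF y(1) E(2)] by simp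
    have 3: "(if real (n + 2) < \<xi> then L * ?y else 0) \<le> L * ?y" using L y(1) by auto
    have "w n \<xi> \<le> (C * (5 / 4 * c * K) * ?y + C * K * ?y) + E * ?y + L * ?y"
      unfolding w_def using 1 2 3 by (intro add_mono)
    also have "\<dots> = D * ?y" unfolding D_def by (simp only: distrib_right)
    finally show ?thesis .
  qed
  have lim: "(\<lambda>n. w n \<xi>) \<longlonglongrightarrow> 0" if \<xi>: "0 \<le> \<xi>" for \<xi>
  proof -
    have l: "eventually (\<lambda>n. lower n \<xi> = 0) sequentially"
    proof (cases "\<xi> = 0")
      case True
      \<comment> \<open>\<open>lower_tendsto\<close> covers \<xi> > 0 only. At 0 the weight is zero
        for every n, so the set where \<rho> vanishes contributes nothing through it.\<close>
      have "lower n 0 = 0" for n using lower_support[of n 0] by (auto simp: divide_le_0_iff)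
      then show ?thesis using True by simp
    qed (use \<xi> lower_tendsto in auto)
    obtain N where N: "\<xi> \<le> real N" using real_arch_simple by blast
    have "eventually (\<lambda>n. w n \<xi> = e n) sequentially"
      using l upper_tendsto[of \<xi>] eventually_ge_at_top[of N]
      by eventually_elim (use N in \<open>auto simp: w_def\<close>)
    then show ?thesis using e(2) tendsto_cong by fast
  qed
  have "integrable (M \<Otimes>\<^sub>M ?Q) (\<lambda>z. D * (1 + r z + s z))"
    by (intro integrable_mult_right Bochner_Integration.integrable_add ir) simp
  then have fin: "(\<integral>\<^sup>+z. ennreal (norm (D * (1 + r z + s z))) \<partial>(M \<Otimes>\<^sub>M ?Q)) < \<infinity>"
    unfolding integrable_iff_bounded by blast
  have "(\<lambda>n. \<integral>\<^sup>+z. u n z \<partial>(M \<Otimes>\<^sub>M ?Q)) \<longlonglongrightarrow> (\<integral>\<^sup>+z. 0 \<partial>(M \<Otimes>\<^sub>M ?Q))"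
  proof (rule nn_integral_dominated_convergence[OF _ _ _ _ fin])
    show "AE z in M \<Otimes>\<^sub>M ?Q. u n z \<le> ennreal (norm (D * (1 + r z + s z)))" for n
    proof (rule AE_I2)
      fix z assume "z \<in> space (M \<Otimes>\<^sub>M ?Q)"
      from dom[OF r0[OF this], of n] show "u n z \<le> ennreal (norm (D * (1 + r z + s z)))"
        unfolding u_def s_def by (intro ennreal_leI) auto
    qed
    show "AE z in M \<Otimes>\<^sub>M ?Q. (\<lambda>n. u n z) \<longlonglongrightarrow> 0"
    proof (rule AE_I2)
      fix z assume "z \<in> space (M \<Otimes>\<^sub>M ?Q)"
      from tendsto_ennrealI[OF lim[OF r0[OF this]]] show "(\<lambda>n. u n z) \<longlonglongrightarrow> 0" by (simp add: u_def)
    qed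
  qed measurable
  moreover have "(\<integral>\<^sup>+\<omega>. b n \<omega> \<partial>M) = (\<integral>\<^sup>+z. u n z \<partial>(M \<Otimes>\<^sub>M ?Q))" for n
    unfolding b by (rule sigma_finite_measure.nn_integral_fst[OF Q.sigma_finite_measure_axioms]) measurable
  ultimately show "(\<lambda>n. \<integral>\<^sup>+\<omega>. b n \<omega> \<partial>M) \<longlonglongrightarrow> 0" by simp
qed

text \<open>Any property holding eventually near 0 holds eventually along the sequence, so one
  sequence of levels suffices for an upper bound on the liminf.\<close>

lemma Liminf_at_right_le:
  fixes f :: "real \<Rightarrow> ennreal"
  assumes "filterlim \<beta> (at_right 0) sequentially"
  shows "Liminf (at_right 0) f \<le> liminf (\<lambda>n. f (\<beta> n))"
  unfolding Liminf_def
proof (rule SUP_mono)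
  fix P assume "P \<in> {P. eventually P (at_right (0::real))}"
  then have "eventually (\<lambda>n. P (\<beta> n)) sequentially"
    using assms by (auto simp: filterlim_iff)
  then show "\<exists>R\<in>{R. eventually R sequentially}. (INF x\<in>Collect P. f x) \<le> (INF n\<in>Collect R. f (\<beta> n))"
    by (intro bexI[of _ "\<lambda>n. P (\<beta> n)"] INF_greatest INF_lower2) auto
qed


text \<open>The shift by 1/4 sends [\<beta>/2, \<beta>] to [1/4, 3/4], a compact part of (0, 1) on
  which the derivative of the step has a positive minimum.\<close>

lemma lower_pos:
  obtains c where "c > 0" "\<And>n \<xi>. \<xi> \<in> {1 / real (n + 1) / 2..1 / real (n + 1)} \<Longrightarrow> real (n + 1) * c \<le> lower n \<xi>"
proof -
  have "continuous_on {1 / 4..3 / 4} (deriv step)" by (intro smooth_continuous smooth_deriv_step)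
  from continuous_attains_inf[OF compact_Icc _ this]
  obtain z :: real where z: "z \<in> {1 / 4..3 / 4}" "\<And>y. y \<in> {1 / 4..3 / 4} \<Longrightarrow> deriv step z \<le> deriv step y"
    by auto
  show ?thesis
  proof (rule that)
    show "deriv step z > 0" using z(1) by (intro deriv_step_pos) auto
    fix n \<xi> assume \<xi>: "\<xi> \<in> {1 / real (n + 1) / 2..1 / real (n + 1)}"
    have "real (n + 1) * \<xi> - 1 / 4 \<in> {1 / 4..3 / 4}" using \<xi> by (auto simp: field_simps)
    then show "real (n + 1) * deriv step z \<le> lower n \<xi>"
      unfolding lower_def by (intro mult_left_mono z(2)) auto
  qed
qed

text \<open>The expected mass near zero is bounded by three vanishing quantities: the loss of mass
  through the cutoff (\<open>a\<close>), the noise correction (\<open>b\<close>) and the mass of q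
  at infinity (\<open>G\<close>). The stochastic integral drops out in mean.\<close>

lemma lower_kinetic_mass_tendsto:
  fixes M :: "'a measure" and F :: "real \<Rightarrow> 'a measure"
    and B :: "nat \<Rightarrow> real \<Rightarrow> 'a \<Rightarrow> real^'d" and f :: "nat \<Rightarrow> real^'d \<Rightarrow> real"
    and \<Phi> \<sigma> :: "real \<Rightarrow> real" and \<nu> :: "real \<Rightarrow> real^'d" and T :: real
    and \<rho>0 :: "'a \<Rightarrow> real^'d \<Rightarrow> real" and \<rho> :: "'a \<Rightarrow> real \<Rightarrow> real^'d \<Rightarrow> real"
    and q :: "'a \<Rightarrow> ((real^'d) \<times> real \<times> real) measure"
  assumes T: "T > 0" and noise: "noise_assumption M F B f" and str: "structure_assumption f \<Phi> \<sigma> \<nu>"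
    and ini: "initial_datum M F \<rho>0" and sol: "stochastic_kinetic_solution M F B f \<Phi> \<sigma> \<nu> T \<rho>0 \<rho> q"
  shows "(\<lambda>\<omega>. \<integral>(x, \<xi>, s). lower n \<xi> \<partial>q \<omega>) \<in> borel_measurable M"
    and "(\<lambda>n. \<integral>\<^sup>+\<omega>. ennreal (\<integral>(x, \<xi>, s). lower n \<xi> \<partial>q \<omega>) \<partial>M) \<longlonglongrightarrow> 0"
proof -
  have M: "prob_space M" and F: "time_filtration M F" and BM: "\<And>k. brownian_motion M F (B k)"
    using noise by (auto simp: noise_assumption_def)
  interpret prob_space M by (rule M)
  let ?Q = "time_measure T \<Otimes>\<^sub>M (torus_measure :: (real^'d) measure)"
  let ?N = "(torus_measure :: (real^'d) measure) \<Otimes>\<^sub>M (lborel :: real measure)"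
  interpret MQ: pair_sigma_finite M ?Q ..
  interpret MT: pair_sigma_finite M "torus_measure :: (real^'d) measure" ..
  interpret Mt: pair_sigma_finite M "time_measure T" ..
  have T0: "0 \<le> T" using T by simp
  have q: "kinetic_measure M F T q" and proc: "solution_process M F T \<rho>"
    and mass: "AE \<omega> in M. \<forall>t\<in>{0..T}. (\<integral>x. \<bar>\<rho> \<omega> t x\<bar> \<partial>torus_measure) = (\<integral>x. \<bar>\<rho>0 \<omega> x\<bar> \<partial>torus_measure)"
    and i\<sigma>: "integrable (M \<Otimes>\<^sub>M ?Q) (\<lambda>(\<omega>, t, x). (\<sigma> (\<rho> \<omega> t x))\<^sup>2)"
    and tail: "((\<lambda>m::real. \<integral>\<^sup>+ \<omega>. emeasure (q \<omega>) (torus \<times> {m..m + 1} \<times> {0..T}) \<partial>M) \<longlongrightarrow> 0) at_top"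
    using sol unfolding stochastic_kinetic_solution_def by blast+
  obtain D\<rho> where tg: "truncation_gradient M T \<rho> D\<rho>"
    and ex: "\<And>\<psi>. kinetic_test_function \<psi> \<Longrightarrow> \<exists>J. noise_integral M F B f T
                  (\<lambda>\<omega> t x. \<psi> (x, \<rho> \<omega> t x)) (\<lambda>\<omega> t x. \<sigma> (\<rho> \<omega> t x))
                  (\<lambda>\<omega> t x. deriv \<sigma> (\<rho> \<omega> t x) *\<^sub>R D\<rho> \<omega> t x) J \<and>
                (AE \<omega> in M. \<forall>t\<in>{0..T}.
                   kinetic_equation f \<Phi> \<sigma> \<nu> \<psi> (\<rho>0 \<omega>) (\<rho> \<omega>) (D\<rho> \<omega>) (q \<omega>) t (J t \<omega>))"
    using sol unfolding stochastic_kinetic_solution_def by blast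
  have nn: "0 \<le> \<rho> \<omega> t x" if "\<omega> \<in> space M" "t \<in> {0..T}" "x \<in> torus" for \<omega> t x
    using proc that by (auto simp: solution_process_def)
  have i\<rho>: "integrable (M \<Otimes>\<^sub>M ?Q) (\<lambda>(\<omega>, t, x). \<rho> \<omega> t x)"
    and cont\<rho>: "AE \<omega> in M. \<forall>t\<in>{0..T}. integrable torus_measure (\<rho> \<omega> t)"
    using proc by (auto simp: solution_process_def elim: AE_mp)
  have nn0: "0 \<le> \<rho>0 \<omega> x" if "\<omega> \<in> space M" "x \<in> torus" for \<omega> x
    using ini that by (auto simp: initial_datum_def)
  have i0: "integrable (M \<Otimes>\<^sub>M torus_measure) (\<lambda>(\<omega>, x). \<rho>0 \<omega> x)"
    using ini by (auto simp: initial_datum_def)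
  have mT: "(\<lambda>(\<omega>, x). \<rho> \<omega> T x) \<in> borel_measurable (M \<Otimes>\<^sub>M torus_measure)"
  proof -
    have 1: "(\<lambda>((\<omega>, t), x). \<rho> \<omega> t x) \<in> borel_measurable (predictable M F T \<Otimes>\<^sub>M torus_measure)"
      using proc by (simp add: solution_process_def)
    have 2: "(\<lambda>z. ((fst z, T), snd z)) \<in> measurable (M \<Otimes>\<^sub>M torus_measure) (predictable M F T \<Otimes>\<^sub>M torus_measure)"
      by (intro measurable_Pair measurable_compose[OF measurable_fst measurable_terminal_time[OF F T0]] measurable_snd)
    from measurable_compose[OF 2 1] show ?thesis by (simp add: case_prod_unfold)
  qed
  have f0: "(\<integral>\<^sup>+\<omega>. \<integral>\<^sup>+x. ennreal (\<rho>0 \<omega> x) \<partial>torus_measure \<partial>M) < \<infinity>"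
  proof -
    have "(\<integral>\<^sup>+\<omega>. \<integral>\<^sup>+x. ennreal (\<rho>0 \<omega> x) \<partial>torus_measure \<partial>M) = (\<integral>\<^sup>+z. ennreal (case z of (\<omega>, x) \<Rightarrow> \<rho>0 \<omega> x) \<partial>(M \<Otimes>\<^sub>M torus_measure))"
      using i0 by (subst torus.nn_integral_fst[symmetric]) auto
    also have "\<dots> \<le> (\<integral>\<^sup>+z. ennreal (norm (case z of (\<omega>, x) \<Rightarrow> \<rho>0 \<omega> x)) \<partial>(M \<Otimes>\<^sub>M torus_measure))"
      by (intro nn_integral_mono ennreal_leI) auto
    also have "\<dots> < \<infinity>" using i0 unfolding integrable_iff_bounded by blast
    finally show ?thesis .
  qed
  have s0: "AE \<omega> in M. integrable torus_measure (\<rho>0 \<omega>)"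
    using MT.AE_integrable_fst'[OF i0] by simp
  \<comment> \<open>Integrability over space-time says nothing about the single time T; finiteness
    there is inherited from the initial datum by conservation of mass.\<close>
  have fT: "(\<integral>\<^sup>+\<omega>. \<integral>\<^sup>+x. ennreal (\<rho> \<omega> T x) \<partial>torus_measure \<partial>M) < \<infinity>"
  proof -
    have "(\<integral>\<^sup>+\<omega>. \<integral>\<^sup>+x. ennreal (\<rho> \<omega> T x) \<partial>torus_measure \<partial>M) = (\<integral>\<^sup>+\<omega>. \<integral>\<^sup>+x. ennreal (\<rho>0 \<omega> x) \<partial>torus_measure \<partial>M)"
    proof (rule nn_integral_cong_AE)
      show "AE \<omega> in M. (\<integral>\<^sup>+x. ennreal (\<rho> \<omega> T x) \<partial>torus_measure) = (\<integral>\<^sup>+x. ennreal (\<rho>0 \<omega> x) \<partial>torus_measure)"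
        using mass cont\<rho> s0 AE_space
      proof eventually_elim
        case (elim \<omega>)
        have *: "(\<integral>\<^sup>+x. ennreal (v x) \<partial>torus_measure) = ennreal (\<integral>x. \<bar>v x\<bar> \<partial>torus_measure)"
          if "integrable torus_measure v" "\<And>x. x \<in> torus \<Longrightarrow> 0 \<le> v x" for v :: "real^'d \<Rightarrow> real"
        proof -
          have "(\<integral>\<^sup>+x. ennreal (v x) \<partial>torus_measure) = (\<integral>\<^sup>+x. ennreal \<bar>v x\<bar> \<partial>torus_measure)"
            by (rule nn_integral_cong) (use that in auto)
          then show ?thesis using that(1) by (subst nn_integral_eq_integral[symmetric]) auto
        qed
        show ?case
          using elim T0 nn nn0 by (subst (1 2) *) auto
      qed
    qed
    then show ?thesis using f0 by simp
  qed
  have m0: "(\<lambda>(\<omega>, x). \<rho>0 \<omega> x) \<in> borel_measurable (M \<Otimes>\<^sub>M torus_measure)" using i0 by auto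
  define a where "a n \<omega> = (\<integral>\<^sup>+(x, \<xi>). ennreal ((kinetic_function (\<rho>0 \<omega> x) \<xi> + kinetic_function (\<rho> \<omega> T x) \<xi>) * (1 - cutoff n \<xi>)) \<partial>?N)" for n \<omega>
  have a: "a n \<in> borel_measurable M" "(\<lambda>n. \<integral>\<^sup>+\<omega>. a n \<omega> \<partial>M) \<longlonglongrightarrow> 0" for n
    using cutoff_tail_tendsto[OF M m0 mT f0 fT] unfolding a_def[abs_def] by blast+
  have C11: "C11_loc \<sigma>" and cont: "continuous_on {0..} \<sigma>" using str by (auto simp: structure_assumption_def)
  obtain D CD K e where div: "has_weak_divergence (F2 f) D" and D: "\<And>x. x \<in> torus \<Longrightarrow> \<bar>D x\<bar> \<le> CD" and K: "K > 0"
    and e: "\<And>n. 0 \<le> e n" "e \<longlonglongrightarrow> (0::real)"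
    and H: "\<And>n. \<exists>H. (\<forall>\<xi>>0. (H has_real_derivative \<sigma> \<xi> * deriv \<sigma> \<xi> * (lower n \<xi> - upper n \<xi>)) (at \<xi>)) \<and>
      (\<forall>x\<in>torus. \<forall>\<xi>\<ge>0. \<forall>S. (\<forall>s\<in>{0..\<xi>}. (\<sigma> s)\<^sup>2 \<le> S) \<longrightarrow>
        \<bar>H \<xi> * D x\<bar> \<le> e n + (if real (n + 2) < \<xi> then K * S else 0))"
    by (rule noise_primitive[OF noise str]) blast
  obtain c where c: "c \<ge> 1" "\<And>\<xi> s. 0 \<le> \<xi> \<Longrightarrow> s \<in> {0..\<xi>} \<Longrightarrow> (\<sigma> s)\<^sup>2 \<le> c * (1 + \<xi> + (\<sigma> \<xi>)\<^sup>2)"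
    using structure_sup[OF str] by blast
  obtain c0 where "Limsup (at_right 0) (\<lambda>\<xi>. ereal ((\<sigma> \<xi>)\<^sup>2 / \<xi>)) \<le> ereal c0"
    using str unfolding structure_assumption_def by blast
  then obtain c1 where c1: "c1 > 0" "\<And>\<xi>. \<xi> \<in> {0<..5 / 4} \<Longrightarrow> (\<sigma> \<xi>)\<^sup>2 \<le> c1 * \<xi>"
    using square_linear_bound[OF cont, of c0 "5 / 4"] by blast
  have cF: "continuous_on UNIV (F2 f)" "continuous_on UNIV (F3 f)" using noise by (auto simp: noise_assumption_def)
  obtain C2 where C2: "\<And>x. x \<in> torus \<Longrightarrow> norm (F2 f x) \<le> C2" using continuous_bounded_torus[OF cF(1)] by blast
  obtain C3 where C3: "C3 \<ge> 0" "\<And>x. x \<in> torus \<Longrightarrow> \<bar>F3 f x\<bar> \<le> C3" using continuous_bounded_torus[OF cF(2)] by (metis real_norm_def)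
  have Kc: "K * c \<ge> 0" using K c(1) by simp
  define b where "b n \<omega> = (\<integral>\<^sup>+(t, x). ennreal (C3 * (\<sigma> (\<rho> \<omega> t x))\<^sup>2 * (lower n (\<rho> \<omega> t x) + upper n (\<rho> \<omega> t x)) + e n +
      (if real (n + 2) < \<rho> \<omega> t x then K * c * (1 + \<rho> \<omega> t x + (\<sigma> (\<rho> \<omega> t x))\<^sup>2) else 0)) \<partial>?Q)" for n \<omega>
  have b: "b n \<in> borel_measurable M" "(\<lambda>n. \<integral>\<^sup>+\<omega>. b n \<omega> \<partial>M) \<longlonglongrightarrow> 0" for n
    using noise_bound_tendsto[OF M i\<rho> i\<sigma> nn c1 C3(1) Kc e] unfolding b_def[abs_def] by blast+
  have qs: "sets (q \<omega>) = sets (restrict_space borel (torus \<times> {0<..} \<times> {0..T}))"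
    and qf: "0 < y \<Longrightarrow> y \<le> z \<Longrightarrow> emeasure (q \<omega>) (torus \<times> {y..z} \<times> {0..T}) < \<infinity>" if "\<omega> \<in> space M" for \<omega> y z
    using q that by (auto simp: kinetic_measure_def)
  define Z where "Z n \<omega> = (\<integral>(x, \<xi>, s). lower n \<xi> \<partial>q \<omega>)" for n \<omega>
  define G where "G n \<omega> = (\<integral>(x, \<xi>, s). upper n \<xi> \<partial>q \<omega>)" for n \<omega>
  have Z [measurable]: "Z n \<in> borel_measurable M" for n
    unfolding Z_def[abs_def]
  proof (rule measurable_kinetic_integral[OF F T0 q smooth_lower])
    show "lower n \<xi> = 0" if "\<xi> \<notin> {1 / (4 * real (n + 1))..5 / (4 * real (n + 1))}" for \<xi>
      using lower_support[of n \<xi>] that by blast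
  qed (auto intro: divide_strict_right_mono)
  then show "(\<lambda>\<omega>. \<integral>(x, \<xi>, s). lower n \<xi> \<partial>q \<omega>) \<in> borel_measurable M"
    by (simp add: Z_def[abs_def])
  have G [measurable]: "G n \<in> borel_measurable M" for n
    unfolding G_def[abs_def]
  proof (rule measurable_kinetic_integral[OF F T0 q smooth_upper])
    show "upper n \<xi> = 0" if "\<xi> \<notin> {real (n + 2)..real (n + 3)}" for \<xi>
      using upper_support[of n \<xi>] that by fastforce
  qed auto
  have Z0: "0 \<le> Z n \<omega>" and G0: "0 \<le> G n \<omega>" for n \<omega>
    unfolding Z_def G_def
    by (auto intro!: Bochner_Integration.integral_nonneg lower_nonneg upper_nonneg)
  \<comment> \<open>All that is kept of the stochastic integral is its value at the final time, a
    random variable of mean zero satisfying the equation.\<close>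
  define P where "P n J \<longleftrightarrow> integrable M J \<and> (\<integral>\<omega>. J \<omega> \<partial>M) = 0 \<and>
      (AE \<omega> in M. kinetic_equation f \<Phi> \<sigma> \<nu> (\<lambda>z. cutoff n (snd z)) (\<rho>0 \<omega>) (\<rho> \<omega>) (D\<rho> \<omega>) (q \<omega>) T (J \<omega>))" for n J
  have exJ: "\<exists>J. P n J" for n
  proof -
    have "kinetic_test_function (\<lambda>z::(real^'d) \<times> real. cutoff n (snd z))"
    proof (rule kinetic_test_function_snd[OF smooth_cutoff])
      show "cutoff n \<xi> = 0" if "\<xi> \<notin> {1 / (4 * real (n + 1))..real (n + 3)}" for \<xi>
        using cutoff_support[of n \<xi>] that by blast
      have "1 / (4 * real (n + 1)) \<le> 1" by (simp add: divide_le_eq)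
      also have "1 < real (n + 3)" by simp
      finally show "1 / (4 * real (n + 1)) < real (n + 3)" .
    qed simp
    from ex[OF this] obtain J where J: "noise_integral M F B f T
                  (\<lambda>\<omega> t x. cutoff n (snd (x, \<rho> \<omega> t x))) (\<lambda>\<omega> t x. \<sigma> (\<rho> \<omega> t x))
                  (\<lambda>\<omega> t x. deriv \<sigma> (\<rho> \<omega> t x) *\<^sub>R D\<rho> \<omega> t x) J"
      "AE \<omega> in M. \<forall>t\<in>{0..T}. kinetic_equation f \<Phi> \<sigma> \<nu> (\<lambda>z. cutoff n (snd z)) (\<rho>0 \<omega>) (\<rho> \<omega>) (D\<rho> \<omega>) (q \<omega>) t (J t \<omega>)"
      by blast
    have t: "T \<in> {0..T}" using T0 by simp
    from J(2) have "AE \<omega> in M. kinetic_equation f \<Phi> \<sigma> \<nu> (\<lambda>z. cutoff n (snd z)) (\<rho>0 \<omega>) (\<rho> \<omega>) (D\<rho> \<omega>) (q \<omega>) T (J T \<omega>)"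
      by eventually_elim (use t in blast)
    with noise_integral_mean[OF M F BM J(1) t] show ?thesis unfolding P_def by blast
  qed
  then obtain J where "\<And>n. P n (J n)" using choice[of P] by blast
  then have J: "\<And>n. integrable M (J n)" "\<And>n. (\<integral>\<omega>. J n \<omega> \<partial>M) = 0"
    "\<And>n. AE \<omega> in M. kinetic_equation f \<Phi> \<sigma> \<nu> (\<lambda>z. cutoff n (snd z)) (\<rho>0 \<omega>) (\<rho> \<omega>) (D\<rho> \<omega>) (q \<omega>) T (J n \<omega>)"
    unfolding P_def by blast+
  \<comment> \<open>The exceptional set may depend on n; this is harmless, since paths are used
    under the expectation for one n at a time.\<close>
  have path: "AE \<omega> in M. truncated_path T (\<rho> \<omega>) (D\<rho> \<omega>) n" for n
  proof -
    let ?k = "4 * n + 5"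
    have mD: "(\<lambda>(\<omega>, t, x). D\<rho> \<omega> t x) \<in> borel_measurable (M \<Otimes>\<^sub>M ?Q)"
      using tg by (simp add: truncation_gradient_def)
    have k1: "1 \<le> ?k" by simp
    have L: "integrable (M \<Otimes>\<^sub>M ?Q) (\<lambda>(\<omega>, t, x). (norm (if 1 / real ?k < \<rho> \<omega> t x \<and> \<rho> \<omega> t x < real ?k then D\<rho> \<omega> t x else 0))\<^sup>2)"
      and W: "AE (\<omega>, t) in M \<Otimes>\<^sub>M time_measure T. has_weak_gradient (\<lambda>x. truncate ?k (\<rho> \<omega> t x))
        (\<lambda>x. if 1 / real ?k < \<rho> \<omega> t x \<and> \<rho> \<omega> t x < real ?k then D\<rho> \<omega> t x else 0)"
      using tg k1 unfolding truncation_gradient_def Let_def truncate_def by blast+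
    from MQ.AE_integrable_fst'[OF L] Mt.AE_pair[OF W] AE_space
    show ?thesis
    proof eventually_elim
      case (elim \<omega>)
      show ?case
      proof
        show "(\<lambda>(t, x). \<rho> \<omega> t x) \<in> borel_measurable ?Q"
          using measurable_Pair2[OF borel_measurable_integrable[OF i\<rho>] elim(3)] by simp
        show "(\<lambda>(t, x). D\<rho> \<omega> t x) \<in> borel_measurable ?Q"
          using measurable_Pair2[OF mD elim(3)] by simp
      qed (use elim nn in auto)
    qed
  qed
  \<comment> \<open>The combination that the equation controls path by path, by \<open>a\<close> and
    \<open>b\<close>, with no reference to the size of the stochastic integral.\<close>
  define W where "W n \<omega> = Z n \<omega> + J n \<omega> - G n \<omega>" for n \<omega>
  have [measurable]: "J n \<in> borel_measurable M" for n using J(1) by auto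
  have [measurable]: "W n \<in> borel_measurable M" for n unfolding W_def[abs_def] by measurable
  have W: "AE \<omega> in M. ennreal \<bar>W n \<omega>\<bar> \<le> a n \<omega> + b n \<omega>" for n
    using path[of n] J(3)[of n] mass cont\<rho> s0 AE_space
  proof eventually_elim
    case (elim \<omega>)
    interpret truncated_path T "\<rho> \<omega>" "D\<rho> \<omega>" n by (rule elim(1))
    obtain H where H: "\<forall>\<xi>>0. (H has_real_derivative \<sigma> \<xi> * deriv \<sigma> \<xi> * (lower n \<xi> - upper n \<xi>)) (at \<xi>)"
      "\<forall>x\<in>torus. \<forall>\<xi>\<ge>0. \<forall>S. (\<forall>s\<in>{0..\<xi>}. (\<sigma> s)\<^sup>2 \<le> S) \<longrightarrow>
        \<bar>H \<xi> * D x\<bar> \<le> e n + (if real (n + 2) < \<xi> then K * S else 0)"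
      using H[of n] by blast
    define A where "A = (\<integral>(x, \<xi>). kinetic_function (\<rho>0 \<omega> x) \<xi> * cutoff n \<xi> \<partial>?N) -
     (\<integral>(x, \<xi>). kinetic_function (\<rho> \<omega> T x) \<xi> * cutoff n \<xi> \<partial>?N)"
    define R where "R = 1 / 2 * (\<integral>(s, x). (\<sigma> (\<rho> \<omega> s x) * deriv \<sigma> (\<rho> \<omega> s x) * (D\<rho> \<omega> s x \<bullet> F2 f x)
        + F3 f x * (\<sigma> (\<rho> \<omega> s x))\<^sup>2) * (lower n (\<rho> \<omega> s x) - upper n (\<rho> \<omega> s x)) \<partial>?Q)"
    have eq: "W n \<omega> = A + R"
      unfolding W_def Z_def G_def A_def R_def
      by (rule cutoff_equation[OF elim(2) str qs[OF elim(6)] qf[OF elim(6)]])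
    have "ennreal \<bar>A\<bar> \<le> a n \<omega>"
      unfolding A_def a_def
    proof (rule mass_difference_bound)
      show "integrable torus_measure (\<rho> \<omega> T)" using elim(4) T0 by auto
      show "(\<integral>x. \<bar>\<rho>0 \<omega> x\<bar> \<partial>torus_measure) = (\<integral>x. \<bar>\<rho> \<omega> T x\<bar> \<partial>torus_measure)" using elim(3) T0 by auto
      show "cutoff n \<in> borel_measurable borel"
        by (intro borel_measurable_continuous_onI smooth_continuous smooth_cutoff)
    qed (use elim(5,6) nn nn0 T0 cutoff_range in auto)
    moreover have "ennreal \<bar>R\<bar> \<le> b n \<omega>"
      unfolding R_def b_def
    proof (rule noise_term_bound[OF C11 cont div D C2 C3(2)])
      show "F3 f \<in> borel_measurable torus_measure" by (rule continuous_measurable_torus[OF cF(2)])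
      show "(\<lambda>(t, x). (\<sigma> (\<rho> \<omega> t x))\<^sup>2) \<in> borel_measurable ?Q"
        using measurable_Pair2[OF borel_measurable_integrable[OF i\<sigma>] elim(6)] by simp
      show "0 \<le> K" "0 \<le> c" using K c(1) by auto
      show "\<bar>H \<xi> * D x\<bar> \<le> e n + (if real (n + 2) < \<xi> then K * S else 0)"
        if "x \<in> torus" "0 \<le> \<xi>" "\<And>s. s \<in> {0..\<xi>} \<Longrightarrow> (\<sigma> s)\<^sup>2 \<le> S" for x \<xi> S
        using H(2) that by blast
      show "(H has_real_derivative \<sigma> \<xi> * deriv \<sigma> \<xi> * (lower n \<xi> - upper n \<xi>)) (at \<xi>)" if "0 < \<xi>" for \<xi>
        using H(1) that by blast
    qed (use e(1) c(2) in auto)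
    moreover have "ennreal \<bar>W n \<omega>\<bar> \<le> ennreal \<bar>A\<bar> + ennreal \<bar>R\<bar>"
      using ennreal_leI[OF abs_triangle_ineq[of A R]] by (simp add: eq)
    ultimately show ?case by (meson add_mono order_trans)
  qed
  have Wlim: "(\<lambda>n. \<integral>\<^sup>+\<omega>. ennreal \<bar>W n \<omega>\<bar> \<partial>M) \<longlonglongrightarrow> 0"
  proof (rule tendsto_sandwich[OF _ _ tendsto_const])
    have "(\<integral>\<^sup>+\<omega>. ennreal \<bar>W n \<omega>\<bar> \<partial>M) \<le> (\<integral>\<^sup>+\<omega>. a n \<omega> \<partial>M) + (\<integral>\<^sup>+\<omega>. b n \<omega> \<partial>M)" for n
      using nn_integral_mono_AE[OF W[of n]] by (simp add: nn_integral_add a(1) b(1))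
    then show "\<forall>\<^sub>F n in sequentially. (\<integral>\<^sup>+\<omega>. ennreal \<bar>W n \<omega>\<bar> \<partial>M) \<le> (\<integral>\<^sup>+\<omega>. a n \<omega> \<partial>M) + (\<integral>\<^sup>+\<omega>. b n \<omega> \<partial>M)"
      by simp
    show "(\<lambda>n. (\<integral>\<^sup>+\<omega>. a n \<omega> \<partial>M) + (\<integral>\<^sup>+\<omega>. b n \<omega> \<partial>M)) \<longlonglongrightarrow> 0"
      using tendsto_add[OF a(2) b(2)] by simp
  qed simp
  obtain S where S: "S > 0" "\<And>x. deriv step x \<le> S" using deriv_step_bounded by metis
  \<comment> \<open>\<open>upper n\<close> is at most S times the indicator of [n + 2, n + 3], so
    the decay of q at infinity applies along integer levels.\<close>
  have Glim: "(\<lambda>n. \<integral>\<^sup>+\<omega>. ennreal (G n \<omega>) \<partial>M) \<longlonglongrightarrow> 0"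
  proof (rule tendsto_sandwich[OF _ _ tendsto_const])
    let ?E = "\<lambda>n. \<integral>\<^sup>+ \<omega>. emeasure (q \<omega>) (torus \<times> {real (n + 2)..real (n + 2) + 1} \<times> {0..T}) \<partial>M"
    have "(\<integral>\<^sup>+\<omega>. ennreal (G n \<omega>) \<partial>M) \<le> ennreal S * ?E n" for n
    proof -
      have "(\<integral>\<^sup>+\<omega>. ennreal (G n \<omega>) \<partial>M) = ennreal S * (\<integral>\<^sup>+\<omega>. ennreal (G n \<omega> / S) \<partial>M)"
        using S(1) G0 by (subst nn_integral_cmult[symmetric]) (auto simp: ennreal_mult[symmetric])
      also have "(\<integral>\<^sup>+\<omega>. ennreal (G n \<omega> / S) \<partial>M) \<le> ?E n"
      proof (rule nn_integral_mono)
        fix \<omega> assume \<omega>: "\<omega> \<in> space M"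
        have "ennreal (G n \<omega> / S) = ennreal \<bar>\<integral>z. (case z of (x, \<xi>, s) \<Rightarrow> upper n \<xi> / S) \<partial>q \<omega>\<bar>"
          using G0[of n \<omega>] S(1) by (simp add: G_def case_prod_unfold)
        also have "\<dots> \<le> (\<integral>\<^sup>+z. ennreal \<bar>case z of (x, \<xi>, s) \<Rightarrow> upper n \<xi> / S\<bar> \<partial>q \<omega>)"
          by (rule abs_integral_le)
        also have "\<dots> \<le> (\<integral>\<^sup>+z. indicator (torus \<times> {real (n + 2)..real (n + 2) + 1} \<times> {0..T}) z \<partial>q \<omega>)"
        proof (rule nn_integral_mono, clarify)
          fix x \<xi> s assume "(x, \<xi>, s) \<in> space (q \<omega>)"
          then have xs: "x \<in> torus" "s \<in> {0..T}"
            using sets_eq_imp_space_eq[OF qs[OF \<omega>]] by (auto simp: space_restrict_space)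
          show "ennreal \<bar>upper n \<xi> / S\<bar> \<le> indicator (torus \<times> {real (n + 2)..real (n + 2) + 1} \<times> {0..T}) (x, \<xi>, s)"
          proof (cases "upper n \<xi> = 0")
            case False
            then have "\<xi> \<in> {real (n + 2)..real (n + 2) + 1}" using upper_support[OF False] by auto
            moreover have "\<bar>upper n \<xi> / S\<bar> \<le> 1"
              using S upper_nonneg[of n \<xi>] by (simp add: upper_def)
            ultimately show ?thesis using xs by (simp add: ennreal_le_1)
          qed simp
        qed
        also have "\<dots> = emeasure (q \<omega>) (torus \<times> {real (n + 2)..real (n + 2) + 1} \<times> {0..T})"
          by (intro nn_integral_indicator kinetic_box_sets[OF qs[OF \<omega>]]) simp
        finally show "ennreal (G n \<omega> / S) \<le> emeasure (q \<omega>) (torus \<times> {real (n + 2)..real (n + 2) + 1} \<times> {0..T})" .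
      qed
      finally show ?thesis by (simp add: mult_left_mono)
    qed
    then show "\<forall>\<^sub>F n in sequentially. (\<integral>\<^sup>+\<omega>. ennreal (G n \<omega>) \<partial>M) \<le> ennreal S * ?E n" by simp
    have "filterlim (\<lambda>n. real (n + 2)) at_top sequentially"
      by (rule filterlim_compose[OF filterlim_real_sequentially filterlim_add_const_nat_at_top])
    from filterlim_compose[OF tail this] have "?E \<longlonglongrightarrow> 0" by simp
    from ennreal_tendsto_cmult[OF _ this, of "ennreal S"] show "(\<lambda>n. ennreal S * ?E n) \<longlonglongrightarrow> 0" by simp
  qed simp
  \<comment> \<open>Integrability of Z is not known beforehand. If both terms on the right are
    finite, then Z = W + G - J is integrable and J has mean zero; otherwise the right-hand side is
    infinite.\<close>
  have Zle: "(\<integral>\<^sup>+\<omega>. ennreal (Z n \<omega>) \<partial>M) \<le> (\<integral>\<^sup>+\<omega>. ennreal \<bar>W n \<omega>\<bar> \<partial>M) + (\<integral>\<^sup>+\<omega>. ennreal (G n \<omega>) \<partial>M)" for n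
  proof (cases "(\<integral>\<^sup>+\<omega>. ennreal \<bar>W n \<omega>\<bar> \<partial>M) < \<infinity> \<and> (\<integral>\<^sup>+\<omega>. ennreal (G n \<omega>) \<partial>M) < \<infinity>")
    case True
    have iW: "integrable M (W n)" using True by (intro integrableI_bounded) auto
    have iG: "integrable M (G n)" using True G0 by (intro integrableI_bounded) (auto simp: abs_of_nonneg)
    have ZW: "Z n = (\<lambda>\<omega>. W n \<omega> + G n \<omega> - J n \<omega>)" by (simp add: W_def fun_eq_iff)
    have iZ: "integrable M (Z n)" unfolding ZW using iW iG J(1) by auto
    have "(\<integral>\<omega>. Z n \<omega> \<partial>M) = (\<integral>\<omega>. W n \<omega> \<partial>M) + (\<integral>\<omega>. G n \<omega> \<partial>M)"
      unfolding ZW using iW iG J(1,2) by simp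
    then have "ennreal (\<integral>\<omega>. Z n \<omega> \<partial>M) \<le> ennreal (\<bar>\<integral>\<omega>. W n \<omega> \<partial>M\<bar> + (\<integral>\<omega>. G n \<omega> \<partial>M))"
      by (intro ennreal_leI) simp
    also have "\<dots> = ennreal \<bar>\<integral>\<omega>. W n \<omega> \<partial>M\<bar> + ennreal (\<integral>\<omega>. G n \<omega> \<partial>M)"
      by (rule ennreal_plus) (auto intro: Bochner_Integration.integral_nonneg G0)
    also have "\<dots> \<le> (\<integral>\<^sup>+\<omega>. ennreal \<bar>W n \<omega>\<bar> \<partial>M) + (\<integral>\<^sup>+\<omega>. ennreal (G n \<omega>) \<partial>M)"
      using abs_integral_le[of M "W n"] nn_integral_eq_integral[OF iG] G0 by (intro add_mono) auto
    finally show ?thesis using nn_integral_eq_integral[OF iZ] Z0 by auto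
  next
    case False
    then show ?thesis by (auto simp: less_top[symmetric])
  qed
  have "(\<lambda>n. \<integral>\<^sup>+\<omega>. ennreal (Z n \<omega>) \<partial>M) \<longlonglongrightarrow> 0"
  proof (rule tendsto_sandwich[OF _ _ tendsto_const])
    show "(\<lambda>n. (\<integral>\<^sup>+\<omega>. ennreal \<bar>W n \<omega>\<bar> \<partial>M) + (\<integral>\<^sup>+\<omega>. ennreal (G n \<omega>) \<partial>M)) \<longlonglongrightarrow> 0"
      using tendsto_add[OF Wlim Glim] by simp
  qed (use Zle in auto)
  then show "(\<lambda>n. \<integral>\<^sup>+\<omega>. ennreal (\<integral>(x, \<xi>, s). lower n \<xi> \<partial>q \<omega>) \<partial>M) \<longlonglongrightarrow> 0"
    by (simp add: Z_def)
qed

theorem proposition4p6: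
  fixes M :: "'a measure" and F :: "real \<Rightarrow> 'a measure"
    and B :: "nat \<Rightarrow> real \<Rightarrow> 'a \<Rightarrow> real^'d" and f :: "nat \<Rightarrow> real^'d \<Rightarrow> real"
    and \<Phi> \<sigma> :: "real \<Rightarrow> real" and \<nu> :: "real \<Rightarrow> real^'d" and T :: real
    and \<rho>0 :: "'a \<Rightarrow> real^'d \<Rightarrow> real" and \<rho> :: "'a \<Rightarrow> real \<Rightarrow> real^'d \<Rightarrow> real"
    and q :: "'a \<Rightarrow> ((real^'d) \<times> real \<times> real) measure"
  assumes "T > 0"
    and "noise_assumption M F B f"
    and "structure_assumption f \<Phi> \<sigma> \<nu>"
    and "initial_datum M F \<rho>0"
    and "stochastic_kinetic_solution M F B f \<Phi> \<sigma> \<nu> T \<rho>0 \<rho> q"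
  shows "AE \<omega> in M. Liminf (at_right 0)
           (\<lambda>\<beta>::real. ennreal (1 / \<beta>) * emeasure (q \<omega>) (torus \<times> {\<beta>/2..\<beta>} \<times> {0..T})) = 0"
proof -
  have M: "prob_space M" and F: "time_filtration M F"
    using assms(2) by (auto simp: noise_assumption_def)
  have q: "kinetic_measure M F T q"
    using assms(5) by (simp add: stochastic_kinetic_solution_def)
  note Z = lower_kinetic_mass_tendsto[OF assms]
  obtain c where c: "c > 0" "\<And>n \<xi>. \<xi> \<in> {1 / real (n + 1) / 2..1 / real (n + 1)} \<Longrightarrow> real (n + 1) * c \<le> lower n \<xi>"
    using lower_pos by blast
  \<comment> \<open>A measurable majorant of the quantity in the theorem at \<beta> = 1 / (n + 1),
    with c the minimum from \<open>lower_pos\<close>; Fatou's lemma is applied to it.\<close>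
  define u where "u n \<omega> = ennreal (1 / c) * ennreal (\<integral>(x, \<xi>, s). lower n \<xi> \<partial>q \<omega>)" for n \<omega>
  have [measurable]: "u n \<in> borel_measurable M" for n
    unfolding u_def[abs_def] using Z(1) by measurable
  have "(\<lambda>n. ennreal (1 / c) * (\<integral>\<^sup>+\<omega>. ennreal (\<integral>(x, \<xi>, s). lower n \<xi> \<partial>q \<omega>) \<partial>M)) \<longlonglongrightarrow> ennreal (1 / c) * 0"
    by (rule ennreal_tendsto_cmult[OF _ Z(2)]) simp
  moreover have "(\<integral>\<^sup>+\<omega>. u n \<omega> \<partial>M) = ennreal (1 / c) * (\<integral>\<^sup>+\<omega>. ennreal (\<integral>(x, \<xi>, s). lower n \<xi> \<partial>q \<omega>) \<partial>M)" for n
    unfolding u_def by (rule nn_integral_cmult) (use Z(1) in measurable)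
  ultimately have "(\<lambda>n. \<integral>\<^sup>+\<omega>. u n \<omega> \<partial>M) \<longlonglongrightarrow> 0" by simp
  then have "liminf (\<lambda>n. \<integral>\<^sup>+\<omega>. u n \<omega> \<partial>M) = 0"
    by (rule lim_imp_Liminf[OF sequentially_bot])
  moreover have "(\<integral>\<^sup>+\<omega>. liminf (\<lambda>n. u n \<omega>) \<partial>M) \<le> liminf (\<lambda>n. \<integral>\<^sup>+\<omega>. u n \<omega> \<partial>M)"
    by (rule nn_integral_liminf) measurable
  ultimately have "(\<integral>\<^sup>+\<omega>. liminf (\<lambda>n. u n \<omega>) \<partial>M) = 0" by simp
  then have "AE \<omega> in M. liminf (\<lambda>n. u n \<omega>) = 0"
    by (subst (asm) nn_integral_0_iff_AE) measurable
  then show ?thesis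
    using AE_space
  proof eventually_elim
    case (elim \<omega>)
    have qs: "sets (q \<omega>) = sets (restrict_space borel (torus \<times> {0<..} \<times> {0..T}))"
      and qf: "\<And>a b. 0 < a \<Longrightarrow> a \<le> b \<Longrightarrow> emeasure (q \<omega>) (torus \<times> {a..b} \<times> {0..T}) < \<infinity>"
      using q elim(2) by (auto simp: kinetic_measure_def)
    let ?f = "\<lambda>\<beta>::real. ennreal (1 / \<beta>) * emeasure (q \<omega>) (torus \<times> {\<beta>/2..\<beta>} \<times> {0..T})"
    let ?\<beta> = "\<lambda>n. 1 / real (n + 1)"
    \<comment> \<open>On [\<beta>/2, \<beta>] the weight is at least c / \<beta>, and elsewhere it
      is nonnegative; hence 1 / \<beta> times the indicator is at most \<open>lower n\<close>
      divided by c.\<close>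
    have "?f (?\<beta> n) \<le> u n \<omega>" for n
    proof -
      let ?A = "torus \<times> {?\<beta> n / 2..?\<beta> n} \<times> {0..T}"
      have "?f (?\<beta> n) = (\<integral>\<^sup>+z. ennreal (real (n + 1)) * indicator ?A z \<partial>q \<omega>)"
        by (subst nn_integral_cmult_indicator) (auto intro!: kinetic_box_sets[OF qs])
      also have "\<dots> \<le> (\<integral>\<^sup>+z. ennreal (1 / c * (case z of (x, \<xi>, s) \<Rightarrow> lower n \<xi>)) \<partial>q \<omega>)"
      proof (rule nn_integral_mono, clarify)
        fix x \<xi> s
        show "ennreal (real (n + 1)) * indicator ?A (x, \<xi>, s) \<le> ennreal (1 / c * lower n \<xi>)"
        proof (cases "\<xi> \<in> {?\<beta> n / 2..?\<beta> n}")
          case True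
          have "real (n + 1) \<le> 1 / c * lower n \<xi>" using c(2)[OF True] c(1) by (simp add: field_simps)
          from ennreal_leI[OF this] show ?thesis
            by (rule order_trans[rotated]) (simp add: indicator_def)
        qed (auto simp: indicator_def)
      qed
      also have "\<dots> = ennreal (1 / c * (\<integral>(x, \<xi>, s). lower n \<xi> \<partial>q \<omega>))"
      proof -
        have i: "integrable (q \<omega>) (\<lambda>z. 1 / c * (case z of (x, \<xi>, s) \<Rightarrow> lower n \<xi>))"
          by (intro integrable_mult_right kinetic_integrable_lower[OF qs qf])
        have "AE z in q \<omega>. 0 \<le> 1 / c * (case z of (x, \<xi>, s) \<Rightarrow> lower n \<xi>)"
          using c(1) by (auto simp: lower_nonneg intro!: AE_I2)
        from nn_integral_eq_integral[OF i this] show ?thesis by simp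
      qed
      also have "\<dots> = u n \<omega>"
        unfolding u_def using c(1)
        by (intro ennreal_mult) (auto intro!: Bochner_Integration.integral_nonneg lower_nonneg)
      finally show ?thesis .
    qed
    then have "liminf (\<lambda>n. ?f (?\<beta> n)) \<le> liminf (\<lambda>n. u n \<omega>)"
      by (intro Liminf_mono always_eventually) blast
    moreover have "filterlim ?\<beta> (at_right 0) sequentially"
      unfolding filterlim_at
      using LIMSEQ_inverse_real_of_nat by (auto simp: inverse_eq_divide intro!: always_eventually)
    then have "Liminf (at_right 0) ?f \<le> liminf (\<lambda>n. ?f (?\<beta> n))"
      by (rule Liminf_at_right_le)
    ultimately have "Liminf (at_right 0) ?f \<le> 0" using elim(1) by simp
    then show ?case by simp
  qed
qed

end
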